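(* Let $(M,g)$ and $(N,\tilde g)$ be Riemannian manifolds and let $\pi:N\to M$ be a Riemannian submersion with totally geodesic fibers, and assume the horizontal distribution $\mathcal{H}N\subset TN$ to be bracket-generating. Let $\Delta_{\mathcal{H}}$ be the horizontal Laplacian on $N$ and $\Delta_M$ the Laplace--Beltrami operator on $M$. Then $$\Delta_{\mathcal{H}}(f\circ\pi)=(\Delta_M f)\circ\pi\qquad\text{for all } f\in C^\infty(M).$$
   Context: Let $d=\dim M$ and $l=\dim N-d$. Riemannian submersion: a smooth surjective map $\pi:(N,\tilde g)\to(M,g)$ such that for every $u\in N$ the restriction $d\pi_u:(\ker d\pi_u)^\perp\to T_{\pi(u)}M$ is a linear isomorphism and an isometry, where $\perp$ is with respect to $\tilde g$. Vertical and horizontal subspaces: $\mathcal{V}_uN=\ker d\pi_u$, $\mathcal{H}_uN=(\mathcal{V}_uN)^\perp$, with corresponding subbundles $\mathcal{V}N,\mathcal{H}N$ of $TN$. A vector field $X$ on $N$ decomposes as $X=X_{\mathcal{H}}+X_{\mathcal{V}}$. Totally geodesic fibers: for every $p\in M$, any geodesic in the fiber $N_p=\pi^{-1}(\{p\})$ (as a submanifold of $N$ with the induced metric) is also a geodesic in $N$. Bracket-generating: a distribution $\Lambda\subset TN$ is bracket-generating if $TN$ is generated by finitely many (iterated) Lie brackets of vector fields in $\Gamma(\Lambda)$. Horizontal Laplacian: $\Delta_{\mathcal{H}}$ is the generator of the pre-Dirichlet form $\mathcal{E}_{\mathcal{H}}(f,h)=-\int_N\langle(\mathrm{grad} f)_{\mathcal{H}},(\mathrm{grad}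 h)_{\mathcal{H}}\rangle_{\tilde g}\,d\mathrm{Vol}_{\tilde g}$, i.e. $\int_N h\,\Delta_{\mathcal{H}}f\,d\mathrm{Vol}_{\tilde g}=\mathcal{E}_{\mathcal{H}}(f,h)$ for $f,h\in C_c^\infty(N)$. In local orthonormal frames $\{E_i\}_{1\le i\le d}$ of $\mathcal{H}N$ and $\{F_j\}_{1\le j\le l}$ of $\mathcal{V}N$, with $\nabla$ the Levi-Civita connection of $N$, $$\Delta_{\mathcal{H}}=\sum_{i=1}^d\big(E_i^2-(\nabla_{E_i}E_i)_{\mathcal{H}}\big)-\sum_{j=1}^l(\nabla_{F_j}F_j)_{\mathcal{H}},$$ a formula which defines $\Delta_{\mathcal{H}}$ on all of $C^\infty(N)$. *)

theory Defs
  imports "HOL-Analysis.Analysis"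
begin

section \<open>Smooth maps on open subsets of a finite-dimensional vector space\<close>

text \<open>
  Manifolds are modelled on a linear subspace \<open>V\<close> of a Euclidean space, and not on a whole type of
  class \<^class>\<open>euclidean_space\<close>: types of that class have positive dimension, whereas
  zero-dimensional manifolds must not be excluded (the fibers of a Riemannian covering are such).
  Moreover, a fiber can then be modelled on a subspace of the type used for the total space.

  A map on a relatively open \<open>U \<subseteq> V\<close> is smooth if its iterated directional derivatives, in
  directions from \<open>V\<close>, all exist and are continuous on \<open>U\<close>.
\<close>

definition dird :: "('e::real_normed_vector \<Rightarrow> 'w::real_normed_vector) \<Rightarrow> 'e \<Rightarrow> 'e \<Rightarrow> 'w" where
  "dird f x v = vector_derivative (\<lambda>t::real. f (x + t *\<^sub>R v)) (at 0)"

primrec Ck_on ::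
  "nat \<Rightarrow> 'e::real_normed_vector set \<Rightarrow> 'e set \<Rightarrow> ('e \<Rightarrow> 'w::real_normed_vector) \<Rightarrow> bool" where
  "Ck_on 0 V U f \<longleftrightarrow> continuous_on U f"
| "Ck_on (Suc k) V U f \<longleftrightarrow>
     continuous_on U f \<and>
     (\<forall>v\<in>V. (\<forall>x\<in>U. (\<lambda>t::real. f (x + t *\<^sub>R v)) differentiable (at 0)) \<and>
             Ck_on k V U (\<lambda>x. dird f x v))"

definition Cinf_on ::
  "'e::real_normed_vector set \<Rightarrow> 'e set \<Rightarrow> ('e \<Rightarrow> 'w::real_normed_vector) \<Rightarrow> bool" where
  "Cinf_on V U f \<longleftrightarrow> (\<forall>k. Ck_on k V U f)"


section \<open>Manifolds\<close>

type_synonym ('a, 'e) chart = "'a set \<times> ('a \<Rightarrow> 'e)"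

text \<open>
  The tangent space at \<open>p\<close> is the model space: a tangent vector is given by its components in a
  preferred chart \<open>chart_at M p\<close> around \<open>p\<close>. In particular \<open>metric M p v w\<close> is the inner product
  of the tangent vectors at \<open>p\<close> with components \<open>v\<close> and \<open>w\<close> in that chart, and a vector field is
  a function \<open>'a \<Rightarrow> 'e\<close>. Components in other charts are given by \<open>comps\<close> below.
\<close>

record ('a, 'e) riem =
  mtop :: "'a topology"
  model :: "'e set"
  atlas :: "('a, 'e) chart set"
  metric :: "'a \<Rightarrow> 'e \<Rightarrow> 'e \<Rightarrow> real"

abbreviation points :: "('a, 'e) riem \<Rightarrow> 'a set" where
  "points M \<equiv> topspace (mtop M)"

definition mdim :: "('a, 'e::euclidean_space) riem \<Rightarrow> nat" where
  "mdim M = dim (model M)"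

definition cinv :: "('a, 'e) chart \<Rightarrow> 'e \<Rightarrow> 'a" where
  "cinv c = inv_into (fst c) (snd c)"

definition smooth_manifold :: "('a, 'e::euclidean_space) riem \<Rightarrow> bool" where
  "smooth_manifold M \<longleftrightarrow>
     Hausdorff_space (mtop M) \<and> second_countable (mtop M) \<and> subspace (model M) \<and>
     (\<Union>c\<in>atlas M. fst c) = points M \<and>
     (\<forall>c\<in>atlas M.
        openin (mtop M) (fst c) \<and>
        openin (top_of_set (model M)) (snd c ` fst c) \<and>
        homeomorphic_map (subtopology (mtop M) (fst c)) (top_of_set (snd c ` fst c)) (snd c)) \<and>
     (\<forall>c\<in>atlas M. \<forall>c'\<in>atlas M.
        Cinf_on (model M) (snd c ` (fst c \<inter> fst c')) (snd c' \<circ> cinv c))"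

definition chart_at :: "('a, 'e) riem \<Rightarrow> 'a \<Rightarrow> ('a, 'e) chart" where
  "chart_at M p = (SOME c. c \<in> atlas M \<and> p \<in> fst c)"

definition smooth_fun ::
  "('a, 'e::euclidean_space) riem \<Rightarrow> 'a set \<Rightarrow> ('a \<Rightarrow> 'w::real_normed_vector) \<Rightarrow> bool" where
  "smooth_fun M W f \<longleftrightarrow>
     (\<forall>c\<in>atlas M. Cinf_on (model M) (snd c ` (fst c \<inter> W)) (f \<circ> cinv c))"

definition smooth_map ::
  "('a, 'e::euclidean_space) riem \<Rightarrow> ('b, 'f::euclidean_space) riem \<Rightarrow> ('a \<Rightarrow> 'b) \<Rightarrow> bool" where
  "smooth_map M N h \<longleftrightarrow>
     continuous_map (mtop M) (mtop N) h \<and>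
     (\<forall>c\<in>atlas M. \<forall>c'\<in>atlas N.
        Cinf_on (model M) (snd c ` (fst c \<inter> h -` fst c')) (snd c' \<circ> h \<circ> cinv c))"

text \<open>The differential at \<open>p\<close> of a real-valued function, and of a map between manifolds.\<close>

definition dfun :: "('a, 'e::euclidean_space) riem \<Rightarrow> ('a \<Rightarrow> real) \<Rightarrow> 'a \<Rightarrow> 'e \<Rightarrow> real" where
  "dfun M f p v = (let c = chart_at M p in dird (f \<circ> cinv c) (snd c p) v)"

definition dmap ::
  "('a, 'e::euclidean_space) riem \<Rightarrow> ('b, 'f::euclidean_space) riem \<Rightarrow> ('a \<Rightarrow> 'b) \<Rightarrow> 'a \<Rightarrow> 'e \<Rightarrow> 'f"
  where
  "dmap M N h p v =
     (let c = chart_at M p; c' = chart_at N (h p) in dird (snd c' \<circ> h \<circ> cinv c) (snd c p) v)"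

text \<open>
  \<open>comps M c p v\<close> are the components in the chart \<open>c\<close> of the tangent vector \<open>v\<close> at \<open>p\<close>;
  \<open>tvec M c p\<close> is the inverse operation.
\<close>

definition comps :: "('a, 'e::euclidean_space) riem \<Rightarrow> ('a, 'e) chart \<Rightarrow> 'a \<Rightarrow> 'e \<Rightarrow> 'e" where
  "comps M c p v = (let c0 = chart_at M p in dird (snd c \<circ> cinv c0) (snd c0 p) v)"

definition tvec :: "('a, 'e::euclidean_space) riem \<Rightarrow> ('a, 'e) chart \<Rightarrow> 'a \<Rightarrow> 'e \<Rightarrow> 'e" where
  "tvec M c p a = (let c0 = chart_at M p in dird (snd c0 \<circ> cinv c) (snd c p) a)"

text \<open>Vector fields, in local coordinates.\<close>

definition vrep :: "('a, 'e::euclidean_space) riem \<Rightarrow> ('a, 'e) chart \<Rightarrow> ('a \<Rightarrow> 'e) \<Rightarrow> 'e \<Rightarrow> 'e" where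
  "vrep M c X x = comps M c (cinv c x) (X (cinv c x))"

definition smooth_vf :: "('a, 'e::euclidean_space) riem \<Rightarrow> 'a set \<Rightarrow> ('a \<Rightarrow> 'e) \<Rightarrow> bool" where
  "smooth_vf M W X \<longleftrightarrow>
     (\<forall>p\<in>W. X p \<in> model M) \<and>
     (\<forall>c\<in>atlas M. Cinf_on (model M) (snd c ` (fst c \<inter> W)) (vrep M c X))"

definition vf_app :: "('a, 'e::euclidean_space) riem \<Rightarrow> ('a \<Rightarrow> 'e) \<Rightarrow> ('a \<Rightarrow> real) \<Rightarrow> 'a \<Rightarrow> real" where
  "vf_app M X f p = dfun M f p (X p)"

definition lie_bracket ::
  "('a, 'e::euclidean_space) riem \<Rightarrow> ('a \<Rightarrow> 'e) \<Rightarrow> ('a \<Rightarrow> 'e) \<Rightarrow> 'a \<Rightarrow> 'e" where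
  "lie_bracket M X Y p =
     (let c = chart_at M p in
        dird (vrep M c Y) (snd c p) (X p) - dird (vrep M c X) (snd c p) (Y p))"


section \<open>Riemannian geometry\<close>

text \<open>The components \<open>g\<^sub>x(a, b)\<close> of the metric in the chart \<open>c\<close>.\<close>

definition gcomp :: "('a, 'e::euclidean_space) riem \<Rightarrow> ('a, 'e) chart \<Rightarrow> 'e \<Rightarrow> 'e \<Rightarrow> 'e \<Rightarrow> real" where
  "gcomp M c x a b =
     (let p = cinv c x in metric M p (tvec M c p a) (tvec M c p b))"

definition riemannian_manifold :: "('a, 'e::euclidean_space) riem \<Rightarrow> bool" where
  "riemannian_manifold M \<longleftrightarrow>
     smooth_manifold M \<and>
     (\<forall>p\<in>points M.
        (\<forall>u\<in>model M. \<forall>v\<in>model M. \<forall>w\<in>model M. \<forall>r s.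
           metric M p (r *\<^sub>R u + s *\<^sub>R v) w = r * metric M p u w + s * metric M p v w) \<and>
        (\<forall>v\<in>model M. \<forall>w\<in>model M. metric M p v w = metric M p w v) \<and>
        (\<forall>v\<in>model M. v \<noteq> 0 \<longrightarrow> metric M p v v > 0)) \<and>
     (\<forall>c\<in>atlas M. \<forall>a\<in>model M. \<forall>b\<in>model M.
        Cinf_on (model M) (snd c ` fst c) (\<lambda>x. gcomp M c x a b))"

text \<open>
  Christoffel symbols as a bilinear map: \<open>christoffel M c x a b\<close> has the components
  \<open>\<Gamma>\<^sup>k\<^bsub>ij\<^esub> a\<^sup>i b\<^sup>j\<close> at the coordinate point \<open>x\<close> (Koszul's formula for coordinate vector fields).
\<close>

definition christoffel :: "('a, 'e::euclidean_space) riem \<Rightarrow> ('a, 'e) chart \<Rightarrow> 'e \<Rightarrow> 'e \<Rightarrow> 'e \<Rightarrow> 'e" where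
  "christoffel M c x a b =
     (THE w. w \<in> model M \<and>
        (\<forall>z\<in>model M. gcomp M c x w z =
           (dird (\<lambda>y. gcomp M c y b z) x a + dird (\<lambda>y. gcomp M c y a z) x b
            - dird (\<lambda>y. gcomp M c y a b) x z) / 2))"

text \<open>The Levi-Civita covariant derivative \<open>(\<nabla>\<^sub>v Y)(p)\<close> of a vector field along a tangent vector.\<close>

definition cov :: "('a, 'e::euclidean_space) riem \<Rightarrow> 'e \<Rightarrow> ('a \<Rightarrow> 'e) \<Rightarrow> 'a \<Rightarrow> 'e" where
  "cov M v Y p =
     (let c = chart_at M p in
        dird (vrep M c Y) (snd c p) v + christoffel M c (snd c p) v (Y p))"

definition smooth_curve :: "('a, 'e::euclidean_space) riem \<Rightarrow> real set \<Rightarrow> (real \<Rightarrow> 'a) \<Rightarrow> bool" where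
  "smooth_curve M I \<gamma> \<longleftrightarrow>
     continuous_map (top_of_set I) (mtop M) \<gamma> \<and>
     (\<forall>c\<in>atlas M. Cinf_on UNIV (I \<inter> \<gamma> -` fst c) (snd c \<circ> \<gamma>))"

definition geodesic :: "('a, 'e::euclidean_space) riem \<Rightarrow> real set \<Rightarrow> (real \<Rightarrow> 'a) \<Rightarrow> bool" where
  "geodesic M I \<gamma> \<longleftrightarrow>
     open I \<and> is_interval I \<and> smooth_curve M I \<gamma> \<and>
     (\<forall>c\<in>atlas M. \<forall>t\<in>I. \<gamma> t \<in> fst c \<longrightarrow>
        (let x = snd c \<circ> \<gamma>; x' = (\<lambda>s. vector_derivative x (at s)) in
           vector_derivative x' (at t) + christoffel M c (x t) (x' t) (x' t) = 0))"

definition grad :: "('a, 'e::euclidean_space) riem \<Rightarrow> ('a \<Rightarrow> real) \<Rightarrow> 'a \<Rightarrow> 'e" where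
  "grad M f p =
     (THE v. v \<in> model M \<and> (\<forall>w\<in>model M. metric M p v w = dfun M f p w))"

definition orthonormal_basis :: "('a, 'e::euclidean_space) riem \<Rightarrow> 'a \<Rightarrow> 'e set \<Rightarrow> bool" where
  "orthonormal_basis M p B \<longleftrightarrow>
     finite B \<and> B \<subseteq> model M \<and> card B = mdim M \<and>
     (\<forall>e\<in>B. \<forall>e'\<in>B. metric M p e e' = (if e = e' then 1 else 0))"

text \<open>The divergence is the trace of \<open>v \<mapsto> \<nabla>\<^sub>v X\<close>; it does not depend on the basis.\<close>

definition divergence :: "('a, 'e::euclidean_space) riem \<Rightarrow> ('a \<Rightarrow> 'e) \<Rightarrow> 'a \<Rightarrow> real" where
  "divergence M X p =
     (THE r. \<forall>B. orthonormal_basis M p B \<longrightarrow> r = (\<Sum>e\<in>B. metric M p (cov M e X p) e))"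

definition laplace_beltrami :: "('a, 'e::euclidean_space) riem \<Rightarrow> ('a \<Rightarrow> real) \<Rightarrow> 'a \<Rightarrow> real" where
  "laplace_beltrami M f = divergence M (grad M f)"


section \<open>Riemannian submersions\<close>

definition vertical ::
  "('b, 'f::euclidean_space) riem \<Rightarrow> ('a, 'e::euclidean_space) riem \<Rightarrow> ('b \<Rightarrow> 'a) \<Rightarrow> 'b \<Rightarrow> 'f set" where
  "vertical N M \<pi> u = {v \<in> model N. dmap N M \<pi> u v = 0}"

definition horizontal ::
  "('b, 'f::euclidean_space) riem \<Rightarrow> ('a, 'e::euclidean_space) riem \<Rightarrow> ('b \<Rightarrow> 'a) \<Rightarrow> 'b \<Rightarrow> 'f set" where
  "horizontal N M \<pi> u = {v \<in> model N. \<forall>w\<in>vertical N M \<pi> u. metric N u v w = 0}"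

definition hpart ::
  "('b, 'f::euclidean_space) riem \<Rightarrow> ('a, 'e::euclidean_space) riem \<Rightarrow> ('b \<Rightarrow> 'a) \<Rightarrow> 'b \<Rightarrow> 'f \<Rightarrow> 'f" where
  "hpart N M \<pi> u v = (THE h. h \<in> horizontal N M \<pi> u \<and> v - h \<in> vertical N M \<pi> u)"

text \<open>Linearity of the differential is automatic for smooth maps.\<close>

definition riemannian_submersion ::
  "('b, 'f::euclidean_space) riem \<Rightarrow> ('a, 'e::euclidean_space) riem \<Rightarrow> ('b \<Rightarrow> 'a) \<Rightarrow> bool" where
  "riemannian_submersion N M \<pi> \<longleftrightarrow>
     smooth_map N M \<pi> \<and> \<pi> ` points N = points M \<and>
     (\<forall>u\<in>points N.
        bij_betw (dmap N M \<pi> u) (horizontal N M \<pi> u) (model M) \<and>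
        (\<forall>v\<in>horizontal N M \<pi> u. \<forall>w\<in>horizontal N M \<pi> u.
           metric M (\<pi> u) (dmap N M \<pi> u v) (dmap N M \<pi> u w) = metric N u v w))"

text \<open>\<open>F\<close> is the set \<open>S\<close> as an embedded submanifold of \<open>N\<close>, with the induced metric.\<close>

definition riem_submanifold ::
  "('b, 'f::euclidean_space) riem \<Rightarrow> 'b set \<Rightarrow> ('b, 'f) riem \<Rightarrow> bool" where
  "riem_submanifold N S F \<longleftrightarrow>
     riemannian_manifold F \<and> S \<subseteq> points N \<and> mtop F = subtopology (mtop N) S \<and>
     smooth_map F N (\<lambda>q. q) \<and>
     (\<forall>q\<in>S. inj_on (dmap F N (\<lambda>q. q) q) (model F) \<and>
        (\<forall>v\<in>model F. \<forall>w\<in>model F.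
           metric F q v w = metric N q (dmap F N (\<lambda>q. q) q v) (dmap F N (\<lambda>q. q) q w)))"

definition totally_geodesic_fibers ::
  "('b, 'f::euclidean_space) riem \<Rightarrow> ('a, 'e::euclidean_space) riem \<Rightarrow> ('b \<Rightarrow> 'a) \<Rightarrow> bool" where
  "totally_geodesic_fibers N M \<pi> \<longleftrightarrow>
     (\<forall>p\<in>points M. \<forall>F. riem_submanifold N {u \<in> points N. \<pi> u = p} F \<longrightarrow>
        (\<forall>I \<gamma>. geodesic F I \<gamma> \<longrightarrow> geodesic N I \<gamma>))"

text \<open>A distribution is given by its fibers \<open>\<Lambda> u \<subseteq> T\<^sub>u N\<close>.\<close>

inductive_set iterated_brackets ::
  "('b, 'f::euclidean_space) riem \<Rightarrow> ('b \<Rightarrow> 'f set) \<Rightarrow> ('b \<Rightarrow> 'f) set"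
  for N :: "('b, 'f::euclidean_space) riem" and \<Lambda> :: "'b \<Rightarrow> 'f set" where
  base: "smooth_vf N (points N) X \<Longrightarrow> (\<And>u. u \<in> points N \<Longrightarrow> X u \<in> \<Lambda> u) \<Longrightarrow>
    X \<in> iterated_brackets N \<Lambda>"
| bracket: "X \<in> iterated_brackets N \<Lambda> \<Longrightarrow> Y \<in> iterated_brackets N \<Lambda> \<Longrightarrow>
    lie_bracket N X Y \<in> iterated_brackets N \<Lambda>"

definition bracket_generating ::
  "('b, 'f::euclidean_space) riem \<Rightarrow> ('b \<Rightarrow> 'f set) \<Rightarrow> bool" where
  "bracket_generating N \<Lambda> \<longleftrightarrow>
     (\<forall>u\<in>points N. \<exists>\<B>. finite \<B> \<and> \<B> \<subseteq> iterated_brackets N \<Lambda> \<and>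
        span ((\<lambda>X. X u) ` \<B>) = model N)"


section \<open>The horizontal Laplacian\<close>

definition adapted_frame ::
  "('b, 'f::euclidean_space) riem \<Rightarrow> ('a, 'e::euclidean_space) riem \<Rightarrow> ('b \<Rightarrow> 'a) \<Rightarrow> 'b set \<Rightarrow>
   (nat \<Rightarrow> 'b \<Rightarrow> 'f) \<Rightarrow> (nat \<Rightarrow> 'b \<Rightarrow> 'f) \<Rightarrow> bool" where
  "adapted_frame N M \<pi> W E F \<longleftrightarrow>
     (\<forall>i<mdim M. smooth_vf N W (E i) \<and> (\<forall>q\<in>W. E i q \<in> horizontal N M \<pi> q)) \<and>
     (\<forall>j<mdim N - mdim M. smooth_vf N W (F j) \<and> (\<forall>q\<in>W. F j q \<in> vertical N M \<pi> q)) \<and>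
     (\<forall>q\<in>W.
        (\<forall>i<mdim M. \<forall>i'<mdim M. metric N q (E i q) (E i' q) = (if i = i' then 1 else 0)) \<and>
        (\<forall>j<mdim N - mdim M. \<forall>j'<mdim N - mdim M.
           metric N q (F j q) (F j' q) = (if j = j' then 1 else 0)))"

definition hlap_in_frame ::
  "('b, 'f::euclidean_space) riem \<Rightarrow> ('a, 'e::euclidean_space) riem \<Rightarrow> ('b \<Rightarrow> 'a) \<Rightarrow>
   (nat \<Rightarrow> 'b \<Rightarrow> 'f) \<Rightarrow> (nat \<Rightarrow> 'b \<Rightarrow> 'f) \<Rightarrow> ('b \<Rightarrow> real) \<Rightarrow> 'b \<Rightarrow> real" where
  "hlap_in_frame N M \<pi> E F f u =
     (\<Sum>i<mdim M. vf_app N (E i) (vf_app N (E i) f) u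
                  - dfun N f u (hpart N M \<pi> u (cov N (E i u) (E i) u)))
     - (\<Sum>j<mdim N - mdim M. dfun N f u (hpart N M \<pi> u (cov N (F j u) (F j) u)))"

text \<open>
  The value at \<open>u\<close> is the common value of the frame formula in all adapted orthonormal frames
  around \<open>u\<close>; this also makes sense for functions without compact support.
\<close>

definition horizontal_laplacian ::
  "('b, 'f::euclidean_space) riem \<Rightarrow> ('a, 'e::euclidean_space) riem \<Rightarrow> ('b \<Rightarrow> 'a) \<Rightarrow>
   ('b \<Rightarrow> real) \<Rightarrow> 'b \<Rightarrow> real" where
  "horizontal_laplacian N M \<pi> f u =
     (THE r. \<forall>W E F. openin (mtop N) W \<and> u \<in> W \<and> adapted_frame N M \<pi> W E F \<longrightarrow>
        r = hlap_in_frame N M \<pi> E F f u)"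

end

theory Submission
  imports Defs
begin

text \<open>
  In coordinates \<open>\<pi>\<close> becomes a map \<open>\<phi>\<close> with differential \<open>D\<close> at the given point. For a function of
  the form \<open>f \<circ> \<pi>\<close> the frame formula only involves \<open>D\<close> of the covariant derivatives of the frame,
  so everything reduces to the second fundamental form
  \<open>II(e, e) = \<phi>''(e, e) - D \<Gamma>\<^sup>N(e, e) + \<Gamma>\<^sup>M(De, De)\<close> of \<open>\<pi>\<close>.

  For horizontal \<open>e\<close> it vanishes: \<open>G\<^sup>N - \<phi>\<^sup>*G\<^sup>M\<close> is positive semidefinite with the horizontal vectors
  in its kernel, so its first derivatives vanish on horizontal vectors, and Koszul's formula applies.
  Hence the horizontal part of the frame formula is the trace of the Hessian of \<open>f\<close> in the orthonormal
  basis \<open>D E\<^sub>i\<close>, which is the Laplace-Beltrami operator.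

  For vertical \<open>e\<close> it vanishes because the fiber geodesic with initial velocity \<open>e\<close> is a geodesic of \<open>N\<close>
  along which \<open>\<phi>\<close> is constant. This requires the fibers as submanifolds (inverse function theorem) and
  the existence of geodesics (Picard iteration). Since the horizontal Laplacian is defined as the common
  value over all adapted frames, such a frame must also be constructed, by Gram-Schmidt.
\<close>

section \<open>Calculus on relatively open subsets of a subspace\<close>

text \<open>Three features of the definitions shape the proof. Smoothness is phrased by iterated
  directional derivatives along a subspace, so Frechet derivatives have to be recovered, by
  composing with the orthogonal projection onto that subspace. Christoffel symbols, gradients,
  divergences and horizontal parts are definite descriptions, usable only once existence and
  uniqueness are known; a Riesz lemma for inner products on a subspace, together with its smooth
  dependence on parameters, serves this purpose throughout. Finally, the hypothesis on the fibers
  speaks of Riemannian submanifold structures \<open>F\<close> on a fiber and gives information only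
  after such an \<open>F\<close> has been built; its atlas may be any compatible one, and this
  freedom is used when geodesics are constructed.

  Everything is computed at one point \<open>u\<close>, in the preferred charts at \<open>u\<close>
  and at its image, because there a tangent vector coincides with its components. The frame formula
  contains only diagonal terms of the second fundamental form, so a single geodesic through
  \<open>u\<close> for each vertical vector is enough.\<close>

definition onb :: "'e::euclidean_space set \<Rightarrow> 'e set" where
  "onb V = (SOME B. B \<subseteq> V \<and> pairwise orthogonal B \<and> (\<forall>b\<in>B. norm b = 1) \<and>
     independent B \<and> card B = dim V \<and> span B = V)"

text \<open>The Euclidean orthogonal projection onto \<open>V\<close>; it has nothing to do with the
  Riemannian metric. Precomposing with it extends a function from a relatively open subset of
  \<open>V\<close> to an open subset of the whole space, where Frechet derivatives make
  sense.\<close>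

definition oproj :: "'e::euclidean_space set \<Rightarrow> 'e \<Rightarrow> 'e" where
  "oproj V x = (\<Sum>b\<in>onb V. (x \<bullet> b) *\<^sub>R b)"

lemma onb_props:
  assumes "subspace V"
  shows "onb V \<subseteq> V" "pairwise orthogonal (onb V)" "\<And>b. b \<in> onb V \<Longrightarrow> norm b = 1"
    "independent (onb V)" "card (onb V) = dim V" "span (onb V) = V" "finite (onb V)"
proof -
  have "\<exists>B. B \<subseteq> V \<and> pairwise orthogonal B \<and> (\<forall>b\<in>B. norm b = 1) \<and>
     independent B \<and> card B = dim V \<and> span B = V"
    using orthonormal_basis_subspace[OF assms] by metis
  from someI_ex[OF this, folded onb_def]
  show "onb V \<subseteq> V" "pairwise orthogonal (onb V)" "\<And>b. b \<in> onb V \<Longrightarrow> norm b = 1"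
    "independent (onb V)" "card (onb V) = dim V" "span (onb V) = V"
    by blast+
  then show "finite (onb V)" using independent_imp_finite by blast
qed

lemma onb_inner:
  assumes "subspace V" "b \<in> onb V" "c \<in> onb V"
  shows "b \<bullet> c = (if b = c then 1 else 0)"
  using onb_props(2,3)[OF assms(1)] assms(2,3)
  by (auto simp: pairwise_def orthogonal_def norm_eq_1)

lemma oproj_in: "subspace V \<Longrightarrow> oproj V x \<in> V"
  unfolding oproj_def using onb_props(1) by (intro subspace_sum subspace_scale) auto

lemma linear_oproj: "linear (oproj V)"
  unfolding oproj_def by (intro linearI) (simp_all add: inner_add_left scaleR_add_left sum.distrib scaleR_sum_right)

lemma bounded_linear_oproj: "bounded_linear (oproj V)"
  using linear_oproj by (simp add: linear_conv_bounded_linear)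

lemma inner_oproj_onb:
  assumes "subspace V" "c \<in> onb V"
  shows "oproj V x \<bullet> c = x \<bullet> c"
proof -
  have "oproj V x \<bullet> c = (\<Sum>b\<in>onb V. (x \<bullet> b) * (b \<bullet> c))"
    by (simp add: oproj_def inner_sum_left)
  also have "\<dots> = (\<Sum>b\<in>onb V. if b = c then x \<bullet> b else 0)"
    using onb_inner[OF assms(1) _ assms(2)] by (intro sum.cong) auto
  finally show ?thesis using assms onb_props(7)[OF assms(1)] by (simp add: sum.delta)
qed

lemma oproj_orth:
  assumes "subspace V" "w \<in> V"
  shows "(x - oproj V x) \<bullet> w = 0"
proof -
  have "orthogonal (x - oproj V x) w"
  proof (rule orthogonal_to_span)
    show "w \<in> span (onb V)" using assms onb_props(6)[OF assms(1)] by simp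
    show "orthogonal (x - oproj V x) c" if "c \<in> onb V" for c
      using inner_oproj_onb[OF assms(1) that] by (simp add: orthogonal_def inner_diff_left)
  qed
  then show ?thesis by (simp add: orthogonal_def)
qed

lemma oproj_id:
  assumes "subspace V" "x \<in> V"
  shows "oproj V x = x"
proof -
  have "(x - oproj V x) \<bullet> (x - oproj V x) = 0"
    using assms oproj_in by (intro oproj_orth subspace_diff) auto
  then show ?thesis by simp
qed

lemma onb_expand: "subspace V \<Longrightarrow> x \<in> V \<Longrightarrow> x = (\<Sum>b\<in>onb V. (x \<bullet> b) *\<^sub>R b)"
  using oproj_id[of V x] by (simp add: oproj_def)

lemma linear_on_expand:
  fixes l :: "'e::euclidean_space \<Rightarrow> 'w::real_vector"
  assumes V: "subspace V" and x: "x \<in> V"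
    and lin: "\<And>a b r s. a \<in> V \<Longrightarrow> b \<in> V \<Longrightarrow> l (r *\<^sub>R a + s *\<^sub>R b) = r *\<^sub>R l a + s *\<^sub>R l b"
  shows "l x = (\<Sum>b\<in>onb V. (x \<bullet> b) *\<^sub>R l b)"
proof -
  have l0: "l 0 = 0" using lin[of 0 0 0 0] subspace_0[OF V] by simp
  have sub: "finite B \<Longrightarrow> B \<subseteq> onb V \<Longrightarrow> l (\<Sum>b\<in>B. (x \<bullet> b) *\<^sub>R b) = (\<Sum>b\<in>B. (x \<bullet> b) *\<^sub>R l b)" for B
  proof (induction B rule: finite_induct)
    case empty then show ?case using l0 by simp
  next
    case (insert c B)
    have "(\<Sum>b\<in>B. (x \<bullet> b) *\<^sub>R b) \<in> V" "c \<in> V"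
      using insert onb_props(1)[OF V] by (auto intro!: subspace_sum[OF V] subspace_scale[OF V])
    then show ?case using lin[of c "\<Sum>b\<in>B. (x \<bullet> b) *\<^sub>R b" "x \<bullet> c" 1] insert by simp
  qed
  from sub[OF onb_props(7)[OF V] subset_refl] show ?thesis
    using onb_expand[OF V x] by simp
qed

section \<open>Relatively open sets and the locality of directional derivatives\<close>

abbreviation relopen :: "'e::euclidean_space set \<Rightarrow> 'e set \<Rightarrow> bool" where
  "relopen V U \<equiv> subspace V \<and> openin (top_of_set V) U"

lemma relopen_ball:
  assumes "relopen V U" "x \<in> U"
  obtains r where "r > 0" "\<And>y. y \<in> V \<Longrightarrow> dist y x < r \<Longrightarrow> y \<in> U"
  using assms by (auto simp: openin_euclidean_subtopology_iff)

lemma relopen_subset: "relopen V U \<Longrightarrow> U \<subseteq> V"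
  by (auto dest: openin_imp_subset)

lemma relopen_eventually_line:
  assumes "relopen V U" "x \<in> U" "v \<in> V"
  shows "\<forall>\<^sub>F t in nhds (0::real). x + t *\<^sub>R v \<in> U"
proof -
  obtain r where r: "r > 0" "\<And>y. y \<in> V \<Longrightarrow> dist y x < r \<Longrightarrow> y \<in> U"
    using relopen_ball[OF assms(1,2)] by blast
  have "((\<lambda>t::real. x + t *\<^sub>R v) \<longlongrightarrow> x + 0 *\<^sub>R v) (nhds 0)"
    by (intro tendsto_intros filterlim_ident)
  then have "\<forall>\<^sub>F t in nhds (0::real). dist (x + t *\<^sub>R v) x < r"
    using r(1) by (auto dest: tendstoD)
  then show ?thesis
    by (rule eventually_mono) (use assms relopen_subset[OF assms(1)] r(2) in \<open>auto intro!: r(2) subspace_add subspace_scale\<close>)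
qed

lemma dird_eqI: "((\<lambda>t::real. f (x + t *\<^sub>R v)) has_vector_derivative d) (at 0) \<Longrightarrow> dird f x v = d"
  unfolding dird_def by (rule vector_derivative_at)

lemma dird_works:
  "(\<lambda>t::real. f (x + t *\<^sub>R v)) differentiable (at 0) \<Longrightarrow>
    ((\<lambda>t::real. f (x + t *\<^sub>R v)) has_vector_derivative dird f x v) (at 0)"
  unfolding dird_def by (simp add: vector_derivative_works)

text \<open>A line in a direction of \<open>V\<close> stays in \<open>V\<close>, hence in
  \<open>U\<close> for small parameters. Values outside \<open>U\<close> are therefore irrelevant,
  which matters because representatives built from \<open>cinv\<close> are arbitrary there.\<close>

lemma dird_cong:
  assumes ro: "relopen V U" "x \<in> U" "v \<in> V" and eq: "\<And>y. y \<in> U \<Longrightarrow> f y = g y"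
  shows "dird f x v = dird g x v"
  unfolding dird_def
  using relopen_eventually_line[OF ro] eq
  by (intro vector_derivative_cong_eq) (auto elim: eventually_mono)

lemma differentiable_line_cong:
  assumes ro: "relopen V U" "x \<in> U" "v \<in> V" and eq: "\<And>y. y \<in> U \<Longrightarrow> f y = g y"
    and "(\<lambda>t::real. f (x + t *\<^sub>R v)) differentiable (at 0)"
  shows "(\<lambda>t::real. g (x + t *\<^sub>R v)) differentiable (at 0)"
proof -
  have "((\<lambda>t::real. f (x + t *\<^sub>R v)) has_vector_derivative dird f x v) (at 0)"
    using assms dird_works by blast
  then have "((\<lambda>t::real. g (x + t *\<^sub>R v)) has_vector_derivative dird f x v) (at 0)"
    using relopen_eventually_line[OF ro] ro eq
    by (subst has_vector_derivative_cong_ev[where g="\<lambda>t. f (x + t *\<^sub>R v)"]) (auto elim: eventually_mono)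
  then show ?thesis using differentiableI_vector by blast
qed

lemma Ck_on_cong:
  assumes "relopen V U" "\<And>x. x \<in> U \<Longrightarrow> f x = g x" "Ck_on k V U f"
  shows "Ck_on k V U g"
  using assms
proof (induction k arbitrary: f g)
  case 0
  then show ?case using continuous_on_cong[of U U f g] by simp
next
  case (Suc k)
  have "Ck_on k V U (\<lambda>x. dird g x v)" if "v \<in> V" for v
    by (rule Suc.IH[of "\<lambda>x. dird f x v"]) (use Suc.prems that dird_cong[OF Suc.prems(1) _ that Suc.prems(2)] in auto)
  moreover have "(\<lambda>t::real. g (x + t *\<^sub>R v)) differentiable (at 0)" if "v \<in> V" "x \<in> U" for v x
    using differentiable_line_cong[OF Suc.prems(1) that(2,1), of f g] Suc.prems that by auto
  ultimately show ?case using Suc.prems continuous_on_cong[of U U f g] by simp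
qed

lemma Cinf_on_cong:
  "relopen V U \<Longrightarrow> (\<And>x. x \<in> U \<Longrightarrow> f x = g x) \<Longrightarrow> Cinf_on V U f \<Longrightarrow> Cinf_on V U g"
  unfolding Cinf_on_def using Ck_on_cong by blast

lemma Ck_on_subset: "Ck_on k V U f \<Longrightarrow> W \<subseteq> U \<Longrightarrow> Ck_on k V W f"
  by (induction k arbitrary: f) (auto intro: continuous_on_subset)

lemma Ck_on_continuous: "Ck_on k V U f \<Longrightarrow> continuous_on U f"
  by (cases k) auto

lemma Ck_on_Suc_lower: "Ck_on (Suc k) V U f \<Longrightarrow> Ck_on k V U f"
  by (induction k arbitrary: f) auto

lemma Ck_on_dird: "Ck_on (Suc k) V U f \<Longrightarrow> v \<in> V \<Longrightarrow> Ck_on k V U (\<lambda>x. dird f x v)"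
  by simp

lemma Cinf_on_Ck: "Cinf_on V U f \<Longrightarrow> Ck_on k V U f"
  by (simp add: Cinf_on_def)

lemma continuous_on_local:
  assumes ro: "relopen V U"
    and loc: "\<And>x. x \<in> U \<Longrightarrow> \<exists>W. openin (top_of_set V) W \<and> x \<in> W \<and> continuous_on (U \<inter> W) f"
  shows "continuous_on U f"
  unfolding continuous_on_eq_continuous_within
proof
  fix x assume x: "x \<in> U"
  then obtain W where W: "openin (top_of_set V) W" "x \<in> W" "continuous_on (U \<inter> W) f" using loc by blast
  then obtain T where T: "open T" "W = V \<inter> T" by (auto simp: openin_open)
  have "U \<inter> W = U \<inter> T" using T relopen_subset[OF ro] by auto
  then have "continuous (at x within (U \<inter> T)) f" using W x by (auto simp: continuous_on_eq_continuous_within)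
  moreover have "at x within (U \<inter> T) = at x within U"
    using T W x by (intro at_within_nhd[of _ T]) auto
  ultimately show "continuous (at x within U) f" by simp
qed

lemma Ck_on_local:
  assumes ro: "relopen V U"
    and loc: "\<And>x. x \<in> U \<Longrightarrow> \<exists>W. openin (top_of_set V) W \<and> x \<in> W \<and> Ck_on k V (U \<inter> W) f"
  shows "Ck_on k V U f"
  using loc
proof (induction k arbitrary: f)
  case 0
  show ?case using continuous_on_local[OF ro, of f] 0[unfolded Ck_on.simps(1)] by simp
next
  case (Suc k)
  have "continuous_on U f"
  proof (rule continuous_on_local[OF ro])
    fix x assume "x \<in> U"
    then obtain W where "openin (top_of_set V) W" "x \<in> W" "Ck_on (Suc k) V (U \<inter> W) f"
      using Suc.prems by blast
    then show "\<exists>W. openin (top_of_set V) W \<and> x \<in> W \<and> continuous_on (U \<inter> W) f"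
      using Ck_on_continuous by blast
  qed
  moreover have "Ck_on k V U (\<lambda>x. dird f x v)" if "v \<in> V" for v
  proof (rule Suc.IH)
    fix x assume "x \<in> U"
    then obtain W where "openin (top_of_set V) W" "x \<in> W" "Ck_on (Suc k) V (U \<inter> W) f"
      using Suc.prems by blast
    then show "\<exists>W. openin (top_of_set V) W \<and> x \<in> W \<and> Ck_on k V (U \<inter> W) (\<lambda>x. dird f x v)"
      using Ck_on_dird[OF _ that] by blast
  qed
  moreover have "(\<lambda>t::real. f (x + t *\<^sub>R v)) differentiable (at 0)" if v: "v \<in> V" and x: "x \<in> U" for v x
  proof -
    obtain W where "x \<in> W" "Ck_on (Suc k) V (U \<inter> W) f" using Suc.prems[OF x] by blast
    then show ?thesis using v x by simp
  qed
  ultimately show ?case unfolding Ck_on.simps(2) by blast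
qed

lemma Ck_on_differentiable:
  "Ck_on (Suc k) V U f \<Longrightarrow> v \<in> V \<Longrightarrow> x \<in> U \<Longrightarrow> (\<lambda>t::real. f (x + t *\<^sub>R v)) differentiable (at 0)"
  by simp

lemma line_derivative:
  assumes f: "Ck_on (Suc k) V U f" and v: "v \<in> V" and y: "y + s *\<^sub>R v \<in> U"
  shows "((\<lambda>t. f (y + t *\<^sub>R v)) has_vector_derivative dird f (y + s *\<^sub>R v) v) (at s)"
proof -
  have "((\<lambda>t. f (y + s *\<^sub>R v + t *\<^sub>R v)) has_vector_derivative dird f (y + s *\<^sub>R v) v) (at 0)"
    using f y v by (intro dird_works) auto
  then have "((\<lambda>t. f (y + s *\<^sub>R v + (t - s) *\<^sub>R v)) has_vector_derivative 1 *\<^sub>R dird f (y + s *\<^sub>R v) v) (at s)"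
    by (intro vector_diff_chain_at[of "\<lambda>t. t - s" 1 s "\<lambda>t. f (y + s *\<^sub>R v + t *\<^sub>R v)", unfolded o_def])
      (auto intro!: derivative_eq_intros)
  moreover have "(\<lambda>t. f (y + s *\<^sub>R v + (t - s) *\<^sub>R v)) = (\<lambda>t. f (y + t *\<^sub>R v))"
    by (simp add: algebra_simps)
  ultimately show ?thesis by simp
qed

section \<open>Frechet differentiability and the chain rule\<close>

lemma orthogonal_norm_le: "orthogonal a b \<Longrightarrow> norm a \<le> norm (a + b)"
  by (rule power2_le_imp_le) (simp_all add: norm_add_Pythagorean)

text \<open>The classical argument that continuous partial derivatives imply differentiability, by
  induction over the basis vectors allowed in the increment. An increment in
  \<open>span (insert b B)\<close> is an increment in \<open>span B\<close>, covered by the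
  induction hypothesis, followed by a segment in direction \<open>b\<close>, covered by the mean
  value inequality.\<close>

lemma Ck1_linear_approx:
  fixes f :: "'e::euclidean_space \<Rightarrow> 'w::real_normed_vector"
  assumes ro: "relopen V U" and f: "Ck_on (Suc k) V U f" and x: "x \<in> U"
    and B: "B \<subseteq> onb V" and "\<epsilon> > 0"
  shows "\<exists>\<delta>>0. \<forall>y\<in>V. \<forall>h\<in>span B. norm (y - x) < \<delta> \<and> norm h < \<delta> \<longrightarrow>
     norm (f (y + h) - f y - (\<Sum>b\<in>B. (h \<bullet> b) *\<^sub>R dird f x b)) \<le> \<epsilon> * norm h"
proof -
  have V: "subspace V" using ro by simp
  have "finite B" using B onb_props(7)[OF V] finite_subset by blast
  then show ?thesis using B \<open>\<epsilon> > 0\<close>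
  proof (induction B arbitrary: \<epsilon> rule: finite_induct)
    case empty
    then show ?case by (auto intro: exI[of _ 1])
  next
    case (insert b B)
    have bV: "b \<in> V" and nb: "norm b = 1"
      using insert onb_props[OF V] by auto
    obtain \<delta>1 where d1: "\<delta>1 > 0" "\<And>y h. y \<in> V \<Longrightarrow> h \<in> span B \<Longrightarrow> norm (y - x) < \<delta>1 \<Longrightarrow> norm h < \<delta>1 \<Longrightarrow>
      norm (f (y + h) - f y - (\<Sum>b\<in>B. (h \<bullet> b) *\<^sub>R dird f x b)) \<le> \<epsilon>/2 * norm h"
      using insert.IH[of "\<epsilon>/2"] insert.prems by fastforce
    obtain r where r: "r > 0" "\<And>y. y \<in> V \<Longrightarrow> dist y x < r \<Longrightarrow> y \<in> U"
      using relopen_ball[OF ro x] by blast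
    have "continuous_on U (\<lambda>x. dird f x b)" by (rule Ck_on_continuous[OF Ck_on_dird[OF f bV]])
    then obtain \<delta>2 where d2: "\<delta>2 > 0" "\<And>y. y \<in> U \<Longrightarrow> dist y x < \<delta>2 \<Longrightarrow> dist (dird f y b) (dird f x b) < \<epsilon>/2"
      using x insert.prems(2) unfolding continuous_on_iff by (meson half_gt_zero)
    \<comment> \<open>A point of the final segment is at distance at most
      \<open>norm (y - x) + norm h' + \<bar>s\<bar>\<close> from \<open>x\<close>; each of the three
      terms is below \<open>\<delta>\<close>, hence the thirds.\<close>
    define \<delta> where "\<delta> = Min {\<delta>1, r/3, \<delta>2/3}"
    have dpos: "\<delta> > 0" using d1(1) d2(1) r(1) by (simp add: \<delta>_def)
    have dle: "\<delta> \<le> \<delta>1" "3 * \<delta> \<le> r" "3 * \<delta> \<le> \<delta>2" by (auto simp: \<delta>_def min_def)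
    show ?case
    proof (intro exI conjI ballI impI)
      show "\<delta> > 0" by (rule dpos)
      fix y h assume y: "y \<in> V" and h: "h \<in> span (insert b B)" and small: "norm (y - x) < \<delta> \<and> norm h < \<delta>"
      define s where "s = h \<bullet> b"
      define h' where "h' = h - s *\<^sub>R b"
      obtain k where k: "h - k *\<^sub>R b \<in> span B" using h span_breakdown_eq by blast
      have "orthogonal b (h - k *\<^sub>R b)"
      proof (rule orthogonal_to_span[OF k])
        fix c assume "c \<in> B"
        then show "orthogonal b c"
          using onb_inner[OF V, of b c] insert.prems(1) insert.hyps by (auto simp: orthogonal_def)
      qed
      then have "k = s" using nb by (simp add: s_def orthogonal_def inner_diff_right norm_eq_1 inner_commute)
      then have h'B: "h' \<in> span B" using k by (simp add: h'_def)
      have ob: "orthogonal b h'" using \<open>orthogonal b (h - k *\<^sub>R b)\<close> \<open>k = s\<close> by (simp add: h'_def)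
      have hsum: "h = h' + s *\<^sub>R b" by (simp add: h'_def)
      have nh': "norm h' \<le> norm h" "\<bar>s\<bar> \<le> norm h"
        using orthogonal_norm_le[of h' "s *\<^sub>R b"] orthogonal_norm_le[of "s *\<^sub>R b" h'] ob nb
        by (simp_all add: hsum orthogonal_def inner_commute add.commute)
      have h'V: "h' \<in> V" using h'B insert.prems(1) onb_props(1)[OF V] V
        span_minimal[of B V] by auto
      have inU: "y + h' + \<tau> *\<^sub>R b \<in> U" "dist (y + h' + \<tau> *\<^sub>R b) x < \<delta>2" if "\<bar>\<tau>\<bar> \<le> \<bar>s\<bar>" for \<tau>
      proof -
        have "dist (y + h' + \<tau> *\<^sub>R b) x \<le> norm (y - x) + norm h' + norm (\<tau> *\<^sub>R b)"
          unfolding dist_norm using norm_triangle_ineq[of "y - x + h'" "\<tau> *\<^sub>R b"] norm_triangle_ineq[of "y-x" h']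
          by (simp add: algebra_simps)
        also have "\<dots> < 3 * \<delta>" using small nh' that nb by simp
        finally have *: "dist (y + h' + \<tau> *\<^sub>R b) x < 3 * \<delta>" .
        then show "dist (y + h' + \<tau> *\<^sub>R b) x < \<delta>2" using dle by simp
        show "y + h' + \<tau> *\<^sub>R b \<in> U"
          by (rule r(2)) (use * dle y h'V bV V in \<open>auto intro!: subspace_add subspace_scale\<close>)
      qed
      \<comment> \<open>With the linear term at \<open>x\<close> subtracted, the derivative of
        \<open>?g\<close> is a difference of two values of \<open>dird f _ b\<close>, which
        continuity bounds by \<open>\<epsilon>/2\<close>.\<close>
      let ?g = "\<lambda>\<tau>::real. f (y + h' + \<tau> *\<^sub>R b) - \<tau> *\<^sub>R dird f x b"
      have dg: "(?g has_derivative (\<lambda>u. u *\<^sub>R (dird f (y + h' + \<tau> *\<^sub>R b) b - dird f x b))) (at \<tau> within closed_segment 0 s)"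
        if "\<tau> \<in> closed_segment 0 s" for \<tau>
      proof -
        have ab: "\<bar>\<tau>\<bar> \<le> \<bar>s\<bar>" using that by (auto simp: closed_segment_eq_real_ivl split: if_splits)
        have "((\<lambda>t. f (y + h' + t *\<^sub>R b)) has_vector_derivative dird f (y + h' + \<tau> *\<^sub>R b) b) (at \<tau>)"
          by (rule line_derivative[OF f bV inU(1)[OF ab]])
        then have "(?g has_vector_derivative (dird f (y + h' + \<tau> *\<^sub>R b) b - dird f x b)) (at \<tau>)"
          by (auto intro!: derivative_eq_intros)
        then show ?thesis
          unfolding has_vector_derivative_def by (rule has_derivative_at_withinI)
      qed
      have "norm (?g s - ?g 0) \<le> \<epsilon>/2 * norm (s - 0)"
      proof (rule differentiable_bound[OF _ dg])
        fix \<tau> assume "\<tau> \<in> closed_segment 0 s"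
        then have ab: "\<bar>\<tau>\<bar> \<le> \<bar>s\<bar>" by (auto simp: closed_segment_eq_real_ivl split: if_splits)
        have "norm (dird f (y + h' + \<tau> *\<^sub>R b) b - dird f x b) \<le> \<epsilon>/2"
          using d2(2)[OF inU[OF ab]] by (simp add: dist_norm)
        then show "onorm (\<lambda>u. u *\<^sub>R (dird f (y + h' + \<tau> *\<^sub>R b) b - dird f x b)) \<le> \<epsilon>/2"
          by (intro onorm_le) (metis abs_ge_zero mult.commute mult_left_mono norm_scaleR real_norm_def)
      qed (auto simp: convex_closed_segment)
      then have 1: "norm (f (y + h) - f (y + h') - s *\<^sub>R dird f x b) \<le> \<epsilon>/2 * \<bar>s\<bar>"
        by (simp add: hsum algebra_simps)
      have 2: "norm (f (y + h') - f y - (\<Sum>b\<in>B. (h' \<bullet> b) *\<^sub>R dird f x b)) \<le> \<epsilon>/2 * norm h'"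
        by (rule d1(2)) (use y h'B small nh' dle in auto)
      have 3: "(\<Sum>b\<in>B. (h' \<bullet> b) *\<^sub>R dird f x b) = (\<Sum>b\<in>B. (h \<bullet> b) *\<^sub>R dird f x b)"
      proof (rule sum.cong[OF refl])
        fix c assume "c \<in> B"
        then have "b \<bullet> c = 0" using onb_inner[OF V, of b c] insert.prems(1) insert.hyps by auto
        then show "(h' \<bullet> c) *\<^sub>R dird f x c = (h \<bullet> c) *\<^sub>R dird f x c" by (simp add: h'_def inner_diff_left)
      qed
      have "f (y + h) - f y - (\<Sum>b\<in>insert b B. (h \<bullet> b) *\<^sub>R dird f x b)
        = (f (y + h) - f (y + h') - s *\<^sub>R dird f x b) + (f (y + h') - f y - (\<Sum>b\<in>B. (h' \<bullet> b) *\<^sub>R dird f x b))"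
        using insert.hyps by (simp add: 3 s_def)
      also have "norm \<dots> \<le> \<epsilon>/2 * \<bar>s\<bar> + \<epsilon>/2 * norm h'" using norm_triangle_mono[OF 1 2] .
      also have "\<dots> \<le> \<epsilon>/2 * norm h + \<epsilon>/2 * norm h"
        using nh' insert.prems(2) by (intro add_mono mult_left_mono) auto
      finally show "norm (f (y + h) - f y - (\<Sum>b\<in>insert b B. (h \<bullet> b) *\<^sub>R dird f x b)) \<le> \<epsilon> * norm h"
        by simp
    qed
  qed
qed

text \<open>The derivative is written as a sum over the basis because linearity of
  \<open>dird f x\<close> in the direction is not yet available; it is read off from this lemma
  afterwards. Projecting \<open>y - x\<close> to \<open>V\<close> does not increase its norm, so the
  estimate inside \<open>V\<close> carries over.\<close>

lemma Ck1_frechet: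
  fixes f :: "'e::euclidean_space \<Rightarrow> 'w::real_normed_vector"
  assumes ro: "relopen V U" and f: "Ck_on (Suc k) V U f" and x: "x \<in> U"
  shows "((\<lambda>y. f (oproj V y)) has_derivative (\<lambda>h. \<Sum>b\<in>onb V. (h \<bullet> b) *\<^sub>R dird f x b)) (at x)"
  unfolding has_derivative_at_alt
proof (intro conjI allI impI)
  have V: "subspace V" using ro by simp
  show "bounded_linear (\<lambda>h. \<Sum>b\<in>onb V. (h \<bullet> b) *\<^sub>R dird f x b)"
    by (intro bounded_linear_sum bounded_linear_scaleR_const bounded_linear_inner_left)
  fix e :: real assume "0 < e"
  from Ck1_linear_approx[OF ro f x subset_refl this]
  obtain \<delta> where d: "\<delta> > 0" "\<And>y h. y \<in> V \<Longrightarrow> h \<in> V \<Longrightarrow> norm (y - x) < \<delta> \<Longrightarrow> norm h < \<delta> \<Longrightarrow>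
     norm (f (y + h) - f y - (\<Sum>b\<in>onb V. (h \<bullet> b) *\<^sub>R dird f x b)) \<le> e * norm h"
    using onb_props(6)[OF V] by auto
  have xV: "x \<in> V" using x relopen_subset[OF ro] by auto
  show "\<exists>d>0. \<forall>y. norm (y - x) < d \<longrightarrow>
      norm (f (oproj V y) - f (oproj V x) - (\<Sum>b\<in>onb V. ((y - x) \<bullet> b) *\<^sub>R dird f x b)) \<le> e * norm (y - x)"
  proof (intro exI conjI allI impI)
    fix y assume y: "norm (y - x) < \<delta>"
    define h where "h = oproj V (y - x)"
    have hV: "h \<in> V" using oproj_in[OF V] by (simp add: h_def)
    have "orthogonal h (y - x - h)"
      using oproj_orth[OF V hV, of "y - x"] by (simp add: h_def orthogonal_def inner_commute)
    then have "norm h \<le> norm (h + (y - x - h))" by (rule orthogonal_norm_le)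
    then have nh: "norm h \<le> norm (y - x)" by simp
    have py: "oproj V y = x + h"
      using linear_diff[OF linear_oproj, of V y x] oproj_id[OF V xV] by (simp add: h_def)
    have hb: "(y - x) \<bullet> b = h \<bullet> b" if "b \<in> onb V" for b
      using inner_oproj_onb[OF V that, of "y - x"] by (simp add: h_def)
    have "norm (f (x + h) - f x - (\<Sum>b\<in>onb V. (h \<bullet> b) *\<^sub>R dird f x b)) \<le> e * norm h"
      by (rule d(2)) (use xV hV d(1) nh y in auto)
    also have "\<dots> \<le> e * norm (y - x)" using nh \<open>0 < e\<close> by simp
    finally show "norm (f (oproj V y) - f (oproj V x) - (\<Sum>b\<in>onb V. ((y - x) \<bullet> b) *\<^sub>R dird f x b)) \<le> e * norm (y - x)"
      by (simp add: py oproj_id[OF V xV] hb)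
  qed (use d in auto)
qed

text \<open>\<open>Ck_on\<close> asks for derivatives in each direction separately and says nothing
  about their dependence on the direction. Differentiating the extended function along a line, by
  the Frechet chain rule, shows that this dependence is linear.\<close>

lemma dird_expand:
  fixes f :: "'e::euclidean_space \<Rightarrow> 'w::real_normed_vector"
  assumes ro: "relopen V U" and f: "Ck_on (Suc k) V U f" and x: "x \<in> U" and v: "v \<in> V"
  shows "dird f x v = (\<Sum>b\<in>onb V. (v \<bullet> b) *\<^sub>R dird f x b)"
proof (rule dird_eqI)
  have V: "subspace V" using ro by simp
  have xV: "x \<in> V" using x relopen_subset[OF ro] by auto
  have "((\<lambda>t::real. x + t *\<^sub>R v) has_vector_derivative v) (at 0)"
    by (auto intro!: derivative_eq_intros)
  moreover have "((\<lambda>y. f (oproj V y)) has_derivative (\<lambda>h. \<Sum>b\<in>onb V. (h \<bullet> b) *\<^sub>R dird f x b)) (at (x + 0 *\<^sub>R v))"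
    using Ck1_frechet[OF ro f x] by simp
  ultimately have "(((\<lambda>y. f (oproj V y)) \<circ> (\<lambda>t::real. x + t *\<^sub>R v)) has_vector_derivative (\<Sum>b\<in>onb V. (v \<bullet> b) *\<^sub>R dird f x b)) (at 0)"
    by (intro vector_derivative_diff_chain_within) (auto intro: has_derivative_at_withinI)
  then show "((\<lambda>t. f (x + t *\<^sub>R v)) has_vector_derivative (\<Sum>b\<in>onb V. (v \<bullet> b) *\<^sub>R dird f x b)) (at 0)"
    using xV v V by (simp add: o_def oproj_id subspace_add subspace_scale)
qed

lemma dird_frechet:
  assumes "relopen V U" "Ck_on (Suc k) V U f" "x \<in> U"
  shows "((\<lambda>y. f (oproj V y)) has_derivative (\<lambda>h. dird f x (oproj V h))) (at x)"
proof -
  have "dird f x (oproj V h) = (\<Sum>b\<in>onb V. (h \<bullet> b) *\<^sub>R dird f x b)" for h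
    using dird_expand[OF assms oproj_in, of h] assms(1) by (simp add: inner_oproj_onb)
  then show ?thesis using Ck1_frechet[OF assms] by simp
qed

lemma dird_linear:
  assumes ro: "relopen V U" and f: "Ck_on (Suc k) V U f" and x: "x \<in> U" and "a \<in> V" "b \<in> V"
  shows "dird f x (r *\<^sub>R a + s *\<^sub>R b) = r *\<^sub>R dird f x a + s *\<^sub>R dird f x b"
proof -
  have "r *\<^sub>R a + s *\<^sub>R b \<in> V" using assms by (auto intro!: subspace_add subspace_scale)
  from dird_expand[OF ro f x this] dird_expand[OF ro f x \<open>a \<in> V\<close>] dird_expand[OF ro f x \<open>b \<in> V\<close>]
  show ?thesis by (simp add: inner_add_left scaleR_add_left sum.distrib scaleR_sum_right)
qed

text \<open>Near \<open>t\<close> the curve lies in \<open>V\<close>, where \<open>f\<close> and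
  \<open>f \<circ> oproj V\<close> agree, so the ordinary chain rule for the extension
  applies.\<close>

lemma curve_chain:
  assumes ro: "relopen V U" and f: "Ck_on (Suc k) V U f"
    and g: "(g has_vector_derivative v) (at t within T)" and gt: "g t \<in> U" and v: "v \<in> V"
    and ev: "\<forall>\<^sub>F s in nhds t. s \<in> T \<longrightarrow> g s \<in> V"
  shows "((\<lambda>s. f (g s)) has_vector_derivative dird f (g t) v) (at t within T)"
proof -
  have V: "subspace V" using ro by simp
  have "(((\<lambda>y. f (oproj V y)) \<circ> g) has_vector_derivative dird f (g t) (oproj V v)) (at t within T)"
    by (rule vector_derivative_diff_chain_within[OF g])
      (use dird_frechet[OF ro f gt] in \<open>auto intro: has_derivative_at_withinI\<close>)
  then have "((\<lambda>s. f (oproj V (g s))) has_vector_derivative dird f (g t) v) (at t within T)"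
    using oproj_id[OF V v] by (simp add: o_def)
  moreover have "\<forall>\<^sub>F s in nhds t. s \<in> T \<longrightarrow> f (g s) = f (oproj V (g s))"
    using ev by (rule eventually_mono) (use oproj_id[OF V] in auto)
  moreover have "f (g t) = f (oproj V (g t))"
    using gt relopen_subset[OF ro] oproj_id[OF V] by auto
  ultimately show ?thesis
    by (subst has_vector_derivative_cong_ev[where g="\<lambda>s. f (oproj V (g s))"]) auto
qed

text \<open>On \<open>U\<close> the map equals its own projection to \<open>V'\<close>. A bounded
  linear map commutes with differentiation, so the derivative is fixed by the projection as
  well.\<close>

lemma dird_in_subspace:
  fixes f :: "'e::euclidean_space \<Rightarrow> 'w::euclidean_space"
  assumes ro: "relopen V U" and d: "(\<lambda>t::real. f (x + t *\<^sub>R v)) differentiable (at 0)" and x: "x \<in> U" and v: "v \<in> V"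
    and V': "subspace V'" and im: "\<And>y. y \<in> U \<Longrightarrow> f y \<in> V'"
  shows "dird f x v \<in> V'"
proof -
  have "((\<lambda>t. oproj V' (f (x + t *\<^sub>R v))) has_vector_derivative oproj V' (dird f x v)) (at 0)"
    by (rule bounded_linear.has_vector_derivative[OF bounded_linear_oproj dird_works[OF d]])
  moreover have "dird (\<lambda>y. oproj V' (f y)) x v = dird f x v"
    by (rule dird_cong[OF ro x v]) (use oproj_id[OF V'] im in auto)
  ultimately have "dird f x v = oproj V' (dird f x v)" using dird_eqI[of "\<lambda>y. oproj V' (f y)"] by simp
  then show ?thesis using oproj_in[OF V'] by metis
qed

lemma dird_chain:
  assumes ro: "relopen V U" and ro': "relopen V' U'"
    and f: "Ck_on (Suc j) V U f" and g: "Ck_on (Suc k) V' U' g" and im: "f ` U \<subseteq> U'"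
    and x: "x \<in> U" and v: "v \<in> V"
  shows "((\<lambda>t. g (f (x + t *\<^sub>R v))) has_vector_derivative dird g (f x) (dird f x v)) (at 0)"
    and "dird (\<lambda>y. g (f y)) x v = dird g (f x) (dird f x v)"
proof -
  have d: "(\<lambda>t::real. f (x + t *\<^sub>R v)) differentiable (at 0)" using f x v by simp
  have "((\<lambda>t. g (f (x + t *\<^sub>R v))) has_vector_derivative dird g (f (x + 0 *\<^sub>R v)) (dird f x v)) (at 0)"
  proof (rule curve_chain[OF ro' g])
    show "((\<lambda>t::real. f (x + t *\<^sub>R v)) has_vector_derivative dird f x v) (at 0)" by (rule dird_works[OF d])
    show "f (x + 0 *\<^sub>R v) \<in> U'" using im x by auto
    show "dird f x v \<in> V'"
      by (rule dird_in_subspace[OF ro d x v]) (use ro' im relopen_subset[OF ro'] in auto)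
    show "\<forall>\<^sub>F s in nhds 0. s \<in> UNIV \<longrightarrow> f (x + s *\<^sub>R v) \<in> V'"
      using relopen_eventually_line[OF ro x v] by (rule eventually_mono) (use im relopen_subset[OF ro'] in auto)
  qed
  then show *: "((\<lambda>t. g (f (x + t *\<^sub>R v))) has_vector_derivative dird g (f x) (dird f x v)) (at 0)" by simp
  show "dird (\<lambda>y. g (f y)) x v = dird g (f x) (dird f x v)" by (rule dird_eqI[OF *])
qed

section \<open>Closure properties of the classes of k times differentiable maps\<close>

lemma Ck_on_const [simp]: "Ck_on k V U (\<lambda>x. c)"
proof (induction k arbitrary: c)
  case (Suc k)
  have "dird (\<lambda>x. c) x v = 0" for x v :: 'a by (rule dird_eqI) simp
  then show ?case using Suc by simp
qed simp

lemma Ck_on_add: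
  assumes ro: "relopen V U"
  shows "Ck_on k V U f \<Longrightarrow> Ck_on k V U g \<Longrightarrow> Ck_on k V U (\<lambda>x. f x + g x)"
proof (induction k arbitrary: f g)
  case 0 then show ?case by (simp add: continuous_on_add)
next
  case (Suc k)
  have d: "((\<lambda>t. f (x + t *\<^sub>R v) + g (x + t *\<^sub>R v)) has_vector_derivative dird f x v + dird g x v) (at 0)"
    if "x \<in> U" "v \<in> V" for x v
    using Suc.prems that by (intro has_vector_derivative_add dird_works) auto
  have "Ck_on k V U (\<lambda>x. dird (\<lambda>x. f x + g x) x v)" if v: "v \<in> V" for v
    by (rule Ck_on_cong[OF ro, of "\<lambda>x. dird f x v + dird g x v"])
      (use dird_eqI[of "\<lambda>x. f x + g x" _ v, OF d[OF _ v]] Suc v in auto)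
  then show ?case using Suc.prems d by (auto intro: continuous_on_add differentiableI_vector)
qed

lemma Ck_on_bounded_linear:
  assumes ro: "relopen V U" and l: "bounded_linear l"
  shows "Ck_on k V U f \<Longrightarrow> Ck_on k V U (\<lambda>x. l (f x))"
proof (induction k arbitrary: f)
  case 0 then show ?case using l by (simp add: bounded_linear.continuous_on)
next
  case (Suc k)
  have d: "((\<lambda>t. l (f (x + t *\<^sub>R v))) has_vector_derivative l (dird f x v)) (at 0)"
    if "x \<in> U" "v \<in> V" for x v
    using Suc.prems that by (intro bounded_linear.has_vector_derivative[OF l] dird_works) auto
  have "Ck_on k V U (\<lambda>x. dird (\<lambda>x. l (f x)) x v)" if v: "v \<in> V" for v
    by (rule Ck_on_cong[OF ro, of "\<lambda>x. l (dird f x v)"])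
      (use dird_eqI[of "\<lambda>x. l (f x)" _ v, OF d[OF _ v]] Suc v in auto)
  then show ?case using Suc.prems d l by (auto intro: bounded_linear.continuous_on differentiableI_vector)
qed

lemma Ck_on_bilinear:
  assumes ro: "relopen V U" and "bounded_bilinear pr"
  shows "Ck_on k V U f \<Longrightarrow> Ck_on k V U g \<Longrightarrow> Ck_on k V U (\<lambda>x. pr (f x) (g x))"
proof (induction k arbitrary: f g)
  interpret bounded_bilinear pr by fact
  case 0 then show ?case by (simp add: continuous_on)
next
  interpret bounded_bilinear pr by fact
  case (Suc k)
  have d: "((\<lambda>t. pr (f (x + t *\<^sub>R v)) (g (x + t *\<^sub>R v))) has_vector_derivative
      pr (f x) (dird g x v) + pr (dird f x v) (g x)) (at 0)"
    if "x \<in> U" "v \<in> V" for x v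
    using has_vector_derivative[OF dird_works[of f x v] dird_works[of g x v]] Suc.prems that by auto
  have "Ck_on k V U (\<lambda>x. dird (\<lambda>x. pr (f x) (g x)) x v)" if v: "v \<in> V" for v
  proof (rule Ck_on_cong[OF ro])
    show "Ck_on k V U (\<lambda>x. pr (f x) (dird g x v) + pr (dird f x v) (g x))"
      using Suc v Ck_on_Suc_lower[OF Suc.prems(1)] Ck_on_Suc_lower[OF Suc.prems(2)]
      by (intro Ck_on_add[OF ro] Suc.IH) auto
  qed (use dird_eqI[of "\<lambda>x. pr (f x) (g x)" _ v, OF d[OF _ v]] in auto)
  then show ?case using Suc.prems d by (auto intro: continuous_on differentiableI_vector)
qed

lemmas Ck_on_scaleR = Ck_on_bilinear[OF _ bounded_bilinear_scaleR]
lemmas Ck_on_mult = Ck_on_bilinear[OF _ bounded_bilinear_mult]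
lemmas Ck_on_inner = Ck_on_bilinear[OF _ bounded_bilinear_inner]

lemma Ck_on_minus: "relopen V U \<Longrightarrow> Ck_on k V U f \<Longrightarrow> Ck_on k V U (\<lambda>x. - f x)"
  by (rule Ck_on_bounded_linear[OF _ bounded_linear_minus[OF bounded_linear_ident]])

lemma Ck_on_diff:
  "relopen V U \<Longrightarrow> Ck_on k V U f \<Longrightarrow> Ck_on k V U g \<Longrightarrow> Ck_on k V U (\<lambda>x. f x - g x)"
  using Ck_on_add[of V U k f "\<lambda>x. - g x"] Ck_on_minus[of V U k g] by simp

lemma Ck_on_sum:
  "relopen V U \<Longrightarrow> (\<And>i. i \<in> I \<Longrightarrow> Ck_on k V U (f i)) \<Longrightarrow> Ck_on k V U (\<lambda>x. \<Sum>i\<in>I. f i x)"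
  by (induction I rule: infinite_finite_induct) (auto intro: Ck_on_add)

lemma Ck_on_ident: "relopen V U \<Longrightarrow> Ck_on k V U (\<lambda>x. x)"
proof (cases k)
  case (Suc j)
  have *: "((\<lambda>t. x + t *\<^sub>R v) has_vector_derivative v) (at 0)" for x v :: 'a
    by (auto intro!: derivative_eq_intros)
  have "dird (\<lambda>x. x) x v = v" for x v :: 'a using dird_eqI[of "\<lambda>x. x", OF *] .
  then show ?thesis using * Suc by (auto intro: differentiableI_vector)
qed simp

lemma Ck_on_linear: "relopen V U \<Longrightarrow> bounded_linear l \<Longrightarrow> Ck_on k V U l"
  using Ck_on_bounded_linear[OF _ _ Ck_on_ident] by blast

text \<open>The exponent is kept arbitrary in the induction since differentiation lowers it by one.
  The exponent \<open>-1/2\<close> is the one that normalizes vectors.\<close>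

lemma Ck_on_powr:
  assumes ro: "relopen V U" and pos: "\<And>x. x \<in> U \<Longrightarrow> s x > (0::real)"
  shows "Ck_on k V U s \<Longrightarrow> Ck_on k V U (\<lambda>x. s x powr p)"
proof (induction k arbitrary: p)
  case 0 then show ?case using pos by (fastforce intro!: continuous_intros)
next
  case (Suc k)
  have d: "((\<lambda>t. s (x + t *\<^sub>R v) powr p) has_vector_derivative
      (p * s x powr (p - 1)) * dird s x v) (at 0)"
    if "x \<in> U" "v \<in> V" for x v
  proof -
    have "((\<lambda>t. s (x + t *\<^sub>R v)) has_real_derivative dird s x v) (at 0)"
      using dird_works[of s x v] Suc.prems that by (simp add: has_real_derivative_iff_has_vector_derivative)
    moreover have "((\<lambda>y. y powr p) has_real_derivative p * s x powr (p - 1)) (at (s (x + 0 *\<^sub>R v)))"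
      using pos[OF that(1)] by (auto intro!: derivative_eq_intros has_real_derivative_powr)
    ultimately have "((\<lambda>t. s (x + t *\<^sub>R v) powr p) has_real_derivative
      (p * s x powr (p - 1)) * dird s x v) (at 0)" by (rule DERIV_chain2[rotated])
    then show ?thesis by (simp add: has_real_derivative_iff_has_vector_derivative)
  qed
  have "Ck_on k V U (\<lambda>x. dird (\<lambda>x. s x powr p) x v)" if v: "v \<in> V" for v
  proof (rule Ck_on_cong[OF ro])
    show "Ck_on k V U (\<lambda>x. (p * s x powr (p - 1)) * dird s x v)"
      using Suc v Ck_on_Suc_lower[OF Suc.prems(1)]
      by (intro Ck_on_mult[OF ro] Suc.IH Ck_on_const) auto
  qed (use dird_eqI[of "\<lambda>x. s x powr p" _ v, OF d[OF _ v]] in auto)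
  moreover have "continuous_on U (\<lambda>x. s x powr p)"
    using pos Ck_on_continuous[OF Suc.prems] by (fastforce intro!: continuous_intros)
  ultimately show ?case using d by (auto intro: differentiableI_vector)
qed

text \<open>Expanding the direction \<open>dird f x v\<close> in the basis of \<open>V'\<close>
  turns the derivative of the composite into a sum of products of a coefficient with a composite
  \<open>dird g (f x) b\<close> in a fixed direction, to which the induction hypothesis for one
  degree less applies.\<close>

lemma Ck_on_compose:
  fixes f :: "'e::euclidean_space \<Rightarrow> 'f::euclidean_space"
  assumes ro: "relopen V U" and ro': "relopen V' U'" and im: "f ` U \<subseteq> U'"
  shows "Ck_on k V U f \<Longrightarrow> Ck_on k V' U' g \<Longrightarrow> Ck_on k V U (\<lambda>x. g (f x))"
proof (induction k arbitrary: g)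
  case 0 then show ?case using im by (auto intro: continuous_on_compose2)
next
  case (Suc k)
  note d = dird_chain[OF ro ro' Suc.prems im]
  have V': "subspace V'" using ro' by simp
  have inV': "dird f x v \<in> V'" if "x \<in> U" "v \<in> V" for x v
    by (rule dird_in_subspace[OF ro _ that V']) (use Suc.prems that im relopen_subset[OF ro'] in auto)
  have "Ck_on k V U (\<lambda>x. dird (\<lambda>x. g (f x)) x v)" if v: "v \<in> V" for v
  proof (rule Ck_on_cong[OF ro])
    show "Ck_on k V U (\<lambda>x. \<Sum>b\<in>onb V'. (dird f x v \<bullet> b) *\<^sub>R dird g (f x) b)"
      using Suc v Ck_on_Suc_lower[OF Suc.prems(1)] onb_props(1)[OF V']
      by (intro Ck_on_sum Ck_on_scaleR Ck_on_inner ro Suc.IH Ck_on_const) auto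
    show "(\<Sum>b\<in>onb V'. (dird f x v \<bullet> b) *\<^sub>R dird g (f x) b) = dird (\<lambda>x. g (f x)) x v" if "x \<in> U" for x
      using d(2)[OF that v] dird_expand[OF ro' Suc.prems(2) _ inV'[OF that v], of "f x"] im that by auto
  qed
  moreover have "continuous_on U (\<lambda>x. g (f x))"
    using Ck_on_continuous[OF Suc.prems(1)] Ck_on_continuous[OF Suc.prems(2)] im
    by (auto intro: continuous_on_compose2)
  ultimately show ?case using d(1) by (auto intro: differentiableI_vector)
qed

lemma Ck_on_dird_field:
  assumes ro: "relopen V U" and f: "Ck_on (Suc k) V U f" and X: "Ck_on k V U X"
    and im: "\<And>x. x \<in> U \<Longrightarrow> X x \<in> V"
  shows "Ck_on k V U (\<lambda>x. dird f x (X x))"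
proof (rule Ck_on_cong[OF ro])
  have V: "subspace V" using ro by simp
  show "Ck_on k V U (\<lambda>x. \<Sum>b\<in>onb V. (X x \<bullet> b) *\<^sub>R dird f x b)"
    using f onb_props(1)[OF V] X by (intro Ck_on_sum Ck_on_scaleR Ck_on_inner ro) auto
  show "(\<Sum>b\<in>onb V. (X x \<bullet> b) *\<^sub>R dird f x b) = dird f x (X x)" if "x \<in> U" for x
    using dird_expand[OF ro f that im[OF that]] by simp
qed

subsection \<open>Symmetry of second derivatives\<close>

text \<open>The mean value theorem used twice: on the difference of two parallel segments in
  direction \<open>a\<close>, then in direction \<open>b\<close> on the derivative so obtained. The
  left-hand side is symmetric in \<open>a\<close> and \<open>b\<close>, the right-hand side is
  not.\<close>

lemma second_difference:
  fixes f :: "'e::euclidean_space \<Rightarrow> real"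
  assumes f: "Ck_on (Suc (Suc k)) V U f" and a: "a \<in> V" and b: "b \<in> V"
    and h: "h > 0" and inU: "\<And>s t. 0 \<le> s \<Longrightarrow> s \<le> h \<Longrightarrow> 0 \<le> t \<Longrightarrow> t \<le> h \<Longrightarrow> x + s *\<^sub>R a + t *\<^sub>R b \<in> U"
  shows "\<exists>s t. 0 \<le> s \<and> s \<le> h \<and> 0 \<le> t \<and> t \<le> h \<and>
    f (x + h *\<^sub>R a + h *\<^sub>R b) - f (x + h *\<^sub>R a) - f (x + h *\<^sub>R b) + f x
      = h * h * dird (\<lambda>y. dird f y a) (x + s *\<^sub>R a + t *\<^sub>R b) b"
proof -
  let ?F = "\<lambda>s. f (x + h *\<^sub>R b + s *\<^sub>R a) - f (x + s *\<^sub>R a)"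
  let ?F' = "\<lambda>s. dird f (x + h *\<^sub>R b + s *\<^sub>R a) a - dird f (x + s *\<^sub>R a) a"
  have "\<exists>s. 0 < s \<and> s < h \<and> ?F h - ?F 0 = (h - 0) * ?F' s"
  proof (rule MVT2[OF h])
    fix s :: real assume "0 \<le> s" "s \<le> h"
    then have "x + h *\<^sub>R b + s *\<^sub>R a \<in> U" "x + s *\<^sub>R a \<in> U"
      using inU[of s h] inU[of s 0] h by (simp_all add: algebra_simps)
    then show "(?F has_real_derivative ?F' s) (at s)"
      unfolding has_real_derivative_iff_has_vector_derivative
      by (intro has_vector_derivative_diff line_derivative[OF f a])
  qed
  then obtain s where s: "0 < s" "s < h" "?F h - ?F 0 = h * ?F' s" by auto
  let ?G = "\<lambda>t. dird f (x + s *\<^sub>R a + t *\<^sub>R b) a"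
  have "\<exists>t. 0 < t \<and> t < h \<and> ?G h - ?G 0 = (h - 0) * dird (\<lambda>y. dird f y a) (x + s *\<^sub>R a + t *\<^sub>R b) b"
  proof (rule MVT2[OF h])
    fix t :: real assume "0 \<le> t" "t \<le> h"
    then have "x + s *\<^sub>R a + t *\<^sub>R b \<in> U" using inU s by simp
    then show "(?G has_real_derivative dird (\<lambda>y. dird f y a) (x + s *\<^sub>R a + t *\<^sub>R b) b) (at t)"
      unfolding has_real_derivative_iff_has_vector_derivative
      by (intro line_derivative[OF Ck_on_dird[OF f a] b])
  qed
  then obtain t where t: "0 < t" "t < h" "?G h - ?G 0 = h * dird (\<lambda>y. dird f y a) (x + s *\<^sub>R a + t *\<^sub>R b) b" by auto
  have "?F' s = ?G h - ?G 0" by (simp add: algebra_simps)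
  then have "?F h - ?F 0 = h * h * dird (\<lambda>y. dird f y a) (x + s *\<^sub>R a + t *\<^sub>R b) b"
    using s t by simp
  then show ?thesis using s t by (intro exI[of _ s] exI[of _ t]) (simp add: algebra_simps)
qed

text \<open>The same second difference equals \<open>h * h\<close> times a value of either mixed
  derivative at some point of the small parallelogram. If the two differed at \<open>x\<close>,
  continuity would keep both values within half of their distance, a contradiction.\<close>

lemma dird_symmetric_real:
  fixes f :: "'e::euclidean_space \<Rightarrow> real"
  assumes ro: "relopen V U" and f: "Ck_on (Suc (Suc k)) V U f" and x: "x \<in> U" and a: "a \<in> V" and b: "b \<in> V"
  shows "dird (\<lambda>y. dird f y a) x b = dird (\<lambda>y. dird f y b) x a"
proof (rule ccontr)
  let ?A = "\<lambda>y. dird (\<lambda>y. dird f y a) y b" and ?B = "\<lambda>y. dird (\<lambda>y. dird f y b) y a"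
  have V: "subspace V" using ro by simp
  have xV: "x \<in> V" using x relopen_subset[OF ro] by auto
  assume ne: "?A x \<noteq> ?B x"
  define \<epsilon> where "\<epsilon> = \<bar>?A x - ?B x\<bar> / 2"
  have e: "\<epsilon> > 0" using ne by (simp add: \<epsilon>_def)
  have c: "continuous_on U ?A" "continuous_on U ?B"
    using Ck_on_continuous[OF Ck_on_dird[OF Ck_on_dird[OF f a] b]] Ck_on_continuous[OF Ck_on_dird[OF Ck_on_dird[OF f b] a]] by auto
  obtain d1 where d1: "d1 > 0" "\<And>y. y \<in> U \<Longrightarrow> dist y x < d1 \<Longrightarrow> dist (?A y) (?A x) < \<epsilon>"
    using c(1)[unfolded continuous_on_iff, rule_format, OF x e] by blast
  obtain d2 where d2: "d2 > 0" "\<And>y. y \<in> U \<Longrightarrow> dist y x < d2 \<Longrightarrow> dist (?B y) (?B x) < \<epsilon>"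
    using c(2)[unfolded continuous_on_iff, rule_format, OF x e] by blast
  note d = d1 d2
  obtain r where r: "r > 0" "\<And>y. y \<in> V \<Longrightarrow> dist y x < r \<Longrightarrow> y \<in> U"
    using relopen_ball[OF ro x] by blast
  define m where "m = Min {d1, d2, r}"
  have m: "m > 0" "m \<le> d1" "m \<le> d2" "m \<le> r" using d r by (auto simp: m_def)
  \<comment> \<open>The summand 1 covers \<open>a = b = 0\<close> and makes the parallelogram lie
    strictly inside the ball of radius \<open>m\<close>.\<close>
  define h where "h = m / (norm a + norm b + 1)"
  have np: "norm a + norm b + 1 > 0" by (smt (verit) norm_ge_zero)
  have h: "h > 0" "h * (norm a + norm b) < m"
    using m np by (auto simp: h_def field_simps)
  have near: "dist (x + s *\<^sub>R a + t *\<^sub>R b) x < m" if "0 \<le> s" "s \<le> h" "0 \<le> t" "t \<le> h" for s t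
  proof -
    have "dist (x + s *\<^sub>R a + t *\<^sub>R b) x \<le> s * norm a + t * norm b"
      using norm_triangle_ineq[of "s *\<^sub>R a" "t *\<^sub>R b"] that by (simp add: dist_norm add.assoc)
    also have "\<dots> \<le> h * norm a + h * norm b" using that by (intro add_mono mult_right_mono) auto
    finally show ?thesis using h by (simp add: distrib_left)
  qed
  have inU: "x + s *\<^sub>R a + t *\<^sub>R b \<in> U" if "0 \<le> s" "s \<le> h" "0 \<le> t" "t \<le> h" for s t
    using near[OF that] m xV a b V by (intro r(2)) (auto intro!: subspace_add subspace_scale)
  have inU': "x + s *\<^sub>R b + t *\<^sub>R a \<in> U" if "0 \<le> s" "s \<le> h" "0 \<le> t" "t \<le> h" for s t
    using inU[OF that(3,4,1,2)] by (simp add: algebra_simps)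
  obtain s t where st: "0 \<le> s" "s \<le> h" "0 \<le> t" "t \<le> h"
    "f (x + h *\<^sub>R a + h *\<^sub>R b) - f (x + h *\<^sub>R a) - f (x + h *\<^sub>R b) + f x = h * h * ?A (x + s *\<^sub>R a + t *\<^sub>R b)"
    using second_difference[OF f a b h(1) inU] by blast
  obtain s' t' where st': "0 \<le> s'" "s' \<le> h" "0 \<le> t'" "t' \<le> h"
    "f (x + h *\<^sub>R b + h *\<^sub>R a) - f (x + h *\<^sub>R b) - f (x + h *\<^sub>R a) + f x = h * h * ?B (x + s' *\<^sub>R b + t' *\<^sub>R a)"
    using second_difference[OF f b a h(1) inU'] by blast
  have "h * h * ?A (x + s *\<^sub>R a + t *\<^sub>R b) = h * h * ?B (x + s' *\<^sub>R b + t' *\<^sub>R a)"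
    using st(5) st'(5) by (simp add: algebra_simps)
  then have eq: "?A (x + s *\<^sub>R a + t *\<^sub>R b) = ?B (x + t' *\<^sub>R a + s' *\<^sub>R b)" using h by (simp add: algebra_simps)
  have "\<bar>?A (x + s *\<^sub>R a + t *\<^sub>R b) - ?A x\<bar> < \<epsilon>"
    using d(2)[OF inU[OF st(1-4)]] near[OF st(1-4)] m by (simp add: dist_real_def)
  moreover have "\<bar>?B (x + t' *\<^sub>R a + s' *\<^sub>R b) - ?B x\<bar> < \<epsilon>"
    using d(4)[OF inU[OF st'(3,4,1,2)]] near[OF st'(3,4,1,2)] m by (simp add: dist_real_def)
  ultimately show False using eq unfolding \<epsilon>_def by (auto simp: abs_if field_simps split: if_splits)
qed

lemma dird_bounded_linear:
  assumes "bounded_linear l" "(\<lambda>t::real. f (x + t *\<^sub>R v)) differentiable (at 0)"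
  shows "dird (\<lambda>y. l (f y)) x v = l (dird f x v)"
  by (rule dird_eqI) (rule bounded_linear.has_vector_derivative[OF assms(1) dird_works[OF assms(2)]])

text \<open>The mean value theorem needs real values, so \<open>f\<close> is paired with an
  arbitrary vector \<open>w\<close>.\<close>

lemma dird_symmetric:
  fixes f :: "'e::euclidean_space \<Rightarrow> 'w::euclidean_space"
  assumes ro: "relopen V U" and f: "Ck_on (Suc (Suc k)) V U f" and x: "x \<in> U" and a: "a \<in> V" and b: "b \<in> V"
  shows "dird (\<lambda>y. dird f y a) x b = dird (\<lambda>y. dird f y b) x a"
proof (rule euclidean_eqI)
  fix w :: 'w
  have l: "bounded_linear (\<lambda>z. z \<bullet> w)" by (rule bounded_linear_inner_left)
  have f': "Ck_on (Suc (Suc k)) V U (\<lambda>y. f y \<bullet> w)" by (rule Ck_on_bounded_linear[OF ro l f])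
  have 1: "dird (\<lambda>y. dird (\<lambda>y. f y \<bullet> w) y a) x b = dird (\<lambda>y. dird f y a) x b \<bullet> w"
    if "a \<in> V" "b \<in> V" for a b
  proof -
    have "dird (\<lambda>y. dird (\<lambda>y. f y \<bullet> w) y a) x b = dird (\<lambda>y. dird f y a \<bullet> w) x b"
      using f that by (intro dird_cong[OF ro x] dird_bounded_linear[OF l]) auto
    also have "\<dots> = dird (\<lambda>y. dird f y a) x b \<bullet> w"
      using f that x by (intro dird_bounded_linear[OF l]) auto
    finally show ?thesis .
  qed
  show "dird (\<lambda>y. dird f y a) x b \<bullet> w = dird (\<lambda>y. dird f y b) x a \<bullet> w"
    using dird_symmetric_real[OF ro f' x a b] 1 a b by simp
qed

section \<open>Inner products depending on a parameter\<close>

text \<open>Linearity is relative to \<open>V\<close> because differentials, metrics and Christoffel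
  maps are controlled only on the model space.\<close>

definition lin_on :: "'e::real_vector set \<Rightarrow> ('e \<Rightarrow> 'w::real_vector) \<Rightarrow> bool" where
  "lin_on V l \<longleftrightarrow> (\<forall>a\<in>V. \<forall>b\<in>V. \<forall>r s. l (r *\<^sub>R a + s *\<^sub>R b) = r *\<^sub>R l a + s *\<^sub>R l b)"

definition inner_on :: "'e::real_vector set \<Rightarrow> ('e \<Rightarrow> 'e \<Rightarrow> real) \<Rightarrow> bool" where
  "inner_on V g \<longleftrightarrow> (\<forall>w\<in>V. lin_on V (\<lambda>v. g v w)) \<and> (\<forall>v\<in>V. \<forall>w\<in>V. g v w = g w v) \<and>
     (\<forall>v\<in>V. v \<noteq> 0 \<longrightarrow> g v v > 0)"

lemma lin_onD: "lin_on V l \<Longrightarrow> a \<in> V \<Longrightarrow> b \<in> V \<Longrightarrow> l (r *\<^sub>R a + s *\<^sub>R b) = r *\<^sub>R l a + s *\<^sub>R l b"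
  by (simp add: lin_on_def)

lemma lin_on_add: "lin_on V l \<Longrightarrow> a \<in> V \<Longrightarrow> b \<in> V \<Longrightarrow> l (a + b) = l a + l b"
  using lin_onD[of V l a b 1 1] by simp

lemma lin_on_diff: "lin_on V l \<Longrightarrow> a \<in> V \<Longrightarrow> b \<in> V \<Longrightarrow> l (a - b) = l a - l b"
  using lin_onD[of V l a b 1 "-1"] by simp

lemma lin_on_scale: "lin_on V l \<Longrightarrow> a \<in> V \<Longrightarrow> l (r *\<^sub>R a) = r *\<^sub>R l a"
  using lin_onD[of V l a a r 0] by simp

lemma lin_on_zero: "lin_on V l \<Longrightarrow> subspace V \<Longrightarrow> l 0 = 0"
  using lin_on_scale[of V l 0 0] subspace_0 by auto

lemma lin_on_sum:
  assumes "lin_on V l" "subspace V" "\<And>i. i \<in> I \<Longrightarrow> v i \<in> V"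
  shows "l (\<Sum>i\<in>I. c i *\<^sub>R v i) = (\<Sum>i\<in>I. c i *\<^sub>R l (v i))"
  using assms(3)
proof (induction I rule: infinite_finite_induct)
  case (insert i I)
  then have "(\<Sum>i\<in>I. c i *\<^sub>R v i) \<in> V" by (auto intro!: subspace_sum subspace_scale assms(2))
  then show ?case using insert lin_onD[OF assms(1), of "v i" _ "c i" 1] by simp
qed (use lin_on_zero[OF assms(1,2)] in auto)

lemma lin_on_expand:
  "subspace V \<Longrightarrow> lin_on V l \<Longrightarrow> x \<in> V \<Longrightarrow> l x = (\<Sum>b\<in>onb V. (x \<bullet> b) *\<^sub>R l b)"
  by (rule linear_on_expand) (auto simp: lin_on_def)

text \<open>Turns a map that is linear on \<open>V\<close> only into a globally linear one, so that
  results on images, dimensions and right inverses of linear maps can be used.\<close>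

lemma linear_oproj_extension:
  assumes V: "subspace V" and l: "lin_on V l"
  shows "linear (\<lambda>v. l (oproj V v))"
proof (rule linearI)
  fix a b r
  show "l (oproj V (a + b)) = l (oproj V a) + l (oproj V b)"
    by (simp add: linear_add[OF linear_oproj] lin_on_add[OF l oproj_in[OF V] oproj_in[OF V]])
  show "l (oproj V (r *\<^sub>R a)) = r *\<^sub>R l (oproj V a)"
    by (simp add: linear_scale[OF linear_oproj] lin_on_scale[OF l oproj_in[OF V]])
qed

lemma lin_on_dird: "relopen V U \<Longrightarrow> Ck_on (Suc k) V U f \<Longrightarrow> x \<in> U \<Longrightarrow> lin_on V (dird f x)"
  unfolding lin_on_def using dird_linear by blast

lemma inner_on_lin1: "inner_on V g \<Longrightarrow> w \<in> V \<Longrightarrow> lin_on V (\<lambda>v. g v w)"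
  by (simp add: inner_on_def)

lemma inner_on_sym: "inner_on V g \<Longrightarrow> v \<in> V \<Longrightarrow> w \<in> V \<Longrightarrow> g v w = g w v"
  by (simp add: inner_on_def)

lemma inner_on_pos: "inner_on V g \<Longrightarrow> v \<in> V \<Longrightarrow> v \<noteq> 0 \<Longrightarrow> g v v > 0"
  by (simp add: inner_on_def)

lemma inner_on_lin2:
  assumes "inner_on V g" "subspace V" "v \<in> V" shows "lin_on V (g v)"
  unfolding lin_on_def
proof (intro ballI allI)
  fix a b r s assume ab: "a \<in> V" "b \<in> V"
  then have "r *\<^sub>R a + s *\<^sub>R b \<in> V" using assms by (auto intro!: subspace_add subspace_scale)
  then show "g v (r *\<^sub>R a + s *\<^sub>R b) = r *\<^sub>R g v a + s *\<^sub>R g v b"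
    using lin_onD[OF inner_on_lin1[OF assms(1,3)] ab] inner_on_sym[OF assms(1,3)] ab by simp
qed

lemma inner_on_eqI:
  assumes g: "inner_on V g" and V: "subspace V" and vw: "v \<in> V" "w \<in> V"
    and eq: "\<And>z. z \<in> V \<Longrightarrow> g v z = g w z"
  shows "v = w"
proof (rule ccontr)
  assume "v \<noteq> w"
  have d: "v - w \<in> V" using vw V by (simp add: subspace_diff)
  have "g (v - w) (v - w) = 0"
    using lin_on_diff[OF inner_on_lin1[OF g d] vw] eq[OF d] by simp
  then show False using inner_on_pos[OF g d] \<open>v \<noteq> w\<close> by simp
qed

text \<open>An indexed family covers both numbered frames and, with the identity as indexing, the
  orthonormal bases in the definition of the divergence, which are sets.\<close>

definition onfam :: "('e \<Rightarrow> 'e \<Rightarrow> real) \<Rightarrow> 'i set \<Rightarrow> ('i \<Rightarrow> 'e) \<Rightarrow> bool" where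
  "onfam g I Y \<longleftrightarrow> (\<forall>i\<in>I. \<forall>j\<in>I. g (Y i) (Y j) = (if i = j then 1 else 0))"

lemma onfam_coeff:
  assumes g: "inner_on V g" and V: "subspace V" and I: "finite I" and Y: "\<And>i. i \<in> I \<Longrightarrow> Y i \<in> V"
    and on: "onfam g I Y" and j: "j \<in> I"
  shows "g (\<Sum>i\<in>I. c i *\<^sub>R Y i) (Y j) = c j"
proof -
  have "g (\<Sum>i\<in>I. c i *\<^sub>R Y i) (Y j) = (\<Sum>i\<in>I. c i *\<^sub>R g (Y i) (Y j))"
    by (rule lin_on_sum[OF inner_on_lin1[OF g Y[OF j]] V Y])
  also have "\<dots> = (\<Sum>i\<in>I. if i = j then c i else 0)"
    using on j by (intro sum.cong) (auto simp: onfam_def)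
  finally show ?thesis using I j by simp
qed

lemma onfam_inj_independent:
  assumes g: "inner_on V g" and V: "subspace V" and I: "finite I" and Y: "\<And>i. i \<in> I \<Longrightarrow> Y i \<in> V"
    and on: "onfam g I Y"
  shows "inj_on Y I" "independent (Y ` I)"
proof -
  show inj: "inj_on Y I"
    using on unfolding inj_on_def onfam_def by (metis zero_neq_one)
  show "independent (Y ` I)"
  proof (rule independent_if_scalars_zero)
    fix c x assume z: "(\<Sum>x\<in>Y ` I. c x *\<^sub>R x) = 0" and "x \<in> Y ` I"
    then obtain j where j: "j \<in> I" "x = Y j" by auto
    have "(\<Sum>i\<in>I. c (Y i) *\<^sub>R Y i) = 0" using z by (simp add: sum.reindex[OF inj])
    then show "c x = 0"
      using onfam_coeff[OF g V I Y on j(1), of "\<lambda>i. c (Y i)"] j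
        lin_on_zero[OF inner_on_lin1[OF g Y[OF j(1)]] V] by simp
  qed (use I in auto)
qed

lemma onfam_span:
  fixes V :: "'e::euclidean_space set"
  assumes g: "inner_on V g" and V: "subspace V" and I: "finite I" and Y: "\<And>i. i \<in> I \<Longrightarrow> Y i \<in> V"
    and on: "onfam g I Y" and card: "card I = dim V"
  shows "V \<subseteq> span (Y ` I)"
proof (rule card_ge_dim_independent)
  have *: "inj_on Y I" "independent (Y ` I)"
    using onfam_inj_independent[OF g V I _ on] Y by blast+
  then show "independent (Y ` I)" "dim V \<le> card (Y ` I)" "Y ` I \<subseteq> V"
    using Y card by (auto simp: card_image)
qed

lemma onfam_expand_span:
  assumes g: "inner_on V g" and V: "subspace V" and I: "finite I" and Y: "\<And>i. i \<in> I \<Longrightarrow> Y i \<in> V"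
    and on: "onfam g I Y" and v: "v \<in> span (Y ` I)"
  shows "v = (\<Sum>i\<in>I. g v (Y i) *\<^sub>R Y i)"
proof -
  have "\<exists>c. v = (\<Sum>i\<in>I. c i *\<^sub>R Y i)"
  proof -
    from v obtain u where "v = (\<Sum>x\<in>Y ` I. u x *\<^sub>R x)"
      using span_finite[of "Y ` I"] I by auto
    then show ?thesis
      using sum.reindex[OF onfam_inj_independent(1)[OF g V I Y on], of "\<lambda>x. u x *\<^sub>R x"] by auto
  qed
  then obtain c where c: "v = (\<Sum>i\<in>I. c i *\<^sub>R Y i)" by blast
  have "g v (Y j) = c j" if "j \<in> I" for j unfolding c by (rule onfam_coeff[OF g V I Y on that])
  then show ?thesis using c by simp
qed

lemma onfam_expand:
  fixes V :: "'e::euclidean_space set"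
  assumes g: "inner_on V g" and V: "subspace V" and I: "finite I" and Y: "\<And>i. i \<in> I \<Longrightarrow> Y i \<in> V"
    and on: "onfam g I Y" and card: "card I = dim V" and v: "v \<in> V"
  shows "v = (\<Sum>i\<in>I. g v (Y i) *\<^sub>R Y i)"
  by (rule onfam_expand_span[OF g V I Y on]) (use onfam_span[OF g V I Y on card] v in auto)

text \<open>Expand each \<open>Y i\<close> in the basis \<open>Z\<close>. The coefficients
  \<open>g (Y i) (Z j)\<close> form an orthogonal matrix: summing
  \<open>g (Y i) (Z j) * g (Y i) (Z k)\<close> over \<open>i\<close> gives
  \<open>g (Z j) (Z k)\<close>, by expanding \<open>Z j\<close> in the basis
  \<open>Y\<close>.\<close>

lemma trace_independent:
  fixes b :: "'e::euclidean_space \<Rightarrow> 'e \<Rightarrow> real"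
  assumes g: "inner_on V g" and V: "subspace V"
    and I: "finite I" and Y: "\<And>i. i \<in> I \<Longrightarrow> Y i \<in> V" and Yon: "onfam g I Y" and cI: "card I = dim V"
    and J: "finite J" and Z: "\<And>i. i \<in> J \<Longrightarrow> Z i \<in> V" and Zon: "onfam g J Z" and cJ: "card J = dim V"
    and b1: "\<And>w. w \<in> V \<Longrightarrow> lin_on V (\<lambda>v. b v w)" and b2: "\<And>v. v \<in> V \<Longrightarrow> lin_on V (b v)"
  shows "(\<Sum>i\<in>I. b (Y i) (Y i)) = (\<Sum>j\<in>J. b (Z j) (Z j))"
proof -
  have "b (Y i) (Y i) = (\<Sum>j\<in>J. \<Sum>k\<in>J. g (Y i) (Z j) * g (Y i) (Z k) * b (Z j) (Z k))" if i: "i \<in> I" for i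
  proof -
    note e = onfam_expand[OF g V J Z Zon cJ Y[OF i]]
    have "b (Y i) (Y i) = b (\<Sum>j\<in>J. g (Y i) (Z j) *\<^sub>R Z j) (Y i)" using e by simp
    also have "\<dots> = (\<Sum>j\<in>J. g (Y i) (Z j) *\<^sub>R b (Z j) (Y i))"
      by (rule lin_on_sum[OF b1[OF Y[OF i]] V Z])
    also have "\<dots> = (\<Sum>j\<in>J. g (Y i) (Z j) *\<^sub>R (\<Sum>k\<in>J. g (Y i) (Z k) *\<^sub>R b (Z j) (Z k)))"
    proof (intro sum.cong refl)
      fix j assume j: "j \<in> J"
      have "b (Z j) (Y i) = b (Z j) (\<Sum>k\<in>J. g (Y i) (Z k) *\<^sub>R Z k)" using e by simp
      also have "\<dots> = (\<Sum>k\<in>J. g (Y i) (Z k) *\<^sub>R b (Z j) (Z k))"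
        by (rule lin_on_sum[OF b2[OF Z[OF j]] V Z])
      finally show "g (Y i) (Z j) *\<^sub>R b (Z j) (Y i) = g (Y i) (Z j) *\<^sub>R (\<Sum>k\<in>J. g (Y i) (Z k) *\<^sub>R b (Z j) (Z k))" by simp
    qed
    finally show ?thesis by (simp add: sum_distrib_left mult.assoc)
  qed
  then have "(\<Sum>i\<in>I. b (Y i) (Y i)) = (\<Sum>i\<in>I. \<Sum>j\<in>J. \<Sum>k\<in>J. g (Y i) (Z j) * g (Y i) (Z k) * b (Z j) (Z k))"
    by simp
  also have "\<dots> = (\<Sum>j\<in>J. \<Sum>k\<in>J. \<Sum>i\<in>I. g (Y i) (Z j) * g (Y i) (Z k) * b (Z j) (Z k))"
    by (subst sum.swap) (intro sum.cong refl, rule sum.swap)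
  also have "\<dots> = (\<Sum>j\<in>J. \<Sum>k\<in>J. (if j = k then 1 else 0) * b (Z j) (Z k))"
  proof (intro sum.cong refl)
    fix j k assume jk: "j \<in> J" "k \<in> J"
    have "g (Z j) (Z k) = g (\<Sum>i\<in>I. g (Z j) (Y i) *\<^sub>R Y i) (Z k)"
      using onfam_expand[OF g V I Y Yon cI Z[OF jk(1)]] by simp
    also have "\<dots> = (\<Sum>i\<in>I. g (Z j) (Y i) *\<^sub>R g (Y i) (Z k))"
      by (rule lin_on_sum[OF inner_on_lin1[OF g Z[OF jk(2)]] V Y])
    also have "\<dots> = (\<Sum>i\<in>I. g (Y i) (Z j) * g (Y i) (Z k))"
      using inner_on_sym[OF g Z[OF jk(1)] Y] by simp
    finally show "(\<Sum>i\<in>I. g (Y i) (Z j) * g (Y i) (Z k) * b (Z j) (Z k)) = (if j = k then 1 else 0) * b (Z j) (Z k)"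
      using Zon jk by (simp add: onfam_def flip: sum_distrib_right)
  qed
  also have "\<dots> = (\<Sum>j\<in>J. b (Z j) (Z j))"
    using J by (intro sum.cong refl) (simp add: if_distrib[of "\<lambda>x. x * _"] cong: if_cong)
  finally show ?thesis .
qed

text \<open>Smoothness is assumed only for constant arguments; expanding both arguments in a fixed
  basis of \<open>S\<close> gives it for varying ones. The space \<open>S\<close> of arguments may
  differ from the parameter space \<open>V\<close>: for the geodesic equation the parameters are
  pairs of position and velocity.\<close>

lemma Ck_on_bilin_field:
  fixes b :: "'e::euclidean_space \<Rightarrow> 'x::euclidean_space \<Rightarrow> 'x \<Rightarrow> 'w::real_normed_vector"
  assumes ro: "relopen V U" and S: "subspace S"
    and l1: "\<And>x w. x \<in> U \<Longrightarrow> w \<in> S \<Longrightarrow> lin_on S (\<lambda>v. b x v w)"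
    and l2: "\<And>x v. x \<in> U \<Longrightarrow> v \<in> S \<Longrightarrow> lin_on S (b x v)"
    and b: "\<And>v w. v \<in> S \<Longrightarrow> w \<in> S \<Longrightarrow> Ck_on k V U (\<lambda>x. b x v w)"
    and A: "Ck_on k V U A" "\<And>x. x \<in> U \<Longrightarrow> A x \<in> S" and B: "Ck_on k V U B" "\<And>x. x \<in> U \<Longrightarrow> B x \<in> S"
  shows "Ck_on k V U (\<lambda>x. b x (A x) (B x))"
proof (rule Ck_on_cong[OF ro])
  show "Ck_on k V U (\<lambda>x. \<Sum>c\<in>onb S. (A x \<bullet> c) *\<^sub>R (\<Sum>d\<in>onb S. (B x \<bullet> d) *\<^sub>R b x c d))"
    using onb_props(1)[OF S] by (intro Ck_on_sum Ck_on_scaleR Ck_on_inner ro A B Ck_on_const b) auto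
  show "(\<Sum>c\<in>onb S. (A x \<bullet> c) *\<^sub>R (\<Sum>d\<in>onb S. (B x \<bullet> d) *\<^sub>R b x c d)) = b x (A x) (B x)" if "x \<in> U" for x
  proof -
    have "b x (A x) (B x) = (\<Sum>c\<in>onb S. (A x \<bullet> c) *\<^sub>R b x c (B x))"
      by (rule lin_on_expand[OF S l1[OF that B(2)[OF that]] A(2)[OF that]])
    also have "\<dots> = (\<Sum>c\<in>onb S. (A x \<bullet> c) *\<^sub>R (\<Sum>d\<in>onb S. (B x \<bullet> d) *\<^sub>R b x c d))"
    proof (intro sum.cong refl)
      fix c assume "c \<in> onb S"
      then have c: "c \<in> S" using onb_props(1)[OF S] by auto
      have "b x c (B x) = (\<Sum>d\<in>onb S. (B x \<bullet> d) *\<^sub>R b x c d)"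
        by (rule lin_on_expand[OF S l2[OF that c] B(2)[OF that]])
      then show "(A x \<bullet> c) *\<^sub>R b x c (B x) = (A x \<bullet> c) *\<^sub>R (\<Sum>d\<in>onb S. (B x \<bullet> d) *\<^sub>R b x c d)" by simp
    qed
    finally show ?thesis by simp
  qed
qed

lemma relopen_pos:
  assumes ro: "relopen V U" and s: "continuous_on U s"
  shows "openin (top_of_set V) {x \<in> U. s x > (0::real)}"
proof -
  have "openin (top_of_set U) (U \<inter> s -` {0<..})"
    using s by (rule continuous_openin_preimage_gen) simp
  then have "openin (top_of_set V) (U \<inter> s -` {0<..})" using ro openin_trans by blast
  moreover have "U \<inter> s -` {0<..} = {x \<in> U. s x > 0}" by auto
  ultimately show ?thesis by simp
qed

text \<open>The parameter set \<open>K\<close> allows one neighbourhood to serve for a fixed degree of smoothness and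
  for all degrees at once.\<close>

lemma gram_schmidt:
  fixes V :: "'e::euclidean_space set" and n :: nat
  assumes ro: "relopen V U" and x0: "x0 \<in> U" and K: "K \<noteq> {}"
    and g: "\<And>x. x \<in> U \<Longrightarrow> inner_on V (g x)"
    and gC: "\<And>a b k. a \<in> V \<Longrightarrow> b \<in> V \<Longrightarrow> k \<in> K \<Longrightarrow> Ck_on k V U (\<lambda>x. g x a b)"
    and XV: "\<And>i x. i < n \<Longrightarrow> x \<in> U \<Longrightarrow> X i x \<in> V"
    and XC: "\<And>i k. i < n \<Longrightarrow> k \<in> K \<Longrightarrow> Ck_on k V U (X i)"
    and ind: "\<And>i. i < n \<Longrightarrow> X i x0 \<notin> span ((\<lambda>j. X j x0) ` {..<i})"
  shows "\<exists>W Y. openin (top_of_set V) W \<and> W \<subseteq> U \<and> x0 \<in> W \<and> (\<forall>i<n. \<forall>x\<in>W. Y i x \<in> V) \<and>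
     (\<forall>i<n. \<forall>k\<in>K. Ck_on k V W (Y i)) \<and> (\<forall>x\<in>W. onfam (g x) {..<n} (\<lambda>i. Y i x)) \<and>
     (\<forall>x\<in>W. \<forall>m\<le>n. span ((\<lambda>i. Y i x) ` {..<m}) = span ((\<lambda>i. X i x) ` {..<m}))"
  using XV XC ind
proof (induction n)
  case 0
  then show ?case using ro x0 by (auto simp: onfam_def)
next
  case (Suc n)
  have V: "subspace V" using ro by simp
  have "\<exists>W Y. openin (top_of_set V) W \<and> W \<subseteq> U \<and> x0 \<in> W \<and> (\<forall>i<n. \<forall>x\<in>W. Y i x \<in> V) \<and>
     (\<forall>i<n. \<forall>k\<in>K. Ck_on k V W (Y i)) \<and> (\<forall>x\<in>W. onfam (g x) {..<n} (\<lambda>i. Y i x)) \<and>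
     (\<forall>x\<in>W. \<forall>m\<le>n. span ((\<lambda>i. Y i x) ` {..<m}) = span ((\<lambda>i. X i x) ` {..<m}))"
    by (rule Suc.IH) (use Suc.prems in auto)
  then obtain W Y where W: "openin (top_of_set V) W" "W \<subseteq> U" "x0 \<in> W"
    and Y: "\<forall>i<n. \<forall>x\<in>W. Y i x \<in> V" "\<forall>i<n. \<forall>k\<in>K. Ck_on k V W (Y i)"
      "\<forall>x\<in>W. onfam (g x) {..<n} (\<lambda>i. Y i x)"
      "\<forall>x\<in>W. \<forall>m\<le>n. span ((\<lambda>i. Y i x) ` {..<m}) = span ((\<lambda>i. X i x) ` {..<m})"
    by (elim exE conjE) (rule that; assumption)
  note YV = Y(1)[rule_format] and YC = Y(2)[rule_format] and on = Y(3)[rule_format] and sp = Y(4)[rule_format]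
  have roW: "relopen V W" using V W by simp
  have gW: "inner_on V (g x)" if "x \<in> W" for x using g W that by auto
  have gfield: "Ck_on k V W (\<lambda>x. g x (A x) (B x))"
    if "Ck_on k V W A" "\<And>x. x \<in> W \<Longrightarrow> A x \<in> V" "Ck_on k V W B" "\<And>x. x \<in> W \<Longrightarrow> B x \<in> V" "k \<in> K" for A B k
  proof (rule Ck_on_bilin_field[OF roW V])
    show "lin_on V (\<lambda>v. g x v w)" if "x \<in> W" "w \<in> V" for x w by (rule inner_on_lin1[OF gW[OF that(1)] that(2)])
    show "lin_on V (g x v)" if "x \<in> W" "v \<in> V" for x v by (rule inner_on_lin2[OF gW[OF that(1)] V that(2)])
    show "Ck_on k V W (\<lambda>x. g x v w)" if "v \<in> V" "w \<in> V" for v w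
      by (rule Ck_on_subset[OF gC[OF that \<open>k \<in> K\<close>] W(2)])
  qed (use that in auto)
  have XW: "Ck_on k V W (X n)" if "k \<in> K" for k using Suc.prems(2) W Ck_on_subset that by blast
  have XnV: "X n x \<in> V" if "x \<in> W" for x using Suc.prems(1) W that by auto
  define Z where "Z x = X n x - (\<Sum>j<n. g x (X n x) (Y j x) *\<^sub>R Y j x)" for x
  have ZC: "Ck_on k V W Z" if "k \<in> K" for k
    unfolding Z_def using XW[OF that] XnV YC YV that
    by (intro Ck_on_diff Ck_on_sum Ck_on_scaleR roW gfield) auto
  have sumV: "(\<Sum>j<n. c j *\<^sub>R Y j x) \<in> V" if "x \<in> W" for x c
    using YV that by (intro subspace_sum V subspace_scale) auto
  have ZV: "Z x \<in> V" if "x \<in> W" for x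
    unfolding Z_def using XnV sumV that by (intro subspace_diff V) auto
  define s where "s x = g x (Z x) (Z x)" for x
  have sC: "Ck_on k V W s" if "k \<in> K" for k
    unfolding s_def using that ZC ZV by (intro gfield) auto
  \<comment> \<open>Independence is assumed at \<open>x0\<close> only. It makes the new vector
    \<open>Z\<close> nonzero there, and the neighbourhood shrinks to the set where the squared
    length \<open>s\<close> remains positive.\<close>
  define W' where "W' = {x \<in> W. s x > 0}"
  have oW': "openin (top_of_set V) W'"
    unfolding W'_def using K sC Ck_on_continuous by (intro relopen_pos[OF roW]) blast
  have W'W: "W' \<subseteq> W" by (auto simp: W'_def)
  have roW': "relopen V W'" using V oW' by simp
  have "Z x0 \<noteq> 0"
  proof
    assume "Z x0 = 0"
    then have "X n x0 = (\<Sum>j<n. g x0 (X n x0) (Y j x0) *\<^sub>R Y j x0)" by (simp add: Z_def)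
    also have "\<dots> \<in> span ((\<lambda>i. Y i x0) ` {..<n})"
      by (intro span_sum span_scale span_base) auto
    finally show False using Suc.prems(3)[of n] sp[OF W(3), of n] by simp
  qed
  then have x0W': "x0 \<in> W'"
    using inner_on_pos[OF gW[OF W(3)] ZV[OF W(3)]] W by (simp add: W'_def s_def)
  have ZY: "g x (Z x) (Y j x) = 0" if x: "x \<in> W" and j: "j < n" for x j
  proof -
    have "g x (Z x) (Y j x) = g x (X n x) (Y j x) - g x (\<Sum>j<n. g x (X n x) (Y j x) *\<^sub>R Y j x) (Y j x)"
      unfolding Z_def by (rule lin_on_diff[OF inner_on_lin1[OF gW[OF x] YV[OF j x]] XnV[OF x] sumV[OF x]])
    then show ?thesis
      using onfam_coeff[OF gW[OF x] V _ _ on[OF x], of j "\<lambda>j. g x (X n x) (Y j x)"] YV x j by simp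
  qed
  define Y' where "Y' i x = (if i < n then Y i x else s x powr (-1/2) *\<^sub>R Z x)" for i x
  have Y'V: "Y' i x \<in> V" if "i < Suc n" "x \<in> W'" for i x
    using that YV ZV W'W by (auto simp: Y'_def intro!: subspace_scale V)
  have Y'C: "Ck_on k V W' (Y' i)" if "i < Suc n" "k \<in> K" for i k
  proof (cases "i < n")
    case True
    then have "Y' i = Y i" by (auto simp: Y'_def)
    then show ?thesis using Ck_on_subset[OF YC[OF True that(2)] W'W] by simp
  next
    case False
    then have "Y' i = (\<lambda>x. s x powr (-1/2) *\<^sub>R Z x)" by (auto simp: Y'_def)
    moreover have "Ck_on k V W' (\<lambda>x. s x powr (-1/2) *\<^sub>R Z x)"
      using Ck_on_subset[OF sC[OF that(2)] W'W] Ck_on_subset[OF ZC[OF that(2)] W'W]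
      by (intro Ck_on_scaleR roW' Ck_on_powr) (auto simp: W'_def)
    ultimately show ?thesis by simp
  qed
  have on': "onfam (g x) {..<Suc n} (\<lambda>i. Y' i x)" if x: "x \<in> W'" for x
  proof -
    have xW: "x \<in> W" using x W'W by auto
    let ?c = "s x powr (-1/2)"
    have pos: "s x > 0" using x by (simp add: W'_def)
    have "?c * ?c = s x powr (-1)" by (subst powr_add[symmetric]) simp
    then have cc: "?c * ?c * s x = 1" using pos by (simp add: powr_neg_one)
    have n: "g x (?c *\<^sub>R Z x) w = ?c * g x (Z x) w" if "w \<in> V" for w
      using lin_on_scale[OF inner_on_lin1[OF gW[OF xW] that] ZV[OF xW]] by simp
    have cZ: "?c *\<^sub>R Z x \<in> V" using ZV[OF xW] V by (simp add: subspace_scale)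
    have 1: "g x (?c *\<^sub>R Z x) (Y j x) = 0" "g x (Y j x) (?c *\<^sub>R Z x) = 0" if "j < n" for j
      using n[OF YV[OF that xW]] ZY[OF xW that] inner_on_sym[OF gW[OF xW] YV[OF that xW] cZ] by auto
    have 2: "g x (?c *\<^sub>R Z x) (?c *\<^sub>R Z x) = 1"
      using n[OF cZ] lin_on_scale[OF inner_on_lin2[OF gW[OF xW] V ZV[OF xW]] ZV[OF xW], of ?c] cc
      by (simp add: s_def mult.assoc)
    show ?thesis
      unfolding onfam_def Y'_def using 1 2 on[OF xW] by (auto simp: onfam_def less_Suc_eq)
  qed
  \<comment> \<open>The spans are compared for every initial segment: the segment of length
    \<open>mdim M\<close> later separates the horizontal from the vertical vectors of an adapted
    frame.\<close>
  have sp': "span ((\<lambda>i. Y' i x) ` {..<m}) = span ((\<lambda>i. X i x) ` {..<m})" if x: "x \<in> W'" and m: "m \<le> Suc n" for x m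
  proof (cases "m \<le> n")
    case True
    then have "(\<lambda>i. Y' i x) ` {..<m} = (\<lambda>i. Y i x) ` {..<m}" by (intro image_cong) (auto simp: Y'_def)
    then show ?thesis using sp[of x m] x W'W True by auto
  next
    case False
    have xW: "x \<in> W" using x W'W by auto
    have mn: "m = Suc n" using False m by simp
    let ?S = "(\<lambda>i. Y i x) ` {..<n}" and ?T = "(\<lambda>i. X i x) ` {..<n}"
    let ?c = "s x powr (-1/2)"
    have c0: "?c \<noteq> 0" using x by (simp add: W'_def)
    have im: "(\<lambda>i. Y' i x) ` {..<m} = insert (?c *\<^sub>R Z x) ?S"
      unfolding mn lessThan_Suc by (auto simp: Y'_def)
    have im2: "(\<lambda>i. X i x) ` {..<m} = insert (X n x) ?T"
      unfolding mn lessThan_Suc by auto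
    have S: "span ?S = span ?T" using sp[OF xW] by simp
    have rest: "(\<Sum>j<n. g x (X n x) (Y j x) *\<^sub>R Y j x) \<in> span ?S"
      by (intro span_sum span_scale span_base) auto
    have "Z x \<in> span (insert (X n x) ?T)"
      unfolding Z_def using rest S span_mono[of ?T "insert (X n x) ?T"]
      by (intro span_diff) (auto intro: span_base)
    moreover have "X n x \<in> span (insert (?c *\<^sub>R Z x) ?S)"
    proof -
      have e: "X n x = (1 / ?c) *\<^sub>R (?c *\<^sub>R Z x) + (\<Sum>j<n. g x (X n x) (Y j x) *\<^sub>R Y j x)"
        using c0 by (simp add: Z_def)
      have a: "?c *\<^sub>R Z x \<in> span (insert (?c *\<^sub>R Z x) ?S)" by (rule span_base) simp
      have b: "(\<Sum>j<n. g x (X n x) (Y j x) *\<^sub>R Y j x) \<in> span (insert (?c *\<^sub>R Z x) ?S)"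
        using rest span_mono[of ?S "insert (?c *\<^sub>R Z x) ?S"] by blast
      show ?thesis by (subst e) (rule span_add[OF span_scale[OF a] b])
    qed
    moreover have "?S \<subseteq> span (insert (X n x) ?T)"
      using S span_superset[of ?S] span_mono[of ?T "insert (X n x) ?T"] by auto
    moreover have "?T \<subseteq> span (insert (?c *\<^sub>R Z x) ?S)"
      using S span_superset[of ?T] span_mono[of ?S "insert (?c *\<^sub>R Z x) ?S"] by auto
    ultimately show ?thesis unfolding im im2
      by (intro subset_antisym span_minimal subspace_span) (auto intro: span_scale)
  qed
  show ?case
    using oW' W'W W x0W' Y'V Y'C on' sp' by (intro exI[of _ W'] exI[of _ Y']) auto
qed

lemma onb_enum:
  fixes V :: "'e::euclidean_space set"
  assumes "subspace V"
  obtains e where "\<And>i. i < dim V \<Longrightarrow> e i \<in> V" "span (e ` {..<dim V}) = V"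
    "\<And>i. i < dim V \<Longrightarrow> e i \<notin> span (e ` {..<i})"
proof -
  note o = onb_props[OF assms]
  obtain e where e: "bij_betw e {..<dim V} (onb V)"
    using ex_bij_betw_nat_finite[OF o(7)] o(5) by (auto simp: atLeast0LessThan)
  have "e i \<notin> span (e ` {..<i})" if i: "i < dim V" for i
  proof
    assume a: "e i \<in> span (e ` {..<i})"
    have "e ` {..<i} \<subseteq> onb V - {e i}"
      using e i by (auto simp: bij_betw_def inj_on_def)
    then have "e i \<in> span (onb V - {e i})" using a span_mono by blast
    then show False using o(4) e i unfolding dependent_def bij_betw_def by blast
  qed
  moreover have "span (e ` {..<dim V}) = V" using e o(6) by (simp add: bij_betw_def)
  moreover have "e i \<in> V" if "i < dim V" for i using e o(1) that by (auto simp: bij_betw_def)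
  ultimately show ?thesis using that by blast
qed

text \<open>Gram-Schmidt applied to constant fields. A single degree \<open>k\<close> is treated
  because in \<open>inverse_Ck\<close> the inner products are themselves known to that degree
  only.\<close>

lemma local_onframe:
  fixes V :: "'e::euclidean_space set"
  assumes ro: "relopen V U" and x0: "x0 \<in> U"
    and g: "\<And>x. x \<in> U \<Longrightarrow> inner_on V (g x)"
    and gC: "\<And>a b. a \<in> V \<Longrightarrow> b \<in> V \<Longrightarrow> Ck_on k V U (\<lambda>x. g x a b)"
  shows "\<exists>W Y. openin (top_of_set V) W \<and> W \<subseteq> U \<and> x0 \<in> W \<and> (\<forall>i<dim V. \<forall>x\<in>W. Y i x \<in> V) \<and>
     (\<forall>i<dim V. Ck_on k V W (Y i)) \<and> (\<forall>x\<in>W. onfam (g x) {..<dim V} (\<lambda>i. Y i x))"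
proof -
  have V: "subspace V" using ro by simp
  obtain e where e: "\<And>i. i < dim V \<Longrightarrow> e i \<in> V" "\<And>i. i < dim V \<Longrightarrow> e i \<notin> span (e ` {..<i})"
    using onb_enum[OF V] by metis
  show ?thesis
    using gram_schmidt[OF ro x0, of "{k}" g "dim V" "\<lambda>i x. e i"] g gC e by auto
qed

text \<open>A single inner product is viewed as a constant field of inner products, and the frame is
  evaluated at the origin.\<close>

lemma onfam_exists:
  fixes V :: "'e::euclidean_space set"
  assumes V: "subspace V" and g: "inner_on V g"
  shows "\<exists>Y. (\<forall>i<dim V. Y i \<in> V) \<and> onfam g {..<dim V} Y"
proof -
  have ro: "relopen V V" and "0 \<in> V" using V subspace_0 by auto
  obtain W :: "'e set" and Y where "0 \<in> W" "\<forall>i<dim V. \<forall>x\<in>W. Y i x \<in> V" "\<forall>x\<in>W. onfam g {..<dim V} (\<lambda>i. Y i x)"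
    using local_onframe[OF ro \<open>0 \<in> V\<close> g, of 0, OF Ck_on_const]
    by (elim exE conjE) (rule that; assumption)
  then show ?thesis by (intro exI[of _ "\<lambda>i. Y i 0"]) auto
qed

text \<open>The representing vector has the coefficients \<open>l (Y i)\<close> in an orthonormal
  basis \<open>Y\<close>. Unique existence is the form required by the definite descriptions
  \<open>christoffel\<close> and \<open>grad\<close>.\<close>

lemma riesz:
  fixes V :: "'e::euclidean_space set"
  assumes V: "subspace V" and g: "inner_on V g" and l: "lin_on V l"
  shows "\<exists>!v. v \<in> V \<and> (\<forall>w\<in>V. g v w = l w)"
proof -
  obtain Y where Y: "\<And>i. i < dim V \<Longrightarrow> Y i \<in> V" and on: "onfam g {..<dim V} Y"
    using onfam_exists[OF V g] by blast
  define v where "v = (\<Sum>i<dim V. l (Y i) *\<^sub>R Y i)"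
  have vV: "v \<in> V" unfolding v_def using Y by (intro subspace_sum V subspace_scale) auto
  have "g v w = l w" if w: "w \<in> V" for w
  proof -
    have ew: "w = (\<Sum>i<dim V. g w (Y i) *\<^sub>R Y i)"
      by (rule onfam_expand[OF g V _ _ on _ w]) (use Y in auto)
    have "g v w = (\<Sum>i<dim V. l (Y i) *\<^sub>R g (Y i) w)"
      unfolding v_def using Y by (intro lin_on_sum[OF inner_on_lin1[OF g w] V]) auto
    also have "\<dots> = (\<Sum>i<dim V. g w (Y i) *\<^sub>R l (Y i))"
      using inner_on_sym[OF g w Y] by (intro sum.cong) auto
    also have "\<dots> = l (\<Sum>i<dim V. g w (Y i) *\<^sub>R Y i)"
      using Y by (intro lin_on_sum[OF l V, symmetric]) auto
    finally show ?thesis using ew by simp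
  qed
  then show ?thesis using vV inner_on_eqI[OF g V] by (intro ex1I[of _ v]) auto
qed

text \<open>In a local orthonormal frame the solution of \<open>g x (Z x) w = l x w\<close> is the
  sum of \<open>l x (Y i x) *\<^sub>R Y i x\<close>, so its smoothness follows without inverting a
  Gram matrix. This gives the smoothness of Christoffel symbols, gradients, horizontal fields and
  derivatives of inverse maps.\<close>

lemma Ck_on_solve:
  fixes V :: "'e::euclidean_space set"
  assumes ro: "relopen V U"
    and g: "\<And>x. x \<in> U \<Longrightarrow> inner_on V (g x)"
    and gC: "\<And>a b. a \<in> V \<Longrightarrow> b \<in> V \<Longrightarrow> Ck_on k V U (\<lambda>x. g x a b)"
    and l: "\<And>x. x \<in> U \<Longrightarrow> lin_on V (l x)"
    and lC: "\<And>a. a \<in> V \<Longrightarrow> Ck_on k V U (\<lambda>x. l x a)"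
    and Z: "\<And>x. x \<in> U \<Longrightarrow> Z x \<in> V" "\<And>x w. x \<in> U \<Longrightarrow> w \<in> V \<Longrightarrow> g x (Z x) w = l x w"
  shows "Ck_on k V U Z"
proof (rule Ck_on_local[OF ro])
  have V: "subspace V" using ro by simp
  fix x0 assume x0: "x0 \<in> U"
  obtain W Y where W: "openin (top_of_set V) W" "W \<subseteq> U" "x0 \<in> W"
    and YV: "\<And>i x. i < dim V \<Longrightarrow> x \<in> W \<Longrightarrow> Y i x \<in> V" and YC: "\<And>i. i < dim V \<Longrightarrow> Ck_on k V W (Y i)"
    and on: "\<And>x. x \<in> W \<Longrightarrow> onfam (g x) {..<dim V} (\<lambda>i. Y i x)"
    using local_onframe[OF ro x0 g gC] by blast
  have roW: "relopen V W" using V W by simp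
  have "Ck_on k V W Z"
  proof (rule Ck_on_cong[OF roW])
    have "Ck_on k V W (\<lambda>x. l x (Y i x))" if i: "i < dim V" for i
    proof (rule Ck_on_cong[OF roW])
      show "Ck_on k V W (\<lambda>x. \<Sum>b\<in>onb V. (Y i x \<bullet> b) *\<^sub>R l x b)"
        using onb_props(1)[OF V] Ck_on_subset[OF lC W(2)]
        by (intro Ck_on_sum Ck_on_scaleR Ck_on_inner roW YC i Ck_on_const) auto
      show "(\<Sum>b\<in>onb V. (Y i x \<bullet> b) *\<^sub>R l x b) = l x (Y i x)" if "x \<in> W" for x
        using lin_on_expand[OF V l YV[OF i that]] W that by auto
    qed
    then show "Ck_on k V W (\<lambda>x. \<Sum>i<dim V. l x (Y i x) *\<^sub>R Y i x)"
      using YC by (intro Ck_on_sum Ck_on_scaleR roW) auto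
    fix x assume x: "x \<in> W"
    then have xU: "x \<in> U" using W by auto
    have "Z x = (\<Sum>i<dim V. g x (Z x) (Y i x) *\<^sub>R Y i x)"
      by (rule onfam_expand[OF g[OF xU] V _ _ on[OF x] _ Z(1)[OF xU]]) (use YV x in auto)
    then show "(\<Sum>i<dim V. l x (Y i x) *\<^sub>R Y i x) = Z x" using Z(2)[OF xU] YV x by simp
  qed
  then show "\<exists>W. openin (top_of_set V) W \<and> x0 \<in> W \<and> Ck_on k V (U \<inter> W) Z"
    using W Ck_on_subset[of k V W Z "U \<inter> W"] by auto
qed

section \<open>Charts\<close>

lemma smooth_manifoldD:
  assumes "smooth_manifold M"
  shows "subspace (model M)" "(\<Union>c\<in>atlas M. fst c) = points M" "Hausdorff_space (mtop M)"
    "\<And>c. c \<in> atlas M \<Longrightarrow> openin (mtop M) (fst c)"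
    "\<And>c. c \<in> atlas M \<Longrightarrow> openin (top_of_set (model M)) (snd c ` fst c)"
    "\<And>c. c \<in> atlas M \<Longrightarrow> homeomorphic_map (subtopology (mtop M) (fst c)) (top_of_set (snd c ` fst c)) (snd c)"
    "\<And>c c'. c \<in> atlas M \<Longrightarrow> c' \<in> atlas M \<Longrightarrow> Cinf_on (model M) (snd c ` (fst c \<inter> fst c')) (snd c' \<circ> cinv c)"
  using assms unfolding smooth_manifold_def by blast+

lemma chart_subset: "smooth_manifold M \<Longrightarrow> c \<in> atlas M \<Longrightarrow> fst c \<subseteq> points M"
  using smooth_manifoldD(2) by blast

lemma chart_inj:
  assumes "smooth_manifold M" "c \<in> atlas M" shows "inj_on (snd c) (fst c)"
proof -
  have "topspace (subtopology (mtop M) (fst c)) = fst c"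
    using chart_subset[OF assms] by (auto simp: topspace_subtopology)
  then show ?thesis
    using smooth_manifoldD(6)[OF assms] homeomorphic_imp_injective_map by metis
qed

lemma cinv_left: "smooth_manifold M \<Longrightarrow> c \<in> atlas M \<Longrightarrow> p \<in> fst c \<Longrightarrow> cinv c (snd c p) = p"
  unfolding cinv_def using chart_inj inv_into_f_f by metis

lemma cinv_in: "x \<in> snd c ` fst c \<Longrightarrow> cinv c x \<in> fst c"
  unfolding cinv_def by (rule inv_into_into)

lemma cinv_right: "x \<in> snd c ` fst c \<Longrightarrow> snd c (cinv c x) = x"
  unfolding cinv_def by (rule f_inv_into_f)

lemma chart_image_relopen:
  assumes "smooth_manifold M" "c \<in> atlas M" "openin (mtop M) W" "W \<subseteq> fst c"
  shows "relopen (model M) (snd c ` W)"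
proof -
  note s = smooth_manifoldD[OF assms(1)]
  have "openin (subtopology (mtop M) (fst c)) W"
    using assms(3,4) by (metis inf.absorb_iff2 inf_commute openin_subtopology_Int)
  then have "openin (top_of_set (snd c ` fst c)) (snd c ` W)"
    using homeomorphic_imp_open_map[OF s(6)[OF assms(2)]] by (simp add: open_map_def)
  then show ?thesis using s(1) s(5)[OF assms(2)] openin_trans by blast
qed

lemma chart_relopen:
  "smooth_manifold M \<Longrightarrow> c \<in> atlas M \<Longrightarrow> relopen (model M) (snd c ` fst c)"
  using smooth_manifoldD(1,5) by blast

lemma chart_overlap_relopen:
  assumes "smooth_manifold M" "c \<in> atlas M" "openin (mtop M) W"
  shows "relopen (model M) (snd c ` (fst c \<inter> W))"
  using assms smooth_manifoldD(4)[OF assms(1,2)] by (intro chart_image_relopen) auto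

lemma chart_in_model: "smooth_manifold M \<Longrightarrow> c \<in> atlas M \<Longrightarrow> p \<in> fst c \<Longrightarrow> snd c p \<in> model M"
  using chart_relopen relopen_subset by blast

lemma chart_preimage_open:
  assumes "smooth_manifold M" "c \<in> atlas M" "openin (top_of_set (model M)) S"
  shows "openin (mtop M) {p \<in> fst c. snd c p \<in> S}"
proof -
  note s = smooth_manifoldD[OF assms(1)]
  have ts: "topspace (subtopology (mtop M) (fst c)) = fst c"
    using chart_subset[OF assms(1,2)] by (auto simp: topspace_subtopology)
  obtain T where T: "open T" "S = model M \<inter> T" using assms(3) by (auto simp: openin_open)
  have "continuous_map (subtopology (mtop M) (fst c)) (top_of_set (snd c ` fst c)) (snd c)"
    using homeomorphic_imp_continuous_map[OF s(6)[OF assms(2)]] .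
  then have "continuous_map (subtopology (mtop M) (fst c)) euclidean (snd c)"
    by (simp add: continuous_map_in_subtopology)
  from openin_continuous_map_preimage[OF this, of T] T
  have "openin (subtopology (mtop M) (fst c)) {p \<in> fst c. snd c p \<in> T}" unfolding ts by simp
  moreover have "{p \<in> fst c. snd c p \<in> T} = {p \<in> fst c. snd c p \<in> S}"
    using T chart_in_model[OF assms(1,2)] by auto
  ultimately show ?thesis using s(4)[OF assms(2)] openin_trans_full by metis
qed

lemma cinv_continuous:
  assumes "smooth_manifold M" "c \<in> atlas M"
  shows "continuous_map (top_of_set (snd c ` fst c)) (mtop M) (cinv c)"
  unfolding continuous_map
proof (intro conjI allI impI)
  show "cinv c ` topspace (top_of_set (snd c ` fst c)) \<subseteq> points M"
    using chart_subset[OF assms] by (auto simp: cinv_left[OF assms])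
  fix W assume W: "openin (mtop M) W"
  have "openin (top_of_set (model M)) (snd c ` (fst c \<inter> W))"
    using chart_overlap_relopen[OF assms W] by simp
  then have "openin (top_of_set (snd c ` fst c)) (snd c ` (fst c \<inter> W))"
    by (rule openin_subset_trans) (use relopen_subset[OF chart_relopen[OF assms]] in auto)
  moreover have "{x \<in> topspace (top_of_set (snd c ` fst c)). cinv c x \<in> W} = snd c ` (fst c \<inter> W)"
    by (auto simp: cinv_left[OF assms])
  ultimately show "openin (top_of_set (snd c ` fst c)) {x \<in> topspace (top_of_set (snd c ` fst c)). cinv c x \<in> W}"
    by simp
qed

section \<open>Tangent vectors and differentials under change of chart\<close>

lemma chart_at_props:
  assumes "smooth_manifold M" "p \<in> points M"
  shows "chart_at M p \<in> atlas M" "p \<in> fst (chart_at M p)"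
proof -
  have "\<exists>c. c \<in> atlas M \<and> p \<in> fst c" using smooth_manifoldD(2)[OF assms(1)] assms(2) by blast
  from someI_ex[OF this, folded chart_at_def] show "chart_at M p \<in> atlas M" "p \<in> fst (chart_at M p)" by auto
qed

text \<open>The differential at \<open>p\<close> of the transition map from \<open>c\<close> to
  \<open>c'\<close>. Both \<open>comps\<close> and \<open>tvec\<close> are instances, with the
  preferred chart at one end, so that their properties follow from a cocycle rule.\<close>

definition tchange :: "('a, 'e::real_normed_vector) chart \<Rightarrow> ('a, 'e) chart \<Rightarrow> 'a \<Rightarrow> 'e \<Rightarrow> 'e" where
  "tchange c c' p v = dird (snd c' \<circ> cinv c) (snd c p) v"

lemma comps_tchange: "comps M c p = tchange (chart_at M p) c p"
  by (simp add: fun_eq_iff comps_def tchange_def Let_def)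

lemma tvec_tchange: "tvec M c p = tchange c (chart_at M p) p"
  by (simp add: fun_eq_iff tvec_def tchange_def Let_def)

text \<open>The chain rule for the transition map. The set \<open>W\<close> permits functions that
  are smooth only near \<open>p\<close>, such as the components of a map in a chart of the
  target.\<close>

lemma rep_change:
  fixes f :: "'a \<Rightarrow> 'w::real_normed_vector"
  assumes sm: "smooth_manifold M" and c1: "c1 \<in> atlas M" and c2: "c2 \<in> atlas M"
    and W: "openin (mtop M) W" and f: "Ck_on (Suc k) (model M) (snd c2 ` (fst c2 \<inter> W)) (f \<circ> cinv c2)"
    and p: "p \<in> fst c1" "p \<in> fst c2" "p \<in> W" and v: "v \<in> model M"
  shows "dird (f \<circ> cinv c1) (snd c1 p) v = dird (f \<circ> cinv c2) (snd c2 p) (tchange c1 c2 p v)"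
proof -
  let ?V = "model M" and ?U = "snd c1 ` (fst c1 \<inter> (fst c2 \<inter> W))" and ?U' = "snd c2 ` (fst c2 \<inter> W)"
  have ro: "relopen ?V ?U"
    using W smooth_manifoldD(4)[OF sm c2] by (intro chart_overlap_relopen[OF sm c1]) auto
  have ro': "relopen ?V ?U'" by (rule chart_overlap_relopen[OF sm c2 W])
  have x: "snd c1 p \<in> ?U" using p by auto
  have t: "Ck_on (Suc 0) ?V ?U (snd c2 \<circ> cinv c1)"
    by (rule Ck_on_subset[OF Cinf_on_Ck[OF smooth_manifoldD(7)[OF sm c1 c2]]]) auto
  have eq: "(f \<circ> cinv c1) y = (f \<circ> cinv c2) ((snd c2 \<circ> cinv c1) y)" if "y \<in> ?U" for y
    using that cinv_left[OF sm c1] cinv_left[OF sm c2] by auto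
  have im: "(snd c2 \<circ> cinv c1) ` ?U \<subseteq> ?U'" using cinv_left[OF sm c1] by auto
  have "dird (f \<circ> cinv c1) (snd c1 p) v = dird (\<lambda>y. (f \<circ> cinv c2) ((snd c2 \<circ> cinv c1) y)) (snd c1 p) v"
    by (rule dird_cong[OF ro x v eq])
  also have "\<dots> = dird (f \<circ> cinv c2) ((snd c2 \<circ> cinv c1) (snd c1 p)) (dird (snd c2 \<circ> cinv c1) (snd c1 p) v)"
    by (rule dird_chain(2)[OF ro ro' t f im x v])
  finally show ?thesis using cinv_left[OF sm c1 p(1)] by (simp add: tchange_def)
qed

lemma transition_Ck:
  assumes "smooth_manifold M" "c \<in> atlas M" "c' \<in> atlas M"
  shows "Ck_on k (model M) (snd c ` (fst c \<inter> fst c')) (snd c' \<circ> cinv c)"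
  by (rule Cinf_on_Ck[OF smooth_manifoldD(7)[OF assms]])

lemma tchange_trans:
  assumes sm: "smooth_manifold M" and c: "c1 \<in> atlas M" "c2 \<in> atlas M" "c3 \<in> atlas M"
    and p: "p \<in> fst c1" "p \<in> fst c2" "p \<in> fst c3" and v: "v \<in> model M"
  shows "tchange c2 c3 p (tchange c1 c2 p v) = tchange c1 c3 p v"
  using rep_change[OF sm c(1,2) smooth_manifoldD(4)[OF sm c(3)] transition_Ck[OF sm c(2,3)] p v]
  by (simp add: tchange_def)

lemma tchange_self:
  assumes sm: "smooth_manifold M" and c: "c \<in> atlas M" and p: "p \<in> fst c" and v: "v \<in> model M"
  shows "tchange c c p v = v"
proof -
  have ro: "relopen (model M) (snd c ` fst c)" by (rule chart_relopen[OF sm c])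
  have "dird (snd c \<circ> cinv c) (snd c p) v = dird (\<lambda>x. x) (snd c p) v"
    by (rule dird_cong[OF ro _ v]) (use p cinv_left[OF sm c] in auto)
  also have "\<dots> = v" by (rule dird_eqI) (auto intro!: derivative_eq_intros)
  finally show ?thesis by (simp add: tchange_def)
qed

lemma tchange_lin:
  assumes sm: "smooth_manifold M" and c: "c1 \<in> atlas M" "c2 \<in> atlas M" and p: "p \<in> fst c1" "p \<in> fst c2"
  shows "lin_on (model M) (tchange c1 c2 p)"
  unfolding tchange_def
  by (rule lin_on_dird[OF chart_overlap_relopen[OF sm c(1) smooth_manifoldD(4)[OF sm c(2)]] transition_Ck[OF sm c, of "Suc 0"]])
    (use p in auto)

lemma tchange_in:
  assumes sm: "smooth_manifold M" and c: "c1 \<in> atlas M" "c2 \<in> atlas M" and p: "p \<in> fst c1" "p \<in> fst c2"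
    and v: "v \<in> model M"
  shows "tchange c1 c2 p v \<in> model M"
  unfolding tchange_def
proof (rule dird_in_subspace[OF chart_overlap_relopen[OF sm c(1) smooth_manifoldD(4)[OF sm c(2)]]])
  show "snd c1 p \<in> snd c1 ` (fst c1 \<inter> fst c2)" using p by auto
  then show "(\<lambda>t. (snd c2 \<circ> cinv c1) (snd c1 p + t *\<^sub>R v)) differentiable at 0"
    by (rule Ck_on_differentiable[OF transition_Ck[OF sm c, of "Suc 0"] v])
  show "(snd c2 \<circ> cinv c1) y \<in> model M" if "y \<in> snd c1 ` (fst c1 \<inter> fst c2)" for y
    using that cinv_left[OF sm c(1)] chart_in_model[OF sm c(2)] by auto
qed (use v smooth_manifoldD[OF sm] in auto)

lemma
  assumes sm: "smooth_manifold M" and c: "c \<in> atlas M" and p: "p \<in> fst c"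
  shows comps_in: "v \<in> model M \<Longrightarrow> comps M c p v \<in> model M"
    and tvec_in: "v \<in> model M \<Longrightarrow> tvec M c p v \<in> model M"
    and comps_tvec: "v \<in> model M \<Longrightarrow> comps M c p (tvec M c p v) = v"
    and tvec_comps: "v \<in> model M \<Longrightarrow> tvec M c p (comps M c p v) = v"
    and comps_lin: "lin_on (model M) (comps M c p)"
    and tvec_lin: "lin_on (model M) (tvec M c p)"
proof -
  have "p \<in> points M" using chart_subset[OF sm c] p by auto
  note ca = chart_at_props[OF sm this]
  show "v \<in> model M \<Longrightarrow> comps M c p v \<in> model M" "v \<in> model M \<Longrightarrow> tvec M c p v \<in> model M"
    "lin_on (model M) (comps M c p)" "lin_on (model M) (tvec M c p)"
    unfolding comps_tchange tvec_tchange using tchange_in[OF sm] tchange_lin[OF sm] ca c p by auto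
  show "v \<in> model M \<Longrightarrow> comps M c p (tvec M c p v) = v" "v \<in> model M \<Longrightarrow> tvec M c p (comps M c p v) = v"
    unfolding comps_tchange tvec_tchange using tchange_trans[OF sm] tchange_self[OF sm] ca c p by simp_all
qed

lemma
  assumes sm: "smooth_manifold M" and p: "p \<in> points M" and v: "v \<in> model M"
  shows comps_chart_at: "comps M (chart_at M p) p v = v" and tvec_chart_at: "tvec M (chart_at M p) p v = v"
  unfolding comps_tchange tvec_tchange using tchange_self[OF sm] chart_at_props[OF sm p] v by auto

lemma dfun_rep:
  assumes sm: "smooth_manifold M" and c: "c \<in> atlas M" and p: "p \<in> fst c" "p \<in> W" and W: "openin (mtop M) W"
    and f: "Ck_on (Suc k) (model M) (snd c ` (fst c \<inter> W)) (f \<circ> cinv c)" and v: "v \<in> model M"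
  shows "dfun M f p v = dird (f \<circ> cinv c) (snd c p) (comps M c p v)"
proof -
  have "p \<in> points M" using chart_subset[OF sm c] p by auto
  note ca = chart_at_props[OF sm this]
  show ?thesis
    using rep_change[OF sm ca(1) c W f ca(2) p v] by (simp add: dfun_def comps_tchange Let_def)
qed

lemma smooth_map_relopen:
  assumes "smooth_manifold M" "smooth_manifold N" "smooth_map M N h" "c \<in> atlas M" "c' \<in> atlas N"
  shows "openin (mtop M) (points M \<inter> h -` fst c')" "relopen (model M) (snd c ` (fst c \<inter> h -` fst c'))"
proof -
  have "continuous_map (mtop M) (mtop N) h" using assms(3) by (simp add: smooth_map_def)
  from openin_continuous_map_preimage[OF this smooth_manifoldD(4)[OF assms(2,5)]]
  show o: "openin (mtop M) (points M \<inter> h -` fst c')" by (simp add: vimage_def Int_def)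
  have "fst c \<inter> h -` fst c' = fst c \<inter> (points M \<inter> h -` fst c')" using chart_subset[OF assms(1,4)] by auto
  then show "relopen (model M) (snd c ` (fst c \<inter> h -` fst c'))"
    using chart_overlap_relopen[OF assms(1,4) o] by simp
qed

lemma smooth_map_Ck:
  assumes "smooth_map M N h" "c \<in> atlas M" "c' \<in> atlas N"
  shows "Ck_on k (model M) (snd c ` (fst c \<inter> h -` fst c')) (snd c' \<circ> h \<circ> cinv c)"
  using assms unfolding smooth_map_def Cinf_on_def by blast

text \<open>\<open>dmap\<close> uses the preferred charts at \<open>p\<close> and
  \<open>h p\<close>, which may jump as \<open>p\<close> moves. This formula replaces them by one
  fixed pair of charts, as is necessary for differentiating over a neighbourhood.\<close>

lemma dmap_rep:
  assumes sm: "smooth_manifold M" and sn: "smooth_manifold N" and h: "smooth_map M N h"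
    and c: "c \<in> atlas M" and c': "c' \<in> atlas N" and p: "p \<in> fst c" "h p \<in> fst c'" and v: "v \<in> model M"
  shows "dmap M N h p v = tvec N c' (h p) (dird (snd c' \<circ> h \<circ> cinv c) (snd c p) (comps M c p v))"
proof -
  let ?e = "chart_at N (h p)" and ?b = "chart_at M p"
  let ?W = "points M \<inter> h -` fst ?e"
  have pM: "p \<in> points M" using chart_subset[OF sm c] p by auto
  have pN: "h p \<in> points N" using chart_subset[OF sn c'] p by auto
  note cb = chart_at_props[OF sm pM] and ce = chart_at_props[OF sn pN]
  have W: "openin (mtop M) ?W" by (rule smooth_map_relopen(1)[OF sm sn h cb(1) ce(1)])
  have Weq: "fst c \<inter> ?W = fst c \<inter> h -` fst ?e" using chart_subset[OF sm c] by auto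
  have 1: "dird (snd ?e \<circ> h \<circ> cinv ?b) (snd ?b p) v = dird (snd ?e \<circ> h \<circ> cinv c) (snd c p) (comps M c p v)"
    using rep_change[OF sm cb(1) c W, of 0 "snd ?e \<circ> h" p v] smooth_map_Ck[OF h c ce(1), of 1] p pM ce cb v Weq
    by (simp add: comps_tchange)
  let ?U = "snd c ` (fst c \<inter> h -` fst ?e \<inter> h -` fst c')" and ?U' = "snd c' ` (fst c' \<inter> fst ?e)"
  have w: "comps M c p v \<in> model M" by (rule comps_in[OF sm c p(1) v])
  have "openin (mtop M) (?W \<inter> (points M \<inter> h -` fst c'))"
    using W smooth_map_relopen(1)[OF sm sn h c c'] by (rule openin_Int)
  from chart_overlap_relopen[OF sm c this]
  have ro: "relopen (model M) ?U" using chart_subset[OF sm c]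
    by (simp add: Int_ac inf.absorb1 inf_left_commute) (smt (verit) Int_absorb1 Int_assoc Int_commute)
  have ro': "relopen (model N) ?U'" by (rule chart_overlap_relopen[OF sn c' smooth_manifoldD(4)[OF sn ce(1)]])
  have x: "snd c p \<in> ?U" using p ce by auto
  have Ck: "Ck_on (Suc 0) (model M) ?U (snd c' \<circ> h \<circ> cinv c)"
    by (rule Ck_on_subset[OF smooth_map_Ck[OF h c c']]) auto
  have "dird (snd ?e \<circ> h \<circ> cinv c) (snd c p) (comps M c p v) =
    dird (\<lambda>y. (snd ?e \<circ> cinv c') ((snd c' \<circ> h \<circ> cinv c) y)) (snd c p) (comps M c p v)"
    by (rule dird_cong[OF ro x w]) (use cinv_left[OF sm c] cinv_left[OF sn c'] in auto)
  also have "\<dots> = dird (snd ?e \<circ> cinv c') ((snd c' \<circ> h \<circ> cinv c) (snd c p)) (dird (snd c' \<circ> h \<circ> cinv c) (snd c p) (comps M c p v))"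
    by (rule dird_chain(2)[OF ro ro' Ck transition_Ck[OF sn c' ce(1), of "Suc 0"] _ x w])
      (use cinv_left[OF sm c] in auto)
  finally show ?thesis using 1 cinv_left[OF sm c p(1)]
    by (simp add: dmap_def tvec_tchange tchange_def Let_def)
qed

lemma rep_in_model:
  assumes sm: "smooth_manifold M" and sn: "smooth_manifold N" and h: "smooth_map M N h"
    and c: "c \<in> atlas M" and c': "c' \<in> atlas N" and x: "x \<in> snd c ` (fst c \<inter> h -` fst c')" and v: "v \<in> model M"
  shows "dird (snd c' \<circ> h \<circ> cinv c) x v \<in> model N"
proof (rule dird_in_subspace[OF smooth_map_relopen(2)[OF sm sn h c c'] _ x v])
  show "(\<lambda>t. (snd c' \<circ> h \<circ> cinv c) (x + t *\<^sub>R v)) differentiable at 0"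
    by (rule Ck_on_differentiable[OF smooth_map_Ck[OF h c c', of "Suc 0"] v x])
  show "(snd c' \<circ> h \<circ> cinv c) y \<in> model N" if "y \<in> snd c ` (fst c \<inter> h -` fst c')" for y
    using that cinv_left[OF sm c] chart_in_model[OF sn c'] by auto
qed (rule smooth_manifoldD(1)[OF sn])

section \<open>Riemannian metrics in coordinates\<close>

lemma riemannian_manifoldD:
  assumes "riemannian_manifold M"
  shows "smooth_manifold M" "\<And>p. p \<in> points M \<Longrightarrow> inner_on (model M) (metric M p)"
    "\<And>c a b. c \<in> atlas M \<Longrightarrow> a \<in> model M \<Longrightarrow> b \<in> model M \<Longrightarrow> Cinf_on (model M) (snd c ` fst c) (\<lambda>x. gcomp M c x a b)"
  using assms unfolding riemannian_manifold_def inner_on_def lin_on_def by auto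

lemma gcomp_at:
  assumes "smooth_manifold M" "c \<in> atlas M" "p \<in> fst c"
  shows "gcomp M c (snd c p) a b = metric M p (tvec M c p a) (tvec M c p b)"
  by (simp add: gcomp_def Let_def cinv_left[OF assms])

lemma gcomp_chart_at:
  assumes sm: "smooth_manifold M" and p: "p \<in> points M" and ab: "a \<in> model M" "b \<in> model M"
  shows "gcomp M (chart_at M p) (snd (chart_at M p) p) a b = metric M p a b"
  using gcomp_at[OF sm chart_at_props[OF sm p]] tvec_chart_at[OF sm p] ab by simp

lemma gcomp_inner:
  assumes R: "riemannian_manifold M" and c: "c \<in> atlas M" and x: "x \<in> snd c ` fst c"
  shows "inner_on (model M) (gcomp M c x)"
proof -
  note sm = riemannian_manifoldD(1)[OF R]
  obtain p where p: "p \<in> fst c" "x = snd c p" using x by auto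
  have pM: "p \<in> points M" using chart_subset[OF sm c] p by auto
  note g = riemannian_manifoldD(2)[OF R pM]
  note ti = tvec_in[OF sm c p(1)] and tl = tvec_lin[OF sm c p(1)]
  \<comment> \<open>Positive definiteness is inherited because \<open>tvec\<close> is injective,
    having \<open>comps\<close> as its inverse.\<close>
  have nz: "tvec M c p v \<noteq> 0" if "v \<in> model M" "v \<noteq> 0" for v
  proof
    assume "tvec M c p v = 0"
    then have "v = comps M c p 0" using comps_tvec[OF sm c p(1) that(1)] by simp
    then show False using lin_on_zero[OF comps_lin[OF sm c p(1)] smooth_manifoldD(1)[OF sm]] that by simp
  qed
  have "gcomp M c x (r *\<^sub>R a + s *\<^sub>R b) w = r * gcomp M c x a w + s * gcomp M c x b w"
    if "a \<in> model M" "b \<in> model M" "w \<in> model M" for a b w r s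
    using lin_onD[OF inner_on_lin1[OF g ti[OF that(3)]] ti[OF that(1)] ti[OF that(2)]] lin_onD[OF tl that(1,2)]
    by (simp add: p(2) gcomp_at[OF sm c p(1)])
  then show ?thesis
    using inner_on_sym[OF g ti ti] inner_on_pos[OF g ti] nz
    by (simp add: p(2) gcomp_at[OF sm c p(1)] inner_on_def lin_on_def)
qed

lemma lin_on_dird_param:
  assumes ro: "relopen V U" and x: "x \<in> U" and a: "a \<in> V" and S: "subspace S"
    and l: "\<And>y. y \<in> U \<Longrightarrow> lin_on S (B y)"
    and B: "\<And>z. z \<in> S \<Longrightarrow> Ck_on (Suc k) V U (\<lambda>y. B y z)"
  shows "lin_on S (\<lambda>z. dird (\<lambda>y. B y z) x a)"
  unfolding lin_on_def
proof (intro ballI allI)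
  fix z w r s assume zw: "z \<in> S" "w \<in> S"
  have "((\<lambda>t. r *\<^sub>R B (x + t *\<^sub>R a) z + s *\<^sub>R B (x + t *\<^sub>R a) w) has_vector_derivative
      r *\<^sub>R dird (\<lambda>y. B y z) x a + s *\<^sub>R dird (\<lambda>y. B y w) x a) (at 0)"
    using B[OF zw(1)] B[OF zw(2)] x a
    by (intro has_vector_derivative_add bounded_linear.has_vector_derivative[OF bounded_linear_scaleR_right]
        dird_works[of "\<lambda>y. B y z"] dird_works[of "\<lambda>y. B y w"]) auto
  then have "dird (\<lambda>y. r *\<^sub>R B y z + s *\<^sub>R B y w) x a = r *\<^sub>R dird (\<lambda>y. B y z) x a + s *\<^sub>R dird (\<lambda>y. B y w) x a"
    by (rule dird_eqI)
  moreover have "dird (\<lambda>y. B y (r *\<^sub>R z + s *\<^sub>R w)) x a = dird (\<lambda>y. r *\<^sub>R B y z + s *\<^sub>R B y w) x a"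
    by (rule dird_cong[OF ro x a]) (use lin_onD[OF l zw] in auto)
  ultimately show "dird (\<lambda>y. B y (r *\<^sub>R z + s *\<^sub>R w)) x a = r *\<^sub>R dird (\<lambda>y. B y z) x a + s *\<^sub>R dird (\<lambda>y. B y w) x a"
    by simp
qed

text \<open>The right-hand side in the definition of \<open>christoffel\<close>: the Christoffel
  symbols of the first kind, as a trilinear form.\<close>

definition koszul :: "('a, 'e::euclidean_space) riem \<Rightarrow> ('a, 'e) chart \<Rightarrow> 'e \<Rightarrow> 'e \<Rightarrow> 'e \<Rightarrow> 'e \<Rightarrow> real" where
  "koszul M c x a b z = (dird (\<lambda>y. gcomp M c y b z) x a + dird (\<lambda>y. gcomp M c y a z) x b
            - dird (\<lambda>y. gcomp M c y a b) x z) / 2"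

lemma lin_on_koszul_combine:
  "lin_on V l1 \<Longrightarrow> lin_on V l2 \<Longrightarrow> lin_on V l3 \<Longrightarrow> lin_on V (\<lambda>z. (l1 z + l2 z - l3 z) / (2::real))"
  unfolding lin_on_def by (simp add: field_simps)

context
  fixes M :: "('a, 'e::euclidean_space) riem" and c :: "('a, 'e) chart"
  assumes R: "riemannian_manifold M" and c: "c \<in> atlas M"
begin

private lemma sm: "smooth_manifold M" by (rule riemannian_manifoldD(1)[OF R])
private lemma V: "subspace (model M)" by (rule smooth_manifoldD(1)[OF sm])
private lemma ro: "relopen (model M) (snd c ` fst c)" by (rule chart_relopen[OF sm c])

lemma gcomp_Ck: "a \<in> model M \<Longrightarrow> b \<in> model M \<Longrightarrow> Ck_on k (model M) (snd c ` fst c) (\<lambda>x. gcomp M c x a b)"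
  using riemannian_manifoldD(3)[OF R c] Cinf_on_Ck by blast

lemma gcomp_dird_lin:
  assumes x: "x \<in> snd c ` fst c" and a: "a \<in> model M" and b: "b \<in> model M"
  shows "lin_on (model M) (\<lambda>z. dird (\<lambda>y. gcomp M c y b z) x a)"
    "lin_on (model M) (\<lambda>z. dird (\<lambda>y. gcomp M c y z b) x a)"
    "lin_on (model M) (dird (\<lambda>y. gcomp M c y a b) x)"
proof -
  show "lin_on (model M) (\<lambda>z. dird (\<lambda>y. gcomp M c y b z) x a)"
    by (rule lin_on_dird_param[OF ro x a V inner_on_lin2[OF gcomp_inner[OF R c] V b] gcomp_Ck[OF b]])
  show "lin_on (model M) (\<lambda>z. dird (\<lambda>y. gcomp M c y z b) x a)"
    by (rule lin_on_dird_param[OF ro x a V inner_on_lin1[OF gcomp_inner[OF R c] b] gcomp_Ck[OF _ b]])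
  show "lin_on (model M) (dird (\<lambda>y. gcomp M c y a b) x)"
    by (rule lin_on_dird[OF ro gcomp_Ck[OF a b, of "Suc 0"] x])
qed

lemma koszul_lin:
  assumes x: "x \<in> snd c ` fst c" and a: "a \<in> model M" and b: "b \<in> model M"
  shows "lin_on (model M) (koszul M c x a b)" "lin_on (model M) (\<lambda>z. koszul M c x z a b)"
  unfolding koszul_def by (intro lin_on_koszul_combine gcomp_dird_lin x a b)+

lemma koszul_sym: "x \<in> snd c ` fst c \<Longrightarrow> a \<in> model M \<Longrightarrow> b \<in> model M \<Longrightarrow> z \<in> model M \<Longrightarrow> koszul M c x a b z = koszul M c x b a z"
proof -
  assume x: "x \<in> snd c ` fst c" and ab: "a \<in> model M" "b \<in> model M" and z: "z \<in> model M"
  have "dird (\<lambda>y. gcomp M c y a b) x z = dird (\<lambda>y. gcomp M c y b a) x z"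
    by (rule dird_cong[OF ro x z]) (use inner_on_sym[OF gcomp_inner[OF R c] ab] in auto)
  then show ?thesis by (simp add: koszul_def)
qed

lemma koszul_Ck:
  assumes "a \<in> model M" "b \<in> model M" "z \<in> model M"
  shows "Ck_on k (model M) (snd c ` fst c) (\<lambda>x. koszul M c x a b z)"
proof -
  have "Ck_on k (model M) (snd c ` fst c) (\<lambda>x. dird (\<lambda>y. gcomp M c y a b) x z)" if "a \<in> model M" "b \<in> model M" "z \<in> model M" for a b z
    by (rule Ck_on_dird[OF gcomp_Ck[OF that(1,2)] that(3)])
  then have "Ck_on k (model M) (snd c ` fst c) (\<lambda>x. (1/2) * (dird (\<lambda>y. gcomp M c y b z) x a + dird (\<lambda>y. gcomp M c y a z) x b
            - dird (\<lambda>y. gcomp M c y a b) x z))"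
    using assms by (intro Ck_on_mult Ck_on_diff Ck_on_add Ck_on_const ro) auto
  then show ?thesis by (simp add: koszul_def)
qed

text \<open>The Koszul form is linear in its last argument, so the Riesz lemma provides exactly one
  vector and the definite description is determined.\<close>

lemma christoffel_props:
  assumes x: "x \<in> snd c ` fst c" and a: "a \<in> model M" and b: "b \<in> model M"
  shows "christoffel M c x a b \<in> model M"
    "\<And>z. z \<in> model M \<Longrightarrow> gcomp M c x (christoffel M c x a b) z = koszul M c x a b z"
proof -
  have "lin_on (model M) (koszul M c x a b)" by (rule koszul_lin(1)[OF x a b])
  from theI'[OF riesz[OF V gcomp_inner[OF R c x] this]]
  show "christoffel M c x a b \<in> model M"
    "\<And>z. z \<in> model M \<Longrightarrow> gcomp M c x (christoffel M c x a b) z = koszul M c x a b z"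
    unfolding christoffel_def koszul_def by blast+
qed

lemma christoffel_lin1:
  assumes x: "x \<in> snd c ` fst c" and b: "b \<in> model M"
  shows "lin_on (model M) (\<lambda>a. christoffel M c x a b)"
  unfolding lin_on_def
proof (intro ballI allI)
  fix u v r s assume uv: "u \<in> model M" "v \<in> model M"
  then have uv': "r *\<^sub>R u + s *\<^sub>R v \<in> model M" using V by (auto intro!: subspace_add subspace_scale)
  note g = gcomp_inner[OF R c x]
  let ?C = "\<lambda>a. christoffel M c x a b"
  note C = christoffel_props[OF x _ b]
  show "?C (r *\<^sub>R u + s *\<^sub>R v) = r *\<^sub>R ?C u + s *\<^sub>R ?C v"
  proof (rule inner_on_eqI[OF g V C(1)[OF uv']])
    show "r *\<^sub>R ?C u + s *\<^sub>R ?C v \<in> model M" using V C(1) uv by (auto intro!: subspace_add subspace_scale)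
    fix z assume z: "z \<in> model M"
    have "gcomp M c x (?C (r *\<^sub>R u + s *\<^sub>R v)) z = r * koszul M c x u b z + s * koszul M c x v b z"
      using C(2)[OF uv' z] lin_onD[OF koszul_lin(2)[OF x b z] uv] by simp
    also have "\<dots> = gcomp M c x (r *\<^sub>R ?C u + s *\<^sub>R ?C v) z"
      using lin_onD[OF inner_on_lin1[OF g z] C(1)[OF uv(1)] C(1)[OF uv(2)]] C(2)[OF uv(1) z] C(2)[OF uv(2) z] by simp
    finally show "gcomp M c x (?C (r *\<^sub>R u + s *\<^sub>R v)) z = gcomp M c x (r *\<^sub>R ?C u + s *\<^sub>R ?C v) z" .
  qed
qed

lemma christoffel_sym:
  assumes x: "x \<in> snd c ` fst c" and a: "a \<in> model M" and b: "b \<in> model M"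
  shows "christoffel M c x a b = christoffel M c x b a"
  by (rule inner_on_eqI[OF gcomp_inner[OF R c x] V])
    (use christoffel_props[OF x a b] christoffel_props[OF x b a] koszul_sym[OF x a b] in auto)

lemma christoffel_lin2:
  assumes x: "x \<in> snd c ` fst c" and a: "a \<in> model M"
  shows "lin_on (model M) (christoffel M c x a)"
  unfolding lin_on_def
proof (intro ballI allI)
  fix u v r s assume uv: "u \<in> model M" "v \<in> model M"
  then have uv': "r *\<^sub>R u + s *\<^sub>R v \<in> model M" using V by (auto intro!: subspace_add subspace_scale)
  show "christoffel M c x a (r *\<^sub>R u + s *\<^sub>R v) = r *\<^sub>R christoffel M c x a u + s *\<^sub>R christoffel M c x a v"
    using lin_onD[OF christoffel_lin1[OF x a] uv] christoffel_sym[OF x a] uv uv' by simp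
qed

lemma christoffel_Ck:
  assumes "a \<in> model M" "b \<in> model M"
  shows "Ck_on k (model M) (snd c ` fst c) (\<lambda>x. christoffel M c x a b)"
  by (rule Ck_on_solve[OF ro gcomp_inner[OF R c] gcomp_Ck, where l="\<lambda>x. koszul M c x a b"])
    (use koszul_lin(1)[OF _ assms] assms koszul_Ck christoffel_props in auto)

end

text \<open>The covariant Hessian in the chart \<open>c\<close>, evaluated on fields with constant
  components \<open>a\<close> and \<open>w\<close>.\<close>

definition hessian :: "('a, 'e::euclidean_space) riem \<Rightarrow> ('a, 'e) chart \<Rightarrow> ('a \<Rightarrow> real) \<Rightarrow> 'e \<Rightarrow> 'e \<Rightarrow> 'e \<Rightarrow> real" where
  "hessian M c f y a w = dird (\<lambda>y. dird (f \<circ> cinv c) y w) y a - dird (f \<circ> cinv c) y (christoffel M c y a w)"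

section \<open>Gradient, Hessian and Laplace-Beltrami operator\<close>

context
  fixes M :: "('a, 'e::euclidean_space) riem" and f :: "'a \<Rightarrow> real"
  assumes R: "riemannian_manifold M" and f: "smooth_fun M (points M) f"
begin

private lemma smM: "smooth_manifold M" by (rule riemannian_manifoldD(1)[OF R])
private lemma VM: "subspace (model M)" by (rule smooth_manifoldD(1)[OF smM])

lemma smooth_fun_Ck: "c \<in> atlas M \<Longrightarrow> Ck_on k (model M) (snd c ` fst c) (f \<circ> cinv c)"
  using f chart_subset[OF smM] unfolding smooth_fun_def Cinf_on_def by (metis inf.absorb1)

lemma dfun_chart:
  assumes c: "c \<in> atlas M" and p: "p \<in> fst c" and v: "v \<in> model M"
  shows "dfun M f p v = dird (f \<circ> cinv c) (snd c p) (comps M c p v)"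
  by (rule dfun_rep[OF smM c p p smooth_manifoldD(4)[OF smM c] _ v]) (use smooth_fun_Ck[OF c] in simp)

lemma grad_props:
  assumes p: "p \<in> points M"
  shows "grad M f p \<in> model M" "\<And>w. w \<in> model M \<Longrightarrow> metric M p (grad M f p) w = dfun M f p w"
proof -
  note ca = chart_at_props[OF smM p]
  have "lin_on (model M) (dird (f \<circ> cinv (chart_at M p)) (snd (chart_at M p) p))"
    by (rule lin_on_dird[OF chart_relopen[OF smM ca(1)] smooth_fun_Ck[OF ca(1), of "Suc 0"]]) (use ca in auto)
  then have "lin_on (model M) (dfun M f p)" by (simp add: dfun_def Let_def lin_on_def)
  from theI'[OF riesz[OF VM riemannian_manifoldD(2)[OF R p] this]]
  show "grad M f p \<in> model M" "\<And>w. w \<in> model M \<Longrightarrow> metric M p (grad M f p) w = dfun M f p w"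
    unfolding grad_def by blast+
qed

lemma grad_rep:
  assumes c: "c \<in> atlas M" and y: "y \<in> snd c ` fst c"
  shows "vrep M c (grad M f) y \<in> model M"
    "\<And>w. w \<in> model M \<Longrightarrow> gcomp M c y (vrep M c (grad M f) y) w = dird (f \<circ> cinv c) y w"
proof -
  obtain p where p: "p \<in> fst c" "y = snd c p" using y by auto
  have pM: "p \<in> points M" using chart_subset[OF smM c] p by auto
  have e: "vrep M c (grad M f) y = comps M c p (grad M f p)"
    by (simp add: vrep_def p(2) cinv_left[OF smM c p(1)])
  show "vrep M c (grad M f) y \<in> model M"
    unfolding e by (rule comps_in[OF smM c p(1) grad_props(1)[OF pM]])
  fix w assume w: "w \<in> model M"
  show "gcomp M c y (vrep M c (grad M f) y) w = dird (f \<circ> cinv c) y w"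
    using grad_props[OF pM] tvec_in[OF smM c p(1) w] dfun_chart[OF c p(1)] comps_tvec[OF smM c p(1) w]
    unfolding e unfolding p(2) gcomp_at[OF smM c p(1)] tvec_comps[OF smM c p(1) grad_props(1)[OF pM]] by simp
qed

lemma grad_rep_Ck:
  assumes c: "c \<in> atlas M"
  shows "Ck_on k (model M) (snd c ` fst c) (vrep M c (grad M f))"
  by (rule Ck_on_solve[OF chart_relopen[OF smM c] gcomp_inner[OF R c] gcomp_Ck[OF R c], where l="\<lambda>y. dird (f \<circ> cinv c) y"])
    (use lin_on_dird[OF chart_relopen[OF smM c] smooth_fun_Ck[OF c, of "Suc 0"]] Ck_on_dird[OF smooth_fun_Ck[OF c]] grad_rep[OF c] in auto)

lemma hessian_lin:
  assumes c: "c \<in> atlas M" and y: "y \<in> snd c ` fst c" and w: "w \<in> model M"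
  shows "lin_on (model M) (\<lambda>a. hessian M c f y a w)" "lin_on (model M) (hessian M c f y w)"
proof -
  note ro = chart_relopen[OF smM c]
  have d: "lin_on (model M) (dird (f \<circ> cinv c) y)" if "y \<in> snd c ` fst c" for y
    by (rule lin_on_dird[OF ro smooth_fun_Ck[OF c, of "Suc 0"] that])
  have comp: "lin_on (model M) (\<lambda>a. dird (f \<circ> cinv c) y (l a))"
    if "lin_on (model M) l" "\<And>a. a \<in> model M \<Longrightarrow> l a \<in> model M" for l
    using that lin_onD[OF d[OF y]] by (simp add: lin_on_def)
  have diff: "lin_on (model M) (\<lambda>a. l1 a - l2 a)" if "lin_on (model M) l1" "lin_on (model M) l2" for l1 l2 :: "'e \<Rightarrow> real"
    using that unfolding lin_on_def by (simp add: algebra_simps)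
  show "lin_on (model M) (\<lambda>a. hessian M c f y a w)"
    unfolding hessian_def
    by (intro diff comp lin_on_dird[OF ro Ck_on_dird[OF smooth_fun_Ck[OF c, of "Suc (Suc 0)"] w] y]
        christoffel_lin1[OF R c y w] christoffel_props(1)[OF R c y _ w])
  show "lin_on (model M) (hessian M c f y w)"
    unfolding hessian_def
    by (intro diff comp lin_on_dird_param[OF ro y w VM d Ck_on_dird[OF smooth_fun_Ck[OF c, of "Suc (Suc 0)"]]]
        christoffel_lin2[OF R c y w] christoffel_props(1)[OF R c y w])
qed

text \<open>Compatibility of the connection with the metric, in coordinates: differentiating
  \<open>G(grad f, w) = df(w)\<close> for constant \<open>w\<close> produces the derivative of
  \<open>G\<close>, which is the sum of two Christoffel terms. One completes the covariant
  derivative of the gradient, the other completes the Hessian.\<close>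

lemma cov_grad:
  assumes p: "p \<in> points M" and a: "a \<in> model M" and w: "w \<in> model M"
  defines "c \<equiv> chart_at M p"
  shows "metric M p (cov M a (grad M f) p) w = hessian M c f (snd c p) a w"
proof -
  have c: "c \<in> atlas M" and pc: "p \<in> fst c" using chart_at_props[OF smM p] by (auto simp: c_def)
  let ?y = "snd c p" and ?U = "snd c ` fst c"
  note ro = chart_relopen[OF smM c]
  have y: "?y \<in> ?U" using pc by auto
  define Z where "Z = vrep M c (grad M f)"
  note ZV = grad_rep(1)[OF c, folded Z_def] and Zeq = grad_rep(2)[OF c, folded Z_def]
  have ZC: "Ck_on (Suc k) (model M) ?U Z" for k unfolding Z_def by (rule grad_rep_Ck[OF c])
  note g = gcomp_inner[OF R c y] and gl = inner_on_lin1[OF gcomp_inner[OF R c]]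
  have dZ: "dird Z ?y a \<in> model M"
    by (rule dird_in_subspace[OF ro _ y a VM]) (use ZC[of 0] y a ZV in auto)
  have Zy: "Z ?y = grad M f p"
    unfolding Z_def vrep_def cinv_left[OF smM c pc]
    using comps_chart_at[OF smM p grad_props(1)[OF p]] by (simp add: c_def)
  have Zp: "Z ?y \<in> model M" by (rule ZV[OF y])
  have cov: "cov M a (grad M f) p = dird Z ?y a + christoffel M c ?y a (Z ?y)"
    by (simp add: cov_def Let_def Z_def[symmetric] c_def[symmetric] Zy)
  note C = christoffel_props[OF R c y]
  have Caw: "christoffel M c ?y a w \<in> model M" and Caz: "christoffel M c ?y a (Z ?y) \<in> model M"
    using C a w Zp by auto
  \<comment> \<open>differentiate \<open>G(Z, w) = df(w)\<close> in the direction \<open>a\<close>\<close>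
  let ?D = "dird (\<lambda>y. gcomp M c y (Z ?y) w) ?y a"
  have "dird (\<lambda>y. dird (f \<circ> cinv c) y w) ?y a = dird (\<lambda>y. gcomp M c y (Z y) w) ?y a"
    by (rule dird_cong[OF ro y a]) (use Zeq w in auto)
  also have "\<dots> = ?D + gcomp M c ?y (dird Z ?y a) w"
  proof (rule dird_eqI)
    have exp: "gcomp M c y z w = (\<Sum>b\<in>onb (model M). (z \<bullet> b) *\<^sub>R gcomp M c y b w)" if "y \<in> ?U" "z \<in> model M" for y z
      using lin_on_expand[OF VM gl[OF that(1) w] that(2)] by simp
    have bm: "b \<in> model M" if "b \<in> onb (model M)" for b using onb_props(1)[OF VM] that by auto
    have "((\<lambda>t. \<Sum>b\<in>onb (model M). (Z (?y + t *\<^sub>R a) \<bullet> b) *\<^sub>R gcomp M c (?y + t *\<^sub>R a) b w) has_vector_derivative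
       (\<Sum>b\<in>onb (model M). (Z (?y + 0 *\<^sub>R a) \<bullet> b) *\<^sub>R dird (\<lambda>y. gcomp M c y b w) ?y a
          + (dird Z ?y a \<bullet> b) *\<^sub>R gcomp M c (?y + 0 *\<^sub>R a) b w)) (at 0)"
    proof (intro has_vector_derivative_sum bounded_bilinear.has_vector_derivative[OF bounded_bilinear_scaleR])
      fix b assume "b \<in> onb (model M)"
      then have b: "b \<in> model M" by (rule bm)
      show "((\<lambda>t. Z (?y + t *\<^sub>R a) \<bullet> b) has_vector_derivative dird Z ?y a \<bullet> b) (at 0)"
        using ZC[of 0] y a by (intro bounded_linear.has_vector_derivative[OF bounded_linear_inner_left] dird_works) auto
      show "((\<lambda>t. gcomp M c (?y + t *\<^sub>R a) b w) has_vector_derivative dird (\<lambda>y. gcomp M c y b w) ?y a) (at 0)"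
        using gcomp_Ck[OF R c b w, of "Suc 0"] y a by (intro dird_works[of "\<lambda>y. gcomp M c y b w"]) auto
    qed
    moreover have "(\<Sum>b\<in>onb (model M). (Z (?y + 0 *\<^sub>R a) \<bullet> b) *\<^sub>R dird (\<lambda>y. gcomp M c y b w) ?y a
          + (dird Z ?y a \<bullet> b) *\<^sub>R gcomp M c (?y + 0 *\<^sub>R a) b w) = ?D + gcomp M c ?y (dird Z ?y a) w"
      using exp[OF y dZ] lin_on_expand[OF VM gcomp_dird_lin(2)[OF R c y a w] Zp] by (simp add: sum.distrib)
    ultimately have "((\<lambda>t. \<Sum>b\<in>onb (model M). (Z (?y + t *\<^sub>R a) \<bullet> b) *\<^sub>R gcomp M c (?y + t *\<^sub>R a) b w) has_vector_derivative
       ?D + gcomp M c ?y (dird Z ?y a) w) (at 0)" by simp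
    moreover have "\<forall>\<^sub>F t in nhds 0. t \<in> UNIV \<longrightarrow> gcomp M c (?y + t *\<^sub>R a) (Z (?y + t *\<^sub>R a)) w =
        (\<Sum>b\<in>onb (model M). (Z (?y + t *\<^sub>R a) \<bullet> b) *\<^sub>R gcomp M c (?y + t *\<^sub>R a) b w)"
      using relopen_eventually_line[OF ro y a] by (rule eventually_mono) (use exp ZV in auto)
    ultimately show "((\<lambda>t. gcomp M c (?y + t *\<^sub>R a) (Z (?y + t *\<^sub>R a)) w) has_vector_derivative
       ?D + gcomp M c ?y (dird Z ?y a) w) (at 0)"
      by (subst has_vector_derivative_cong_ev) (use exp[OF y Zp] in auto)
  qed
  finally have 1: "gcomp M c ?y (dird Z ?y a) w = dird (\<lambda>y. dird (f \<circ> cinv c) y w) ?y a - ?D" by simp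
  have sw: "dird (\<lambda>y. gcomp M c y w (Z ?y)) ?y a = ?D" "dird (\<lambda>y. gcomp M c y a (Z ?y)) ?y w = dird (\<lambda>y. gcomp M c y (Z ?y) a) ?y w"
    "dird (\<lambda>y. gcomp M c y w a) ?y (Z ?y) = dird (\<lambda>y. gcomp M c y a w) ?y (Z ?y)"
    using inner_on_sym[OF gcomp_inner[OF R c]] a w Zp by (auto intro!: dird_cong[OF ro y])
  \<comment> \<open>Adding the two Koszul expressions cancels all derivatives of the metric except
    the one in direction \<open>a\<close>.\<close>
  have 2: "gcomp M c ?y (christoffel M c ?y a (Z ?y)) w = ?D - gcomp M c ?y (christoffel M c ?y a w) (Z ?y)"
    using C(2)[OF a Zp w] C(2)[OF a w Zp] sw by (simp add: koszul_def field_simps)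
  have 3: "gcomp M c ?y (christoffel M c ?y a w) (Z ?y) = dird (f \<circ> cinv c) ?y (christoffel M c ?y a w)"
    using inner_on_sym[OF g Caw Zp] Zeq[OF y Caw] by simp
  have "cov M a (grad M f) p \<in> model M" unfolding cov using dZ Caz VM by (simp add: subspace_add)
  then have "metric M p (cov M a (grad M f) p) w = gcomp M c ?y (cov M a (grad M f) p) w"
    using gcomp_chart_at[OF smM p _ w] by (simp add: c_def)
  also have "\<dots> = gcomp M c ?y (dird Z ?y a) w + gcomp M c ?y (christoffel M c ?y a (Z ?y)) w"
    unfolding cov by (rule lin_on_add[OF inner_on_lin1[OF g w] dZ Caz])
  finally show ?thesis using 1 2 3 by (simp add: hessian_def)
qed

text \<open>The divergence is the number that all orthonormal bases agree on. Independence of the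
  trace shows that they agree, and the image of \<open>Y\<close> is a basis that fixes the
  number.\<close>

lemma laplace_beltrami_eq:
  assumes p: "p \<in> points M" and I: "finite I" and Y: "\<And>i. i \<in> I \<Longrightarrow> Y i \<in> model M"
    and on: "onfam (metric M p) I Y" and card: "card I = mdim M"
  defines "c \<equiv> chart_at M p"
  shows "laplace_beltrami M f p = (\<Sum>i\<in>I. hessian M c f (snd c p) (Y i) (Y i))"
proof -
  have c: "c \<in> atlas M" and y: "snd c p \<in> snd c ` fst c" using chart_at_props[OF smM p] by (auto simp: c_def)
  note g = riemannian_manifoldD(2)[OF R p]
  have card': "card I = dim (model M)" using card by (simp add: mdim_def)
  have all: "(\<Sum>e\<in>B. metric M p (cov M e (grad M f) p) e) = (\<Sum>i\<in>I. hessian M c f (snd c p) (Y i) (Y i))"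
    if B: "orthonormal_basis M p B" for B
  proof -
    have B': "finite B" "B \<subseteq> model M" "card B = dim (model M)" "onfam (metric M p) B (\<lambda>e. e)"
      using B by (auto simp: orthonormal_basis_def mdim_def onfam_def)
    have "(\<Sum>e\<in>B. metric M p (cov M e (grad M f) p) e) = (\<Sum>e\<in>B. hessian M c f (snd c p) e e)"
      using cov_grad[OF p] B' by (intro sum.cong) (auto simp: c_def)
    also have "\<dots> = (\<Sum>i\<in>I. hessian M c f (snd c p) (Y i) (Y i))"
      by (rule trace_independent[OF g VM B'(1) _ B'(4,3) I Y on card' hessian_lin[OF c y]]) (use B' in auto)
    finally show ?thesis .
  qed
  have inj: "inj_on Y I" by (rule onfam_inj_independent(1)[OF g VM I _ on]) (use Y in auto)
  have ob: "orthonormal_basis M p (Y ` I)"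
    using I Y card on inj by (auto simp: orthonormal_basis_def card_image onfam_def dest: inj_onD)
  show ?thesis
    unfolding laplace_beltrami_def divergence_def
  proof (rule the_equality)
    show "\<forall>B. orthonormal_basis M p B \<longrightarrow> (\<Sum>i\<in>I. hessian M c f (snd c p) (Y i) (Y i)) =
        (\<Sum>e\<in>B. metric M p (cov M e (grad M f) p) e)"
      using all by simp
    fix r assume "\<forall>B. orthonormal_basis M p B \<longrightarrow> r = (\<Sum>e\<in>B. metric M p (cov M e (grad M f) p) e)"
    then have "r = (\<Sum>e\<in>Y ` I. metric M p (cov M e (grad M f) p) e)" using ob by blast
    then show "r = (\<Sum>i\<in>I. hessian M c f (snd c p) (Y i) (Y i))" using all[OF ob] by simp
  qed
qed

end

section \<open>Riemannian submersions in coordinates\<close>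

text \<open>A product rule in which both the linear map and its argument move. Since
  \<open>l (y s)\<close> is linear on \<open>S\<close> only, the rule is applied to its values on a
  fixed basis of \<open>S\<close>.\<close>

lemma lin_curve:
  fixes l :: "'e::euclidean_space \<Rightarrow> 'x::euclidean_space \<Rightarrow> 'w::real_normed_vector"
  assumes ro: "relopen V U" and S: "subspace S"
    and l: "\<And>y. y \<in> U \<Longrightarrow> lin_on S (l y)" and lC: "\<And>v. v \<in> S \<Longrightarrow> Ck_on (Suc k) V U (\<lambda>y. l y v)"
    and y: "(y has_vector_derivative y') (at t)" "y t \<in> U" "y' \<in> V" "\<forall>\<^sub>F s in nhds t. y s \<in> U"
    and A: "(A has_vector_derivative A') (at t)" "A t \<in> S" "A' \<in> S" "\<forall>\<^sub>F s in nhds t. A s \<in> S"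
  shows "((\<lambda>s. l (y s) (A s)) has_vector_derivative dird (\<lambda>z. l z (A t)) (y t) y' + l (y t) A') (at t)"
proof -
  have bS: "b \<in> S" if "b \<in> onb S" for b using onb_props(1)[OF S] that by auto
  have yV: "\<forall>\<^sub>F s in nhds t. s \<in> UNIV \<longrightarrow> y s \<in> V"
    using y(4) by (rule eventually_mono) (use relopen_subset[OF ro] in auto)
  have "((\<lambda>s. \<Sum>b\<in>onb S. (A s \<bullet> b) *\<^sub>R l (y s) b) has_vector_derivative
      (\<Sum>b\<in>onb S. (A t \<bullet> b) *\<^sub>R dird (\<lambda>z. l z b) (y t) y' + (A' \<bullet> b) *\<^sub>R l (y t) b)) (at t)"
  proof (intro has_vector_derivative_sum bounded_bilinear.has_vector_derivative[OF bounded_bilinear_scaleR])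
    fix b assume "b \<in> onb S"
    then have b: "b \<in> S" by (rule bS)
    show "((\<lambda>s. A s \<bullet> b) has_vector_derivative A' \<bullet> b) (at t)"
      by (rule bounded_linear.has_vector_derivative[OF bounded_linear_inner_left A(1)])
    show "((\<lambda>s. l (y s) b) has_vector_derivative dird (\<lambda>z. l z b) (y t) y') (at t)"
      by (rule curve_chain[OF ro lC[OF b] y(1,2,3) yV])
  qed
  moreover have "(\<Sum>b\<in>onb S. (A t \<bullet> b) *\<^sub>R dird (\<lambda>z. l z b) (y t) y' + (A' \<bullet> b) *\<^sub>R l (y t) b)
      = dird (\<lambda>z. l z (A t)) (y t) y' + l (y t) A'"
    using lin_on_expand[OF S l[OF y(2)] A(3)] lin_on_expand[OF S lin_on_dird_param[OF ro y(2,3) S l lC] A(2)]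
    by (simp add: sum.distrib)
  ultimately have "((\<lambda>s. \<Sum>b\<in>onb S. (A s \<bullet> b) *\<^sub>R l (y s) b) has_vector_derivative
      dird (\<lambda>z. l z (A t)) (y t) y' + l (y t) A') (at t)" by simp
  moreover have "\<forall>\<^sub>F s in nhds t. s \<in> UNIV \<longrightarrow> l (y s) (A s) = (\<Sum>b\<in>onb S. (A s \<bullet> b) *\<^sub>R l (y s) b)"
    using y(4) A(4) by eventually_elim (use lin_on_expand[OF S l] in auto)
  moreover have "l (y t) (A t) = (\<Sum>b\<in>onb S. (A t \<bullet> b) *\<^sub>R l (y t) b)"
    by (rule lin_on_expand[OF S l[OF y(2)] A(2)])
  ultimately show ?thesis
    by (subst has_vector_derivative_cong_ev[where g="\<lambda>s. \<Sum>b\<in>onb S. (A s \<bullet> b) *\<^sub>R l (y s) b"]) auto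
qed

lemma bilin_curve:
  fixes b :: "'e::euclidean_space \<Rightarrow> 'e \<Rightarrow> 'e \<Rightarrow> 'w::real_normed_vector"
  assumes ro: "relopen V U"
    and l1: "\<And>y w. y \<in> U \<Longrightarrow> w \<in> V \<Longrightarrow> lin_on V (\<lambda>v. b y v w)" and l2: "\<And>y v. y \<in> U \<Longrightarrow> v \<in> V \<Longrightarrow> lin_on V (b y v)"
    and bC: "\<And>v w. v \<in> V \<Longrightarrow> w \<in> V \<Longrightarrow> Ck_on (Suc k) V U (\<lambda>y. b y v w)"
    and y: "(y has_vector_derivative y') (at t)" "y t \<in> U" "y' \<in> V" "\<forall>\<^sub>F s in nhds t. y s \<in> U"
    and A: "(A has_vector_derivative A') (at t)" "A t \<in> V" "A' \<in> V" "\<forall>\<^sub>F s in nhds t. A s \<in> V"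
    and B: "(B has_vector_derivative B') (at t)" "B t \<in> V" "B' \<in> V" "\<forall>\<^sub>F s in nhds t. B s \<in> V"
  shows "((\<lambda>s. b (y s) (A s) (B s)) has_vector_derivative
    dird (\<lambda>z. b z (A t) (B t)) (y t) y' + b (y t) A' (B t) + b (y t) (A t) B') (at t)"
proof -
  have V: "subspace V" using ro by simp
  have cV: "c \<in> V" if "c \<in> onb V" for c using onb_props(1)[OF V] that by auto
  note lc = lin_curve[OF ro V l1 bC y A]
  have "((\<lambda>s. \<Sum>c\<in>onb V. (B s \<bullet> c) *\<^sub>R b (y s) (A s) c) has_vector_derivative
      (\<Sum>c\<in>onb V. (B t \<bullet> c) *\<^sub>R (dird (\<lambda>z. b z (A t) c) (y t) y' + b (y t) A' c) + (B' \<bullet> c) *\<^sub>R b (y t) (A t) c)) (at t)"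
    by (intro has_vector_derivative_sum bounded_bilinear.has_vector_derivative[OF bounded_bilinear_scaleR]
        bounded_linear.has_vector_derivative[OF bounded_linear_inner_left B(1)] lc) (auto intro: cV)
  moreover have "(\<Sum>c\<in>onb V. (B t \<bullet> c) *\<^sub>R (dird (\<lambda>z. b z (A t) c) (y t) y' + b (y t) A' c) + (B' \<bullet> c) *\<^sub>R b (y t) (A t) c)
      = dird (\<lambda>z. b z (A t) (B t)) (y t) y' + b (y t) A' (B t) + b (y t) (A t) B'"
    using lin_on_expand[OF V l2[OF y(2) A(2)] B(3)] lin_on_expand[OF V l2[OF y(2) A(3)] B(2)]
      lin_on_expand[OF V lin_on_dird_param[OF ro y(2,3) V l2[OF _ A(2)] bC[OF A(2)]] B(2)]
    by (simp add: sum.distrib scaleR_add_right)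
  ultimately have "((\<lambda>s. \<Sum>c\<in>onb V. (B s \<bullet> c) *\<^sub>R b (y s) (A s) c) has_vector_derivative
      dird (\<lambda>z. b z (A t) (B t)) (y t) y' + b (y t) A' (B t) + b (y t) (A t) B') (at t)" by simp
  moreover have "\<forall>\<^sub>F s in nhds t. s \<in> UNIV \<longrightarrow> b (y s) (A s) (B s) = (\<Sum>c\<in>onb V. (B s \<bullet> c) *\<^sub>R b (y s) (A s) c)"
    using y(4) A(4) B(4) by eventually_elim (use lin_on_expand[OF V l2] in auto)
  moreover have "b (y t) (A t) (B t) = (\<Sum>c\<in>onb V. (B t \<bullet> c) *\<^sub>R b (y t) (A t) c)"
    by (rule lin_on_expand[OF V l2[OF y(2) A(2)] B(2)])
  ultimately show ?thesis
    by (subst has_vector_derivative_cong_ev[where g="\<lambda>s. \<Sum>c\<in>onb V. (B s \<bullet> c) *\<^sub>R b (y s) (A s) c"]) auto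
qed

text \<open>The point \<open>u\<close> is a locale parameter so that the same facts can be
  instantiated at other points of its fiber.\<close>

locale submersion_at =
  fixes M :: "('a, 'e::euclidean_space) riem" and N :: "('b, 'f::euclidean_space) riem"
    and \<pi> :: "'b \<Rightarrow> 'a" and u :: 'b
  assumes RM: "riemannian_manifold M" and RN: "riemannian_manifold N"
    and sub: "riemannian_submersion N M \<pi>" and u: "u \<in> points N"
begin

definition "cN = chart_at N u"
definition "cM = chart_at M (\<pi> u)"
definition "phi = snd cM \<circ> \<pi> \<circ> cinv cN"
definition "Om = snd cN ` (fst cN \<inter> \<pi> -` fst cM)"
definition "x0 = snd cN u"
definition "y0 = snd cM (\<pi> u)"

abbreviation "D x \<equiv> dird phi x"
abbreviation "D2 a b \<equiv> dird (\<lambda>x. dird phi x a) x0 b"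

lemma smM: "smooth_manifold M" and smN: "smooth_manifold N"
  using RM RN riemannian_manifoldD(1) by auto

lemma VM: "subspace (model M)" and VN: "subspace (model N)"
  using smM smN smooth_manifoldD(1) by auto

lemma smooth_pi: "smooth_map N M \<pi>"
  using sub by (simp add: riemannian_submersion_def)

lemma pi_points: "q \<in> points N \<Longrightarrow> \<pi> q \<in> points M"
  using sub by (auto simp: riemannian_submersion_def)

lemma dmap_bij: "q \<in> points N \<Longrightarrow> bij_betw (dmap N M \<pi> q) (horizontal N M \<pi> q) (model M)"
  using sub by (simp add: riemannian_submersion_def)

lemma dmap_isometry: "q \<in> points N \<Longrightarrow> v \<in> horizontal N M \<pi> q \<Longrightarrow> w \<in> horizontal N M \<pi> q \<Longrightarrow>
  metric M (\<pi> q) (dmap N M \<pi> q v) (dmap N M \<pi> q w) = metric N q v w"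
  using sub by (simp add: riemannian_submersion_def)

lemma cN: "cN \<in> atlas N" "u \<in> fst cN" and cM: "cM \<in> atlas M" "\<pi> u \<in> fst cM"
  using chart_at_props[OF smN u] chart_at_props[OF smM pi_points[OF u]] by (auto simp: cN_def cM_def)

lemma Om_relopen: "relopen (model N) Om"
  unfolding Om_def by (rule smooth_map_relopen(2)[OF smN smM smooth_pi cN(1) cM(1)])

lemma Om_subset: "Om \<subseteq> snd cN ` fst cN"
  by (auto simp: Om_def)

lemma x0: "x0 \<in> Om" "x0 \<in> snd cN ` fst cN"
  using cN cM by (auto simp: x0_def Om_def)

lemma phi_Ck: "Ck_on k (model N) Om phi"
  unfolding Om_def phi_def by (rule smooth_map_Ck[OF smooth_pi cN(1) cM(1)])

lemma phi_snd: "q \<in> fst cN \<Longrightarrow> phi (snd cN q) = snd cM (\<pi> q)"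
  by (simp add: phi_def cinv_left[OF smN cN(1)])

lemma phi_in: "x \<in> Om \<Longrightarrow> phi x \<in> snd cM ` fst cM"
  by (auto simp: Om_def phi_snd)

lemma phi_x0: "phi x0 = y0"
  by (simp add: x0_def y0_def phi_snd cN)

lemma y0: "y0 \<in> snd cM ` fst cM"
  using phi_in[OF x0(1)] phi_x0 by simp

lemma roM: "relopen (model M) (snd cM ` fst cM)"
  by (rule chart_relopen[OF smM cM(1)])

lemma D_lin: "x \<in> Om \<Longrightarrow> lin_on (model N) (D x)"
  by (rule lin_on_dird[OF Om_relopen phi_Ck[of "Suc 0"]])

lemma D_in: "x \<in> Om \<Longrightarrow> v \<in> model N \<Longrightarrow> D x v \<in> model M"
  unfolding phi_def Om_def by (rule rep_in_model[OF smN smM smooth_pi cN(1) cM(1)])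

lemma D2_in: "a \<in> model N \<Longrightarrow> b \<in> model N \<Longrightarrow> D2 a b \<in> model M"
  by (rule dird_in_subspace[OF Om_relopen _ x0(1) _ VM])
    (use Ck_on_differentiable[OF Ck_on_dird[OF phi_Ck[of "Suc (Suc 0)"]] _ x0(1)] D_in in auto)

lemma dmap_eq:
  assumes "q \<in> fst cN" "\<pi> q \<in> fst cM" "v \<in> model N"
  shows "dmap N M \<pi> q v = tvec M cM (\<pi> q) (D (snd cN q) (comps N cN q v))"
  unfolding phi_def by (rule dmap_rep[OF smN smM smooth_pi cN(1) cM(1) assms])

lemma dmap_u: "v \<in> model N \<Longrightarrow> dmap N M \<pi> u v = D x0 v"
  by (simp add: dmap_def Let_def x0_def phi_def cN_def cM_def)

lemma dmap_lin:
  assumes q: "q \<in> points N" shows "lin_on (model N) (dmap N M \<pi> q)" "v \<in> model N \<Longrightarrow> dmap N M \<pi> q v \<in> model M"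
proof -
  note a = chart_at_props[OF smN q] and b = chart_at_props[OF smM pi_points[OF q]]
  let ?U = "snd (chart_at N q) ` (fst (chart_at N q) \<inter> \<pi> -` fst (chart_at M (\<pi> q)))"
  have x: "snd (chart_at N q) q \<in> ?U" using a b by auto
  show "lin_on (model N) (dmap N M \<pi> q)"
    using lin_on_dird[OF smooth_map_relopen(2)[OF smN smM smooth_pi a(1) b(1)] smooth_map_Ck[OF smooth_pi a(1) b(1), of "Suc 0"] x]
    by (simp add: dmap_def Let_def lin_on_def)
  show "v \<in> model N \<Longrightarrow> dmap N M \<pi> q v \<in> model M"
    using rep_in_model[OF smN smM smooth_pi a(1) b(1) x] by (simp add: dmap_def Let_def)
qed

text \<open>For horizontal \<open>h\<close>, the difference \<open>v - h\<close> is vertical exactly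
  when \<open>h\<close> and \<open>v\<close> have the same image under the differential. The
  horizontal part is thus the unique horizontal preimage of that image.\<close>

lemma hdecomp:
  assumes q: "q \<in> points N" and v: "v \<in> model N"
  shows "\<exists>!h. h \<in> horizontal N M \<pi> q \<and> v - h \<in> vertical N M \<pi> q"
proof -
  have *: "v - h \<in> vertical N M \<pi> q \<longleftrightarrow> dmap N M \<pi> q h = dmap N M \<pi> q v" if "h \<in> horizontal N M \<pi> q" for h
    using that lin_on_diff[OF dmap_lin(1)[OF q] v] subspace_diff[OF VN v]
    by (auto simp: vertical_def horizontal_def)
  have "\<exists>!h. h \<in> horizontal N M \<pi> q \<and> dmap N M \<pi> q h = dmap N M \<pi> q v"
    using bij_betw_iff_bijections[THEN iffD1, OF dmap_bij[OF q]] dmap_lin(2)[OF q v]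
    by (metis (no_types, lifting))
  then show ?thesis using * by (simp cong: conj_cong)
qed

lemma hpart_props:
  assumes q: "q \<in> points N" and v: "v \<in> model N"
  shows "hpart N M \<pi> q v \<in> horizontal N M \<pi> q" "v - hpart N M \<pi> q v \<in> vertical N M \<pi> q"
  using theI'[OF hdecomp[OF q v]] unfolding hpart_def by auto

lemma horizontal_in: "v \<in> horizontal N M \<pi> q \<Longrightarrow> v \<in> model N"
  and vertical_in: "v \<in> vertical N M \<pi> q \<Longrightarrow> v \<in> model N"
  by (auto simp: horizontal_def vertical_def)

lemma dmap_hpart:
  assumes q: "q \<in> points N" and v: "v \<in> model N"
  shows "dmap N M \<pi> q (hpart N M \<pi> q v) = dmap N M \<pi> q v"
  using hpart_props(2)[OF q v] lin_on_diff[OF dmap_lin(1)[OF q] v horizontal_in[OF hpart_props(1)[OF q v]]]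
  by (simp add: vertical_def)

text \<open>The vertical part of \<open>v\<close> is orthogonal to \<open>h\<close>. In this form
  arbitrary vectors, Christoffel terms in particular, can be tested against horizontal ones.\<close>

lemma metric_horizontal:
  assumes q: "q \<in> points N" and h: "h \<in> horizontal N M \<pi> q" and v: "v \<in> model N"
  shows "metric N q v h = metric M (\<pi> q) (dmap N M \<pi> q v) (dmap N M \<pi> q h)"
proof -
  note g = riemannian_manifoldD(2)[OF RN q]
  let ?k = "hpart N M \<pi> q v"
  note k = hpart_props[OF q v]
  have hm: "h \<in> model N" and km: "?k \<in> model N" using h k horizontal_in by auto
  have "metric N q (v - ?k) h = 0"
    using h k(2) inner_on_sym[OF g hm] by (auto simp: horizontal_def vertical_def)
  then have "metric N q v h = metric N q ?k h"
    using lin_on_diff[OF inner_on_lin1[OF g hm] v km] by simp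
  then show ?thesis using dmap_isometry[OF q k(1) h] dmap_hpart[OF q v] by simp
qed

text \<open>Pythagoras: the horizontal part of \<open>v\<close> has the same image as
  \<open>v\<close> and is mapped isometrically, while the vertical part adds a nonnegative
  square.\<close>

lemma metric_dmap_le:
  assumes q: "q \<in> points N" and v: "v \<in> model N"
  shows "metric M (\<pi> q) (dmap N M \<pi> q v) (dmap N M \<pi> q v) \<le> metric N q v v"
proof -
  note g = riemannian_manifoldD(2)[OF RN q]
  let ?k = "hpart N M \<pi> q v"
  note k = hpart_props[OF q v]
  have km: "?k \<in> model N" and w: "v - ?k \<in> model N" using k horizontal_in vertical_in by auto
  have 0: "metric N q ?k (v - ?k) = 0" using k by (auto simp: horizontal_def)
  have "metric N q v v = metric N q (?k + (v - ?k)) (?k + (v - ?k))" by simp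
  also have "\<dots> = metric N q ?k ?k + metric N q (v - ?k) (v - ?k)"
    using lin_on_add[OF inner_on_lin1[OF g] km w, of "?k + (v - ?k)"] v
      lin_on_add[OF inner_on_lin2[OF g VN km] km w] lin_on_add[OF inner_on_lin2[OF g VN w] km w]
      0 inner_on_sym[OF g km w] by simp
  also have "\<dots> \<ge> metric N q ?k ?k"
    using inner_on_pos[OF g w] lin_on_zero[OF inner_on_lin1[OF g subspace_0[OF VN]] VN] by (cases "v - ?k = 0") auto
  finally show ?thesis using dmap_isometry[OF q k(1) k(1)] dmap_hpart[OF q v] by simp
qed

section \<open>The second fundamental form on horizontal vectors\<close>

abbreviation "G \<equiv> gcomp N cN"
abbreviation "G' \<equiv> gcomp M cM"
abbreviation "\<Gamma> \<equiv> christoffel N cN x0"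
abbreviation "\<Gamma>' \<equiv> christoffel M cM y0"

text \<open>The inequality concerns one constant coefficient vector at all points of
  \<open>Om\<close>, although the horizontal spaces vary from point to point. It can therefore be
  differentiated at \<open>x0\<close> without extending a horizontal vector to a horizontal
  field.\<close>

lemma pulled_back_metric_le:
  assumes x: "x \<in> Om" and a: "a \<in> model N"
  shows "G' (phi x) (D x a) (D x a) \<le> G x a a"
proof -
  obtain q where q: "q \<in> fst cN" "\<pi> q \<in> fst cM" "x = snd cN q" using x by (auto simp: Om_def)
  have qN: "q \<in> points N" using chart_subset[OF smN cN(1)] q by auto
  let ?a = "tvec N cN q a"
  have ta: "?a \<in> model N" by (rule tvec_in[OF smN cN(1) q(1) a])
  have "dmap N M \<pi> q ?a = tvec M cM (\<pi> q) (D x a)"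
    using dmap_eq[OF q(1,2) ta] comps_tvec[OF smN cN(1) q(1) a] q(3) by simp
  then show ?thesis
    using metric_dmap_le[OF qN ta] gcomp_at[OF smN cN(1) q(1)] gcomp_at[OF smM cM(1) q(2)] phi_snd[OF q(1)] q(3) by simp
qed

lemma G_x0: "a \<in> model N \<Longrightarrow> b \<in> model N \<Longrightarrow> G x0 a b = metric N u a b"
  using gcomp_chart_at[OF smN u] by (simp add: x0_def cN_def)

lemma G'_y0: "a \<in> model M \<Longrightarrow> b \<in> model M \<Longrightarrow> G' y0 a b = metric M (\<pi> u) a b"
  using gcomp_chart_at[OF smM pi_points[OF u]] by (simp add: y0_def cM_def)

lemma G_horizontal:
  assumes "e \<in> horizontal N M \<pi> u" "v \<in> model N"
  shows "G x0 v e = G' y0 (D x0 v) (D x0 e)"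
  using metric_horizontal[OF u assms] horizontal_in[OF assms(1)] assms(2)
  by (simp add: G_x0 G'_y0 D_in[OF x0(1)] dmap_u)

lemma pulled_back_metric_derivative:
  assumes a: "a \<in> model N" and b: "b \<in> model N" and v: "v \<in> model N"
  shows "((\<lambda>t. G' (phi (x0 + t *\<^sub>R v)) (D (x0 + t *\<^sub>R v) a) (D (x0 + t *\<^sub>R v) b)) has_vector_derivative
     dird (\<lambda>y. G' y (D x0 a) (D x0 b)) y0 (D x0 v) + G' y0 (D2 a v) (D x0 b) + G' y0 (D x0 a) (D2 b v)) (at 0)"
proof -
  note ev = relopen_eventually_line[OF Om_relopen x0(1) v]
  have d1: "((\<lambda>t. phi (x0 + t *\<^sub>R v)) has_vector_derivative D x0 v) (at 0)"
    by (rule dird_works[OF Ck_on_differentiable[OF phi_Ck v x0(1)]])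
  have d2: "((\<lambda>t. D (x0 + t *\<^sub>R v) a) has_vector_derivative D2 a v) (at 0)" if "a \<in> model N" for a
    by (rule dird_works[OF Ck_on_differentiable[OF Ck_on_dird[OF phi_Ck that] v x0(1)]])
  have "((\<lambda>t. G' (phi (x0 + t *\<^sub>R v)) (D (x0 + t *\<^sub>R v) a) (D (x0 + t *\<^sub>R v) b)) has_vector_derivative
     dird (\<lambda>y. G' y (D (x0 + 0 *\<^sub>R v) a) (D (x0 + 0 *\<^sub>R v) b)) (phi (x0 + 0 *\<^sub>R v)) (D x0 v)
     + G' (phi (x0 + 0 *\<^sub>R v)) (D2 a v) (D (x0 + 0 *\<^sub>R v) b) + G' (phi (x0 + 0 *\<^sub>R v)) (D (x0 + 0 *\<^sub>R v) a) (D2 b v)) (at 0)"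
  proof (rule bilin_curve[OF roM])
    show "lin_on (model M) (\<lambda>v. G' y v w)" if "y \<in> snd cM ` fst cM" "w \<in> model M" for y w
      by (rule inner_on_lin1[OF gcomp_inner[OF RM cM(1) that(1)] that(2)])
    show "lin_on (model M) (G' y w)" if "y \<in> snd cM ` fst cM" "w \<in> model M" for y w
      by (rule inner_on_lin2[OF gcomp_inner[OF RM cM(1) that(1)] VM that(2)])
    show "Ck_on (Suc 0) (model M) (snd cM ` fst cM) (\<lambda>y. G' y v w)" if "v \<in> model M" "w \<in> model M" for v w
      by (rule gcomp_Ck[OF RM cM(1) that])
    show "\<forall>\<^sub>F t in nhds 0. phi (x0 + t *\<^sub>R v) \<in> snd cM ` fst cM"
      using ev by (rule eventually_mono) (rule phi_in)
    show "\<forall>\<^sub>F t in nhds 0. D (x0 + t *\<^sub>R v) a \<in> model M" "\<forall>\<^sub>F t in nhds 0. D (x0 + t *\<^sub>R v) b \<in> model M"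
      using ev by (auto elim!: eventually_mono intro: D_in a b)
  qed (use d1 d2 a b v D_in D2_in x0 phi_in in auto)
  then show ?thesis by (simp add: phi_x0)
qed

text \<open>The vector \<open>e\<close> is horizontal at \<open>u\<close> only. The difference
  \<open>?B\<close> of the two forms vanishes at \<open>t = 0\<close> and is nonnegative nearby, so
  \<open>t = 0\<close> is a local minimum on every line through \<open>x0\<close> and the derivative
  there is zero.\<close>

lemma horizontal_metric_derivative_diag:
  assumes e: "e \<in> horizontal N M \<pi> u" and v: "v \<in> model N"
  shows "dird (\<lambda>x. G x e e) x0 v = dird (\<lambda>x. G' (phi x) (D x e) (D x e)) x0 v"
proof -
  have em: "e \<in> model N" by (rule horizontal_in[OF e])
  let ?B = "\<lambda>t. G (x0 + t *\<^sub>R v) e e - G' (phi (x0 + t *\<^sub>R v)) (D (x0 + t *\<^sub>R v) e) (D (x0 + t *\<^sub>R v) e)"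
  have d1: "((\<lambda>t. G (x0 + t *\<^sub>R v) e e) has_vector_derivative dird (\<lambda>x. G x e e) x0 v) (at 0)"
    by (rule dird_works[of "\<lambda>x. G x e e", OF Ck_on_differentiable[OF gcomp_Ck[OF RN cN(1) em em] v x0(2)]])
  note d2 = pulled_back_metric_derivative[OF em em v]
  let ?d = "dird (\<lambda>y. G' y (D x0 e) (D x0 e)) y0 (D x0 v) + G' y0 (D2 e v) (D x0 e) + G' y0 (D x0 e) (D2 e v)"
  have e2: "dird (\<lambda>x. G' (phi x) (D x e) (D x e)) x0 v = ?d"
    by (rule dird_eqI[of "\<lambda>x. G' (phi x) (D x e) (D x e)"]) (rule d2)
  have "((?B) has_vector_derivative dird (\<lambda>x. G x e e) x0 v - ?d) (at 0)"
    by (rule has_vector_derivative_diff[OF d1 d2])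
  then have DB: "(?B has_real_derivative dird (\<lambda>x. G x e e) x0 v - ?d) (at 0)"
    by (simp add: has_real_derivative_iff_has_vector_derivative)
  have "\<forall>\<^sub>F t in nhds 0. ?B 0 \<le> ?B t"
    using relopen_eventually_line[OF Om_relopen x0(1) v]
    by (rule eventually_mono) (use pulled_back_metric_le[OF _ em] G_horizontal[OF e em] phi_x0 in auto)
  then obtain r where "r > 0" "\<And>t. \<bar>t - 0\<bar> < r \<Longrightarrow> ?B 0 \<le> ?B t"
    unfolding eventually_nhds_metric dist_real_def by blast
  then have "dird (\<lambda>x. G x e e) x0 v - ?d = 0"
    by (intro DERIV_local_min[OF DB]) (auto simp: abs_minus_commute)
  then show ?thesis using e2 by simp
qed

lemma horizontal_add:
  assumes "e \<in> horizontal N M \<pi> u" "w \<in> horizontal N M \<pi> u"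
  shows "e + w \<in> horizontal N M \<pi> u"
  using assms lin_on_add[OF inner_on_lin1[OF riemannian_manifoldD(2)[OF RN u]]] subspace_add[OF VN]
  by (auto simp: horizontal_def vertical_def)

text \<open>The form \<open>G - \<phi>\<^sup>*G'\<close> is positive semidefinite, so its diagonal values at horizontal vectors,
  being zero, are minimal, and polarization gives the vanishing of the remaining derivatives.\<close>

lemma horizontal_metric_derivative:
  assumes e: "e \<in> horizontal N M \<pi> u" and w: "w \<in> horizontal N M \<pi> u" and v: "v \<in> model N"
  shows "dird (\<lambda>x. G x e w) x0 v = dird (\<lambda>y. G' y (D x0 e) (D x0 w)) y0 (D x0 v)
     + G' y0 (D2 e v) (D x0 w) + G' y0 (D x0 e) (D2 w v)"
proof -
  have em: "e \<in> model N" and wm: "w \<in> model N" and ewm: "e + w \<in> model N"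
    using e w horizontal_in horizontal_add by auto
  let ?P = "\<lambda>a b x. G' (phi x) (D x a) (D x b)"
  have dG: "((\<lambda>t. G (x0 + t *\<^sub>R v) a b) has_vector_derivative dird (\<lambda>x. G x a b) x0 v) (at 0)"
    if "a \<in> model N" "b \<in> model N" for a b
    by (rule dird_works[of "\<lambda>x. G x a b", OF Ck_on_differentiable[OF gcomp_Ck[OF RN cN(1) that] v x0(2)]])
  have dP: "((\<lambda>t. ?P a b (x0 + t *\<^sub>R v)) has_vector_derivative dird (?P a b) x0 v) (at 0)"
    if "a \<in> model N" "b \<in> model N" for a b
    using pulled_back_metric_derivative[OF that v] dird_eqI[of "?P a b", OF pulled_back_metric_derivative[OF that v]] by simp
  have polG: "G x e w = (G x (e + w) (e + w) - G x e e - G x w w) / 2" if "x \<in> Om" for x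
  proof -
    have x: "x \<in> snd cN ` fst cN" using that Om_subset by auto
    note g = gcomp_inner[OF RN cN(1) x]
    show ?thesis
      using lin_on_add[OF inner_on_lin1[OF g ewm] em wm] lin_on_add[OF inner_on_lin2[OF g VN em] em wm]
        lin_on_add[OF inner_on_lin2[OF g VN wm] em wm] inner_on_sym[OF g em wm] by simp
  qed
  have polP: "?P e w x = (?P (e + w) (e + w) x - ?P e e x - ?P w w x) / 2" if x: "x \<in> Om" for x
  proof -
    note g = gcomp_inner[OF RM cM(1) phi_in[OF x]]
    note De = D_in[OF x em] and Dw = D_in[OF x wm] and Dew = D_in[OF x ewm]
    have "D x (e + w) = D x e + D x w" by (rule lin_on_add[OF D_lin[OF x] em wm])
    then show ?thesis
      using lin_on_add[OF inner_on_lin1[OF g Dew] De Dw] lin_on_add[OF inner_on_lin2[OF g VM De] De Dw]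
        lin_on_add[OF inner_on_lin2[OF g VM Dw] De Dw] inner_on_sym[OF g De Dw] by simp
  qed
  have "dird (\<lambda>x. G x e w) x0 v = dird (\<lambda>x. (G x (e + w) (e + w) - G x e e - G x w w) / 2) x0 v"
    by (rule dird_cong[OF Om_relopen x0(1) v polG])
  also have "\<dots> = (dird (\<lambda>x. G x (e + w) (e + w)) x0 v - dird (\<lambda>x. G x e e) x0 v - dird (\<lambda>x. G x w w) x0 v) / 2"
    by (rule dird_eqI) (intro has_vector_derivative_divide has_vector_derivative_diff dG em wm ewm)
  also have "\<dots> = (dird (?P (e + w) (e + w)) x0 v - dird (?P e e) x0 v - dird (?P w w) x0 v) / 2"
    by (simp only: horizontal_metric_derivative_diag[OF e v] horizontal_metric_derivative_diag[OF w v]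
        horizontal_metric_derivative_diag[OF horizontal_add[OF e w] v])
  also have "\<dots> = dird (\<lambda>x. (?P (e + w) (e + w) x - ?P e e x - ?P w w x) / 2) x0 v"
    by (rule dird_eqI[symmetric]) (intro has_vector_derivative_divide has_vector_derivative_diff dP em wm ewm)
  also have "\<dots> = dird (?P e w) x0 v"
    by (rule dird_cong[OF Om_relopen x0(1) v polP[symmetric]])
  also have "\<dots> = dird (\<lambda>y. G' y (D x0 e) (D x0 w)) y0 (D x0 v)
     + G' y0 (D2 e v) (D x0 w) + G' y0 (D x0 e) (D2 w v)"
    by (rule dird_eqI[of "?P e w"]) (rule pulled_back_metric_derivative[OF em wm v])
  finally show ?thesis .
qed

text \<open>Both sides are tested against \<open>z = D x0 w\<close> with \<open>w\<close>
  horizontal, which is possible because horizontal vectors map onto the tangent space of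
  \<open>M\<close>. Koszul's formula for \<open>G\<close> becomes the one for \<open>G'\<close> plus
  terms with second derivatives of \<open>phi\<close>, and only \<open>G' y0 (D2 e e) z\<close>
  survives of the latter.\<close>

lemma horizontal_second_form:
  assumes e: "e \<in> horizontal N M \<pi> u"
  shows "D2 e e - D x0 (\<Gamma> e e) = - \<Gamma>' (D x0 e) (D x0 e)"
proof -
  have em: "e \<in> model N" by (rule horizontal_in[OF e])
  note g' = gcomp_inner[OF RM cM(1) y0]
  note \<Gamma>p = christoffel_props[OF RN cN(1) x0(2) em em]
  let ?De = "D x0 e"
  have De: "?De \<in> model M" by (rule D_in[OF x0(1) em])
  note \<Gamma>p' = christoffel_props[OF RM cM(1) y0 De De]
  have D2e: "D2 e e \<in> model M" by (rule D2_in[OF em em])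
  have DG: "D x0 (\<Gamma> e e) \<in> model M" by (rule D_in[OF x0(1) \<Gamma>p(1)])
  have "D x0 (\<Gamma> e e) = D2 e e + \<Gamma>' ?De ?De"
  proof (rule inner_on_eqI[OF g' VM DG])
    show "D2 e e + \<Gamma>' ?De ?De \<in> model M" using D2e \<Gamma>p'(1) VM by (simp add: subspace_add)
    fix z assume z: "z \<in> model M"
    then obtain w where w: "w \<in> horizontal N M \<pi> u" "D x0 w = z"
      using bij_betw_imp_surj_on[OF dmap_bij[OF u]] dmap_u horizontal_in by (metis imageE)
    have wm: "w \<in> model N" by (rule horizontal_in[OF w(1)])
    \<comment> \<open>This symmetry cancels the terms in which the second derivative in the
      directions \<open>e\<close> and \<open>w\<close> is paired with \<open>?De\<close>.\<close>
    have sym: "D2 w e = D2 e w"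
      by (rule dird_symmetric[OF Om_relopen phi_Ck[of "Suc (Suc 0)"] x0(1) wm em])
    have "G' y0 (D x0 (\<Gamma> e e)) z = G x0 (\<Gamma> e e) w"
      using G_horizontal[OF w(1) \<Gamma>p(1)] w(2) by simp
    also have "\<dots> = dird (\<lambda>x. G x e w) x0 e - dird (\<lambda>x. G x e e) x0 w / 2"
      using \<Gamma>p(2)[OF wm] by (simp add: koszul_def)
    also have "\<dots> = dird (\<lambda>y. G' y ?De z) y0 ?De - dird (\<lambda>y. G' y ?De ?De) y0 z / 2
       + G' y0 (D2 e e) z + G' y0 ?De (D2 w e) - (G' y0 (D2 e w) ?De + G' y0 ?De (D2 e w)) / 2"
      using horizontal_metric_derivative[OF e w(1) em] horizontal_metric_derivative[OF e e wm] w(2)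
      by (simp add: field_simps)
    also have "\<dots> = koszul M cM y0 ?De ?De z + G' y0 (D2 e e) z"
      using sym inner_on_sym[OF g' De D2_in[OF em wm]] by (simp add: koszul_def)
    also have "\<dots> = G' y0 (D2 e e + \<Gamma>' ?De ?De) z"
      using lin_on_add[OF inner_on_lin1[OF g' z] D2e \<Gamma>p'(1)] \<Gamma>p'(2)[OF z] by simp
    finally show "G' y0 (D x0 (\<Gamma> e e)) z = G' y0 (D2 e e + \<Gamma>' ?De ?De) z" .
  qed
  then show ?thesis by simp
qed

section \<open>Frame vector fields in coordinates and the frame formula\<close>

lemma vf_coordinates:
  assumes W: "openin (mtop N) W" "u \<in> W" and X: "smooth_vf N W X"
  defines "W1 \<equiv> snd cN ` (fst cN \<inter> \<pi> -` fst cM \<inter> W)"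
  shows "relopen (model N) W1" "x0 \<in> W1" "W1 \<subseteq> Om" "Ck_on k (model N) W1 (vrep N cN X)"
    "\<And>x. x \<in> W1 \<Longrightarrow> vrep N cN X x \<in> model N" "vrep N cN X x0 = X u" "X u \<in> model N"
proof -
  have "openin (mtop N) (points N \<inter> \<pi> -` fst cM \<inter> W)"
    using smooth_map_relopen(1)[OF smN smM smooth_pi cN(1) cM(1)] W(1) by (rule openin_Int)
  moreover have "fst cN \<inter> (points N \<inter> \<pi> -` fst cM \<inter> W) = fst cN \<inter> \<pi> -` fst cM \<inter> W"
    using chart_subset[OF smN cN(1)] by auto
  ultimately show "relopen (model N) W1"
    using chart_overlap_relopen[OF smN cN(1)] unfolding W1_def by metis
  show "x0 \<in> W1" using cN cM W by (auto simp: x0_def W1_def)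
  show "W1 \<subseteq> Om" by (auto simp: W1_def Om_def)
  have "Cinf_on (model N) (snd cN ` (fst cN \<inter> W)) (vrep N cN X)"
    using X cN(1) by (simp add: smooth_vf_def)
  then show "Ck_on k (model N) W1 (vrep N cN X)"
    unfolding Cinf_on_def W1_def by (blast intro: Ck_on_subset)
  show "X u \<in> model N" using X W by (simp add: smooth_vf_def)
  then show "vrep N cN X x0 = X u"
    using comps_chart_at[OF smN u] by (simp add: vrep_def x0_def cinv_left[OF smN cN] flip: cN_def)
  fix x assume "x \<in> W1"
  then obtain q where q: "q \<in> fst cN" "q \<in> W" "x = snd cN q" by (auto simp: W1_def)
  then show "vrep N cN X x \<in> model N"
    using X comps_in[OF smN cN(1) q(1)] by (simp add: vrep_def cinv_left[OF smN cN(1) q(1)] smooth_vf_def)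
qed

text \<open>This derivative occurs twice: inside the second derivative of a lifted function along a
  horizontal field, and for vertical fields, where the differentiated function is constantly
  zero.\<close>

lemma D_field_derivative:
  assumes W: "openin (mtop N) W" "u \<in> W" and X: "smooth_vf N W X"
  shows "((\<lambda>t. D (x0 + t *\<^sub>R X u) (vrep N cN X (x0 + t *\<^sub>R X u))) has_vector_derivative
     D2 (X u) (X u) + D x0 (dird (vrep N cN X) x0 (X u))) (at 0)"
    "dird (vrep N cN X) x0 (X u) \<in> model N"
proof -
  note v = vf_coordinates[OF W X]
  let ?X = "vrep N cN X"
  note ev = relopen_eventually_line[OF v(1,2,7)]
  note diff = Ck_on_differentiable[OF v(4)[of "Suc 0"] v(7,2)]
  show dX: "dird ?X x0 (X u) \<in> model N"
    by (rule dird_in_subspace[OF v(1) diff v(2,7) VN v(5)])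
  have "((\<lambda>t. D (x0 + t *\<^sub>R X u) (?X (x0 + t *\<^sub>R X u))) has_vector_derivative
     dird (\<lambda>x. D x (?X (x0 + 0 *\<^sub>R X u))) (x0 + 0 *\<^sub>R X u) (X u) + D (x0 + 0 *\<^sub>R X u) (dird ?X x0 (X u))) (at 0)"
  proof (rule lin_curve[OF Om_relopen VN D_lin Ck_on_dird[OF phi_Ck]])
    show "((\<lambda>t. x0 + t *\<^sub>R X u) has_vector_derivative X u) (at 0)"
      by (auto intro!: derivative_eq_intros)
    show "((\<lambda>t. ?X (x0 + t *\<^sub>R X u)) has_vector_derivative dird ?X x0 (X u)) (at 0)"
      by (rule dird_works[OF diff])
    show "\<forall>\<^sub>F t in nhds 0. x0 + t *\<^sub>R X u \<in> Om"
      by (rule relopen_eventually_line[OF Om_relopen x0(1) v(7)])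
    show "\<forall>\<^sub>F t in nhds 0. ?X (x0 + t *\<^sub>R X u) \<in> model N"
      using ev by (rule eventually_mono) (rule v(5))
  qed (use x0 v dX in auto)
  then show "((\<lambda>t. D (x0 + t *\<^sub>R X u) (?X (x0 + t *\<^sub>R X u))) has_vector_derivative
     D2 (X u) (X u) + D x0 (dird ?X x0 (X u))) (at 0)" by (simp add: v(6))
qed

lemma cov_eq:
  assumes W: "openin (mtop N) W" "u \<in> W" and X: "smooth_vf N W X"
  shows "cov N (X u) X u = dird (vrep N cN X) x0 (X u) + \<Gamma> (X u) (X u)" "cov N (X u) X u \<in> model N"
    "D x0 (cov N (X u) X u) = D x0 (dird (vrep N cN X) x0 (X u)) + D x0 (\<Gamma> (X u) (X u))"
proof -
  note v = vf_coordinates[OF W X] and d = D_field_derivative(2)[OF W X]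
  have G: "\<Gamma> (X u) (X u) \<in> model N" by (rule christoffel_props(1)[OF RN cN(1) x0(2) v(7,7)])
  show e: "cov N (X u) X u = dird (vrep N cN X) x0 (X u) + \<Gamma> (X u) (X u)"
    by (simp add: cov_def Let_def x0_def cN_def)
  show "cov N (X u) X u \<in> model N" unfolding e using d G VN by (simp add: subspace_add)
  show "D x0 (cov N (X u) X u) = D x0 (dird (vrep N cN X) x0 (X u)) + D x0 (\<Gamma> (X u) (X u))"
    unfolding e by (rule lin_on_add[OF D_lin[OF x0(1)] d G])
qed

context
  fixes f :: "'a \<Rightarrow> real"
  assumes f: "smooth_fun M (points M) f"
begin

private definition "fh = f \<circ> cinv cM"

private lemma fh_Ck: "Ck_on k (model M) (snd cM ` fst cM) fh"
  unfolding fh_def by (rule smooth_fun_Ck[OF RM f cM(1)])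

private lemma fh_lin: "y \<in> snd cM ` fst cM \<Longrightarrow> lin_on (model M) (dird fh y)"
  by (rule lin_on_dird[OF roM fh_Ck[of "Suc 0"]])

private lemma lift_rep: "x \<in> Om \<Longrightarrow> ((f \<circ> \<pi>) \<circ> cinv cN) x = fh (phi x)"
  by (auto simp: Om_def fh_def phi_snd cinv_left[OF smN cN(1)] cinv_left[OF smM cM(1)])

private lemma lift_dird:
  assumes x: "x \<in> Om" and v: "v \<in> model N"
  shows "dird ((f \<circ> \<pi>) \<circ> cinv cN) x v = dird fh (phi x) (D x v)"
proof -
  have "dird ((f \<circ> \<pi>) \<circ> cinv cN) x v = dird (\<lambda>x. fh (phi x)) x v"
    by (rule dird_cong[OF Om_relopen x v lift_rep])
  also have "\<dots> = dird fh (phi x) (D x v)"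
    by (rule dird_chain(2)[OF Om_relopen roM phi_Ck[of "Suc 0"] fh_Ck[of "Suc 0"] _ x v]) (use phi_in in auto)
  finally show ?thesis .
qed

private lemma lift_Ck: "Ck_on k (model N) Om ((f \<circ> \<pi>) \<circ> cinv cN)"
  by (rule Ck_on_cong[OF Om_relopen _ Ck_on_compose[OF Om_relopen roM _ phi_Ck fh_Ck]])
    (use lift_rep phi_in in auto)

private lemma dfun_u: "v \<in> model N \<Longrightarrow> dfun N (f \<circ> \<pi>) u v = dird fh y0 (D x0 v)"
  using lift_dird[OF x0(1)] by (simp add: dfun_def Let_def phi_x0 flip: cN_def x0_def)

text \<open>The differential of a lifted function factors through \<open>D x0\<close>, which does
  not see vertical parts; \<open>hpart\<close> thereby disappears from the frame formula.\<close>

private lemma dfun_hpart: "v \<in> model N \<Longrightarrow> dfun N (f \<circ> \<pi>) u (hpart N M \<pi> u v) = dird fh y0 (D x0 v)"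
  using dfun_u[OF horizontal_in[OF hpart_props(1)[OF u]]] dmap_hpart[OF u] dmap_u horizontal_in[OF hpart_props(1)[OF u]]
  by metis

text \<open>\<open>vf_app\<close> evaluates in the preferred chart of each point. The inner
  application is rewritten in the fixed chart \<open>cN\<close> on all of \<open>?W1\<close>, and
  the outer one differentiates the result by the chain and product rules.\<close>

private lemma vf_app_twice:
  assumes W: "openin (mtop N) W" "u \<in> W" and X: "smooth_vf N W X"
  shows "vf_app N X (vf_app N X (f \<circ> \<pi>)) u =
    dird (\<lambda>y. dird fh y (D x0 (X u))) y0 (D x0 (X u)) + dird fh y0 (D2 (X u) (X u) + D x0 (dird (vrep N cN X) x0 (X u)))"
proof -
  note v = vf_coordinates[OF W X]
  let ?X = "vrep N cN X" and ?W1 = "snd cN ` (fst cN \<inter> \<pi> -` fst cM \<inter> W)"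
  let ?k = "\<lambda>x. dird fh (phi x) (D x (?X x))"
  have rep: "(vf_app N X (f \<circ> \<pi>) \<circ> cinv cN) x = ?k x" if x: "x \<in> ?W1" for x
  proof -
    obtain q where q: "q \<in> fst cN" "\<pi> q \<in> fst cM" "q \<in> W" "x = snd cN q" using x by auto
    have qN: "q \<in> points N" using chart_subset[OF smN cN(1)] q by auto
    have Xq: "X q \<in> model N" using X q by (simp add: smooth_vf_def)
    have dq: "snd cN q \<in> Om" using q by (auto simp: Om_def)
    have domeq: "Om = snd cN ` (fst cN \<inter> (points N \<inter> \<pi> -` fst cM))"
      using chart_subset[OF smN cN(1)] by (auto simp: Om_def)
    have "dfun N (f \<circ> \<pi>) q (X q) = dird ((f \<circ> \<pi>) \<circ> cinv cN) (snd cN q) (comps N cN q (X q))"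
      by (rule dfun_rep[OF smN cN(1) q(1) _ smooth_map_relopen(1)[OF smN smM smooth_pi cN(1) cM(1)] lift_Ck[of "Suc 0", unfolded domeq] Xq])
        (use q qN in auto)
    also have "\<dots> = dird fh (phi (snd cN q)) (D (snd cN q) (comps N cN q (X q)))"
      by (rule lift_dird[OF dq comps_in[OF smN cN(1) q(1) Xq]])
    finally show ?thesis by (simp add: vf_app_def vrep_def q(4) cinv_left[OF smN cN(1) q(1)])
  qed
  have "vf_app N X (vf_app N X (f \<circ> \<pi>)) u = dird (vf_app N X (f \<circ> \<pi>) \<circ> cinv cN) x0 (X u)"
    unfolding vf_app_def[of N X "vf_app N X (f \<circ> \<pi>)"] by (simp add: dfun_def Let_def x0_def cN_def)
  also have "\<dots> = dird ?k x0 (X u)"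
    by (rule dird_cong[OF v(1,2,7) rep])
  also have "\<dots> = dird (\<lambda>y. dird fh y (D x0 (X u))) y0 (D x0 (X u)) + dird fh y0 (D2 (X u) (X u) + D x0 (dird ?X x0 (X u)))"
  proof (rule dird_eqI)
    note dd = D_field_derivative[OF W X]
    note ev = relopen_eventually_line[OF v(1,2,7)]
    have "((\<lambda>t. dird fh (phi (x0 + t *\<^sub>R X u)) (D (x0 + t *\<^sub>R X u) (?X (x0 + t *\<^sub>R X u)))) has_vector_derivative
      dird (\<lambda>y. dird fh y (D (x0 + 0 *\<^sub>R X u) (?X (x0 + 0 *\<^sub>R X u)))) (phi (x0 + 0 *\<^sub>R X u)) (D x0 (X u)) +
      dird fh (phi (x0 + 0 *\<^sub>R X u)) (D2 (X u) (X u) + D x0 (dird ?X x0 (X u)))) (at 0)"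
    proof (rule lin_curve[OF roM VM fh_lin Ck_on_dird[OF fh_Ck]])
      show "((\<lambda>t. phi (x0 + t *\<^sub>R X u)) has_vector_derivative D x0 (X u)) (at 0)"
        by (rule dird_works[OF Ck_on_differentiable[OF phi_Ck v(7) x0(1)]])
      show "\<forall>\<^sub>F t in nhds 0. phi (x0 + t *\<^sub>R X u) \<in> snd cM ` fst cM"
        using ev by (rule eventually_mono) (rule phi_in[OF subsetD[OF v(3)]])
      show "\<forall>\<^sub>F t in nhds 0. D (x0 + t *\<^sub>R X u) (?X (x0 + t *\<^sub>R X u)) \<in> model M"
        using ev by (rule eventually_mono) (rule D_in[OF subsetD[OF v(3)] v(5)])
      show "((\<lambda>t. D (x0 + t *\<^sub>R X u) (?X (x0 + t *\<^sub>R X u))) has_vector_derivative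
         D2 (X u) (X u) + D x0 (dird ?X x0 (X u))) (at 0)" by (rule dd(1))
      show "D2 (X u) (X u) + D x0 (dird ?X x0 (X u)) \<in> model M"
        using D2_in[OF v(7,7)] D_in[OF x0(1) dd(2)] VM by (simp add: subspace_add)
    qed (use x0 v D_in phi_in in auto)
    then show "((\<lambda>t. dird fh (phi (x0 + t *\<^sub>R X u)) (D (x0 + t *\<^sub>R X u) (?X (x0 + t *\<^sub>R X u)))) has_vector_derivative
      dird (\<lambda>y. dird fh y (D x0 (X u))) y0 (D x0 (X u)) + dird fh y0 (D2 (X u) (X u) + D x0 (dird ?X x0 (X u)))) (at 0)"
      by (simp add: v(6) phi_x0)
  qed
  finally show ?thesis .
qed

text \<open>The derivative of the components of \<open>X\<close> occurs both in the second
  derivative along \<open>X\<close> and in the covariant derivative, and cancels. What remains of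
  \<open>phi\<close> is \<open>D2 - D \<Gamma>\<close>, which \<open>horizontal_second_form\<close>
  replaces by the Christoffel term of the Hessian on \<open>M\<close>.\<close>

lemma hlap_horizontal_term:
  assumes W: "openin (mtop N) W" "u \<in> W" and X: "smooth_vf N W X" and h: "X u \<in> horizontal N M \<pi> u"
  shows "vf_app N X (vf_app N X (f \<circ> \<pi>)) u - dfun N (f \<circ> \<pi>) u (hpart N M \<pi> u (cov N (X u) X u))
    = hessian M cM f y0 (D x0 (X u)) (D x0 (X u))"
proof -
  have e: "X u \<in> model N" by (rule horizontal_in[OF h])
  note c = cov_eq[OF W X] and d = D_field_derivative(2)[OF W X]
  let ?D2 = "D2 (X u) (X u)" and ?DX = "D x0 (dird (vrep N cN X) x0 (X u))" and ?DG = "D x0 (\<Gamma> (X u) (X u))"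
  have m: "?D2 \<in> model M" "?DX \<in> model M" "?DG \<in> model M" "\<Gamma>' (D x0 (X u)) (D x0 (X u)) \<in> model M"
    using D2_in[OF e e] D_in[OF x0(1)] d christoffel_props(1)[OF RN cN(1) x0(2) e e]
      christoffel_props(1)[OF RM cM(1) y0] e by auto
  have "?D2 = ?DG - \<Gamma>' (D x0 (X u)) (D x0 (X u))"
    using horizontal_second_form[OF h] by (simp add: algebra_simps)
  then have "dird fh y0 ?D2 = dird fh y0 ?DG - dird fh y0 (\<Gamma>' (D x0 (X u)) (D x0 (X u)))"
    using lin_on_diff[OF fh_lin[OF y0] m(3,4)] by simp
  then show ?thesis
    unfolding vf_app_twice[OF W X] dfun_hpart[OF c(2)] c(3) hessian_def
    using lin_on_add[OF fh_lin[OF y0] m(1,2)] lin_on_add[OF fh_lin[OF y0] m(2,3)] by (simp add: fh_def)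
qed

text \<open>Since \<open>X\<close> is vertical on all of \<open>W\<close>, the function
  \<open>D x (X x)\<close> vanishes near \<open>x0\<close> and so does its derivative
  \<open>D2 + D x0 (dX)\<close>. Together with \<open>VI\<close> this says that \<open>D x0\<close>
  annihilates the covariant derivative of \<open>X\<close> along itself.\<close>

lemma hlap_vertical_term:
  assumes VI: "\<And>v. v \<in> vertical N M \<pi> u \<Longrightarrow> D2 v v = D x0 (\<Gamma> v v)"
    and W: "openin (mtop N) W" "u \<in> W" and X: "smooth_vf N W X" and vert: "\<And>q. q \<in> W \<Longrightarrow> X q \<in> vertical N M \<pi> q"
  shows "dfun N (f \<circ> \<pi>) u (hpart N M \<pi> u (cov N (X u) X u)) = 0"
proof -
  note v = vf_coordinates[OF W X]
  note c = cov_eq[OF W X] and d = D_field_derivative[OF W X]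
  let ?X = "vrep N cN X" and ?W1 = "snd cN ` (fst cN \<inter> \<pi> -` fst cM \<inter> W)"
  have zero: "D x (?X x) = 0" if x: "x \<in> ?W1" for x
  proof -
    obtain q where q: "q \<in> fst cN" "\<pi> q \<in> fst cM" "q \<in> W" "x = snd cN q" using x by auto
    have Xq: "X q \<in> model N" using X q by (simp add: smooth_vf_def)
    have dq: "snd cN q \<in> Om" using q by (auto simp: Om_def)
    have cq: "comps N cN q (X q) \<in> model N" by (rule comps_in[OF smN cN(1) q(1) Xq])
    have "tvec M cM (\<pi> q) (D (snd cN q) (comps N cN q (X q))) = 0"
      using vert[OF q(3)] dmap_eq[OF q(1,2) Xq] by (simp add: vertical_def)
    then have "D (snd cN q) (comps N cN q (X q)) = comps M cM (\<pi> q) 0"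
      using comps_tvec[OF smM cM(1) q(2) D_in[OF dq cq]] by simp
    also have "\<dots> = 0" by (rule lin_on_zero[OF comps_lin[OF smM cM(1) q(2)] VM])
    finally show ?thesis by (simp add: vrep_def q(4) cinv_left[OF smN cN(1) q(1)])
  qed
  have "dird (\<lambda>x. D x (?X x)) x0 (X u) = dird (\<lambda>x. 0) x0 (X u)"
    by (rule dird_cong[OF v(1,2,7) zero])
  also have "\<dots> = 0" by (rule dird_eqI) simp
  finally have "D2 (X u) (X u) + D x0 (dird ?X x0 (X u)) = 0"
    using dird_eqI[of "\<lambda>x. D x (?X x)", OF d(1)] by simp
  then have "D x0 (cov N (X u) X u) = 0"
    using c(3) VI[OF vert[OF W(2)]] by (simp add: add_eq_0_iff)
  then show ?thesis
    unfolding dfun_hpart[OF c(2)] using lin_on_zero[OF fh_lin[OF y0] VM] by simp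
qed

lemma hlap_in_frame_eq:
  assumes VI: "\<And>v. v \<in> vertical N M \<pi> u \<Longrightarrow> D2 v v = D x0 (\<Gamma> v v)"
    and W: "openin (mtop N) W" "u \<in> W" and fr: "adapted_frame N M \<pi> W E F"
  shows "hlap_in_frame N M \<pi> E F (f \<circ> \<pi>) u = laplace_beltrami M f (\<pi> u)"
proof -
  have E: "smooth_vf N W (E i)" "E i u \<in> horizontal N M \<pi> u" if "i < mdim M" for i
    using fr W that by (auto simp: adapted_frame_def)
  have F: "smooth_vf N W (F j)" "\<And>q. q \<in> W \<Longrightarrow> F j q \<in> vertical N M \<pi> q" if "j < mdim N - mdim M" for j
    using fr that by (auto simp: adapted_frame_def)
  have on: "onfam (metric M (\<pi> u)) {..<mdim M} (\<lambda>i. D x0 (E i u))"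
    using fr W dmap_isometry[OF u E(2) E(2)] dmap_u[OF horizontal_in[OF E(2)]]
    by (auto simp: onfam_def adapted_frame_def)
  have "hlap_in_frame N M \<pi> E F (f \<circ> \<pi>) u = (\<Sum>i<mdim M. hessian M cM f y0 (D x0 (E i u)) (D x0 (E i u))) - 0"
    unfolding hlap_in_frame_def
    using hlap_horizontal_term[OF W E] hlap_vertical_term[OF VI W F] by simp
  also have "\<dots> = laplace_beltrami M f (\<pi> u)"
    using laplace_beltrami_eq[OF RM f pi_points[OF u] _ _ on] D_in[OF x0(1) horizontal_in[OF E(2)]]
    by (simp add: y0_def cM_def)
  finally show ?thesis .
qed

end

end

section \<open>Existence of adapted frames\<close>

lemma lin_on_kernel_subspace:
  assumes V: "subspace V" and l: "lin_on V l"
  shows "subspace {v \<in> V. l v = 0}"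
  using lin_on_zero[OF l V] lin_on_add[OF l] lin_on_scale[OF l] V
  by (auto simp: subspace_def)

lemma lin_on_span_zero:
  assumes V: "subspace V" and l: "lin_on V l" and S: "S \<subseteq> V" "\<And>s. s \<in> S \<Longrightarrow> l s = 0" and v: "v \<in> span S"
  shows "l v = 0"
  using span_minimal[OF _ lin_on_kernel_subspace[OF V l], of S] S v by auto

text \<open>Smoothness of a vector field refers to all charts. In another chart \<open>c2\<close>
  the components are the derivative of the transition map applied to \<open>Y\<close>, evaluated at
  the transported point.\<close>

lemma smooth_vf_from_chart:
  assumes sm: "smooth_manifold M" and c: "c \<in> atlas M" and W: "openin (mtop M) W" "W \<subseteq> fst c"
    and Y: "\<And>k. Ck_on k (model M) (snd c ` W) Y" "\<And>x. x \<in> snd c ` W \<Longrightarrow> Y x \<in> model M"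
  shows "smooth_vf M W (\<lambda>q. tvec M c q (Y (snd c q)))"
  unfolding smooth_vf_def Cinf_on_def
proof (intro conjI ballI allI)
  fix q assume q: "q \<in> W"
  then show "tvec M c q (Y (snd c q)) \<in> model M"
    using W by (intro tvec_in[OF sm c]) (auto intro: Y(2))
next
  fix c2 k assume c2: "c2 \<in> atlas M"
  let ?U = "snd c2 ` (fst c2 \<inter> W)" and ?U' = "snd c ` (fst c \<inter> (fst c2 \<inter> W))"
  note oc2 = smooth_manifoldD(4)[OF sm c2]
  have ro: "relopen (model M) ?U" by (rule chart_overlap_relopen[OF sm c2 W(1)])
  have ro': "relopen (model M) ?U'" using W(1) oc2 by (intro chart_overlap_relopen[OF sm c]) auto
  let ?Z = "\<lambda>y. dird (snd c2 \<circ> cinv c) y (Y y)" and ?s = "snd c \<circ> cinv c2"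
  have Z: "Ck_on k (model M) ?U' ?Z"
  proof (rule Ck_on_dird_field[OF ro'])
    show "Ck_on (Suc k) (model M) ?U' (snd c2 \<circ> cinv c)"
      by (rule Ck_on_subset[OF transition_Ck[OF sm c c2]]) auto
    show "Ck_on k (model M) ?U' Y" by (rule Ck_on_subset[OF Y(1)]) auto
    show "Y x \<in> model M" if "x \<in> ?U'" for x using that by (intro Y(2)) auto
  qed
  have s: "Ck_on k (model M) ?U ?s"
    by (rule Ck_on_subset[OF transition_Ck[OF sm c2 c]]) (use W in auto)
  have "Ck_on k (model M) ?U (\<lambda>x. ?Z (?s x))"
    by (rule Ck_on_compose[OF ro ro' _ s Z]) (use W in \<open>auto simp: cinv_left[OF sm c2]\<close>)
  moreover have "?Z (?s x) = vrep M c2 (\<lambda>q. tvec M c q (Y (snd c q))) x" if "x \<in> ?U" for x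
  proof -
    obtain q where q: "q \<in> fst c2" "q \<in> W" "x = snd c2 q" using \<open>x \<in> ?U\<close> by auto
    have qc: "q \<in> fst c" and qM: "q \<in> points M" using q W chart_subset[OF sm c] by auto
    note ca = chart_at_props[OF sm qM]
    have Yq: "Y (snd c q) \<in> model M" using q by (intro Y(2)) auto
    have "comps M c2 q (tvec M c q (Y (snd c q))) = tchange c c2 q (Y (snd c q))"
      unfolding comps_tchange tvec_tchange by (rule tchange_trans[OF sm c ca(1) c2 qc ca(2) q(1) Yq])
    then show ?thesis
      by (simp add: vrep_def q(3) cinv_left[OF sm c2 q(1)] tchange_def)
  qed
  ultimately show "Ck_on k (model M) ?U (vrep M c2 (\<lambda>q. tvec M c q (Y (snd c q))))"
    by (rule Ck_on_cong[OF ro, rotated])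
qed

context submersion_at
begin

lemma vertical_u: "vertical N M \<pi> u = {v \<in> model N. D x0 v = 0}"
  by (auto simp: vertical_def dmap_u)

lemma vertical_subspace: "subspace (vertical N M \<pi> u)"
  unfolding vertical_u by (rule lin_on_kernel_subspace[OF VN D_lin[OF x0(1)]])

lemma horizontal_subspace: "subspace (horizontal N M \<pi> u)"
proof -
  note g = riemannian_manifoldD(2)[OF RN u]
  have z: "0 \<in> horizontal N M \<pi> u"
    using subspace_0[OF VN] lin_on_zero[OF inner_on_lin1[OF g] VN] by (auto simp: horizontal_def vertical_def)
  have s: "r *\<^sub>R v \<in> horizontal N M \<pi> u" if "v \<in> horizontal N M \<pi> u" for r v
    using that lin_on_scale[OF inner_on_lin1[OF g]] VN by (auto simp: horizontal_def vertical_def subspace_scale)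
  show ?thesis using z s horizontal_add by (simp add: subspace_def)
qed

text \<open>The tangent space is the direct sum of the vertical space and a horizontal space
  isomorphic to the model of \<open>M\<close>. Stated as a sum, the formula also yields
  \<open>mdim M \<le> mdim N\<close>, so the natural number subtraction in
  \<open>adapted_frame\<close> is a genuine difference.\<close>

lemma dim_vertical: "mdim M + dim (vertical N M \<pi> u) = mdim N"
proof -
  let ?H = "horizontal N M \<pi> u" and ?K = "vertical N M \<pi> u"
  let ?L = "\<lambda>v. D x0 (oproj (model N) v)"
  have lin: "linear ?L" by (rule linear_oproj_extension[OF VN D_lin[OF x0(1)]])
  have L: "?L v = dmap N M \<pi> u v" if "v \<in> ?H" for v
    using horizontal_in[OF that] by (simp add: oproj_id[OF VN] dmap_u)
  have inj: "inj_on ?L ?H" and im: "?L ` ?H = model M"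
    using dmap_bij[OF u] L unfolding bij_betw_def by (auto simp: inj_on_def image_def)
  have "dim (?L ` ?H) = dim ?H"
    using inj by (intro dim_image_eq[OF lin]) (simp add: span_eq_iff[THEN iffD2, OF horizontal_subspace])
  then have dH: "dim ?H = mdim M" using im by (simp add: mdim_def)
  have "?H \<inter> ?K = {0}"
  proof -
    have "v = 0" if "v \<in> ?H" "v \<in> ?K" for v
      using that inner_on_pos[OF riemannian_manifoldD(2)[OF RN u] horizontal_in[OF that(1)]]
      by (auto simp: horizontal_def)
    then show ?thesis using subspace_0[OF horizontal_subspace] subspace_0[OF vertical_subspace] by auto
  qed
  moreover have "{x + y |x y. x \<in> ?H \<and> y \<in> ?K} = model N"
  proof
    show "{x + y |x y. x \<in> ?H \<and> y \<in> ?K} \<subseteq> model N"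
      using horizontal_in vertical_in VN by (auto intro: subspace_add)
    show "model N \<subseteq> {x + y |x y. x \<in> ?H \<and> y \<in> ?K}"
    proof
      fix v assume "v \<in> model N"
      note h = hpart_props[OF u this]
      have "v = hpart N M \<pi> u v + (v - hpart N M \<pi> u v)" by simp
      then show "v \<in> {x + y |x y. x \<in> ?H \<and> y \<in> ?K}" using h by blast
    qed
  qed
  ultimately show ?thesis
    using dim_sums_Int[OF horizontal_subspace vertical_subspace] dH by (simp add: mdim_def)
qed

text \<open>Gram-Schmidt is applied to horizontal fields followed by constant vectors that are
  vertical at \<open>u\<close> only. The first \<open>?d\<close> results span the same space as the
  horizontal fields; the others are orthogonal to that space, and this alone makes them vertical at
  every point of the neighbourhood.\<close>

lemma adapted_frame_exists:
  "\<exists>W E F. openin (mtop N) W \<and> u \<in> W \<and> adapted_frame N M \<pi> W E F"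
proof -
  let ?d = "mdim M" and ?n = "mdim N" and ?K = "vertical N M \<pi> u"
  have dn: "?d \<le> ?n" and dK: "dim ?K = ?n - ?d" using dim_vertical by auto
  obtain e where e: "\<And>i. i < ?d \<Longrightarrow> e i \<in> model M" "span (e ` {..<?d}) = model M"
    "\<And>i. i < ?d \<Longrightarrow> e i \<notin> span (e ` {..<i})"
    using onb_enum[OF VM] unfolding mdim_def by metis
  obtain v where v: "\<And>i. i < ?n - ?d \<Longrightarrow> v i \<in> ?K" "\<And>i. i < ?n - ?d \<Longrightarrow> v i \<notin> span (v ` {..<i})"
    using onb_enum[OF vertical_subspace] unfolding dK by metis
  have gO: "inner_on (model N) (G x)" if "x \<in> Om" for x
    using gcomp_inner[OF RN cN(1)] that Om_subset by blast
  have gC: "Ck_on k (model N) Om (\<lambda>x. G x a b)" if "a \<in> model N" "b \<in> model N" for k a b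
    by (rule Ck_on_subset[OF gcomp_Ck[OF RN cN(1) that] Om_subset])
  have il: "lin_on (model N) (\<lambda>w. e i \<bullet> D x w)" if "x \<in> Om" for x i
    using D_lin[OF that] by (simp add: lin_on_def inner_add_right)
  \<comment> \<open>\<open>H i x\<close> is metrically dual to the form
    \<open>e i \<bullet> D x w\<close>. It is orthogonal to the kernel of \<open>D x\<close> at
    every \<open>x\<close>, and smooth because it solves a linear system with smooth data.\<close>
  define H where "H i x = (THE z. z \<in> model N \<and> (\<forall>w\<in>model N. G x z w = e i \<bullet> D x w))" for i x
  have H: "H i x \<in> model N" "\<And>w. w \<in> model N \<Longrightarrow> G x (H i x) w = e i \<bullet> D x w" if "x \<in> Om" for i x
    using theI'[OF riesz[OF VN gO[OF that] il[OF that]]] unfolding H_def by blast+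
  have HC: "Ck_on k (model N) Om (H i)" for i k
    by (rule Ck_on_solve[OF Om_relopen gO gC il _ H])
      (assumption | intro Ck_on_inner Ck_on_const Om_relopen Ck_on_dird[OF phi_Ck])+
  \<comment> \<open>The constant fields \<open>v\<close> have to be right at \<open>x0\<close> only,
    since Gram-Schmidt needs independence at that point.\<close>
  define X where "X i x = (if i < ?d then H i x else v (i - ?d))" for i x
  have XV: "X i x \<in> model N" if "i < ?n" "x \<in> Om" for i x
    using that H(1) vertical_in[OF v(1), of "i - ?d"] by (auto simp: X_def)
  have XC: "Ck_on k (model N) Om (X i)" for i k
  proof (cases "i < ?d")
    case True then have "X i = H i" by (auto simp: X_def) then show ?thesis using HC by simp
  next
    case False then have "X i = (\<lambda>x. v (i - ?d))" by (auto simp: X_def) then show ?thesis by simp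
  qed
  \<comment> \<open>Duality sends the span of an initial segment of the \<open>H i x0\<close> to the
    span of the same segment of \<open>e\<close>. Surjectivity of \<open>D x0\<close> lets one
    recover \<open>a\<close> from its form, so independence is inherited from
    \<open>e\<close>.\<close>
  have Hspan: "\<exists>a\<in>span (e ` {..<m}). \<forall>w\<in>model N. G x0 h w = a \<bullet> D x0 w"
    if h: "h \<in> span ((\<lambda>i. H i x0) ` {..<m})" for h m
  proof -
    obtain r where r: "h = (\<Sum>z\<in>(\<lambda>i. H i x0) ` {..<m}. r z *\<^sub>R z)"
      using h span_finite[of "(\<lambda>i. H i x0) ` {..<m}"] by auto
    have "\<exists>a\<in>span (e ` {..<m}). \<forall>w\<in>model N. G x0 z w = a \<bullet> D x0 w" if "z \<in> (\<lambda>i. H i x0) ` {..<m}" for z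
      using that H(2)[OF x0(1)] by (auto intro: span_base)
    then obtain a where a: "\<And>z. z \<in> (\<lambda>i. H i x0) ` {..<m} \<Longrightarrow> a z \<in> span (e ` {..<m})"
      "\<And>z w. z \<in> (\<lambda>i. H i x0) ` {..<m} \<Longrightarrow> w \<in> model N \<Longrightarrow> G x0 z w = a z \<bullet> D x0 w" by metis
    have "G x0 h w = (\<Sum>z\<in>(\<lambda>i. H i x0) ` {..<m}. r z *\<^sub>R a z) \<bullet> D x0 w" if w: "w \<in> model N" for w
    proof -
      have "G x0 h w = (\<Sum>z\<in>(\<lambda>i. H i x0) ` {..<m}. r z *\<^sub>R G x0 z w)"
        unfolding r by (rule lin_on_sum[OF inner_on_lin1[OF gO[OF x0(1)] w] VN]) (use H(1)[OF x0(1)] in auto)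
      then show ?thesis using a(2)[OF _ w] by (simp add: inner_sum_left)
    qed
    then show ?thesis using a(1) by (intro bexI[of _ "\<Sum>z\<in>(\<lambda>i. H i x0) ` {..<m}. r z *\<^sub>R a z"])
      (auto intro!: span_sum span_scale)
  qed
  have ind: "X i x0 \<notin> span ((\<lambda>j. X j x0) ` {..<i})" if i: "i < ?n" for i
  proof (cases "i < ?d")
    case True
    then have im: "(\<lambda>j. X j x0) ` {..<i} = (\<lambda>j. H j x0) ` {..<i}" by (intro image_cong) (auto simp: X_def)
    show ?thesis
    proof
      assume "X i x0 \<in> span ((\<lambda>j. X j x0) ` {..<i})"
      then have "H i x0 \<in> span ((\<lambda>j. H j x0) ` {..<i})" using im True by (simp add: X_def)
      then obtain a where a: "a \<in> span (e ` {..<i})" "\<And>w. w \<in> model N \<Longrightarrow> G x0 (H i x0) w = a \<bullet> D x0 w"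
        using Hspan by blast
      have "a \<in> model M" using a(1) span_mono[of "e ` {..<i}" "e ` {..<?d}"] e(2) True by fastforce
      then have "e i - a \<in> model M" using e(1)[OF True] VM by (simp add: subspace_diff)
      then obtain w where w: "w \<in> horizontal N M \<pi> u" "e i - a = dmap N M \<pi> u w"
        using bij_betw_imp_surj_on[OF dmap_bij[OF u]] by blast
      have "(e i - a) \<bullet> D x0 w = 0"
        using a(2)[OF horizontal_in[OF w(1)]] H(2)[OF x0(1) horizontal_in[OF w(1)], of i]
        by (simp add: inner_diff_left)
      then have "(e i - a) \<bullet> (e i - a) = 0"
        using w(2) dmap_u[OF horizontal_in[OF w(1)]] by metis
      then have "e i = a" by simp
      then show False using a(1) e(3)[OF True] by simp
    qed
  next
    case False
    define k where "k = i - ?d"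
    have k: "k < ?n - ?d" "i = ?d + k" using False i by (auto simp: k_def)
    have im: "(\<lambda>j. X j x0) ` {..<i} \<subseteq> (\<lambda>j. H j x0) ` {..<?d} \<union> v ` {..<k}"
      using False k by (auto simp: X_def)
    show ?thesis
    proof
      assume "X i x0 \<in> span ((\<lambda>j. X j x0) ` {..<i})"
      then have "v k \<in> span ((\<lambda>j. H j x0) ` {..<?d} \<union> v ` {..<k})"
        using span_mono[OF im] False by (auto simp: X_def k_def)
      then obtain h w where hw: "h \<in> span ((\<lambda>j. H j x0) ` {..<?d})" "w \<in> span (v ` {..<k})" "v k = h + w"
        unfolding span_Un by auto
      have "span (v ` {..<k}) \<subseteq> ?K"
        using v(1) k by (intro span_minimal vertical_subspace) auto
      then have wK: "w \<in> ?K" using hw by auto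
      have "h = v k - w" using hw by simp
      then have hK: "h \<in> ?K" using v(1)[OF k(1)] wK vertical_subspace by (simp add: subspace_diff)
      obtain a where "\<And>z. z \<in> model N \<Longrightarrow> G x0 h z = a \<bullet> D x0 z" using Hspan[OF hw(1)] by blast
      then have "G x0 h h = 0" using hK by (simp add: vertical_u)
      then have "h = 0" using inner_on_pos[OF gO[OF x0(1)]] hK vertical_in by fastforce
      then show False using hw v(2)[OF k(1)] by simp
    qed
  qed
  have "\<exists>W Y. openin (top_of_set (model N)) W \<and> W \<subseteq> Om \<and> x0 \<in> W \<and> (\<forall>i<?n. \<forall>x\<in>W. Y i x \<in> model N) \<and>
     (\<forall>i<?n. \<forall>k\<in>UNIV. Ck_on k (model N) W (Y i)) \<and> (\<forall>x\<in>W. onfam (G x) {..<?n} (\<lambda>i. Y i x)) \<and>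
     (\<forall>x\<in>W. \<forall>m\<le>?n. span ((\<lambda>i. Y i x) ` {..<m}) = span ((\<lambda>i. X i x) ` {..<m}))"
    by (rule gram_schmidt[OF Om_relopen x0(1)]) (use gO gC XV XC ind in auto)
  then obtain W1 Y where W1: "openin (top_of_set (model N)) W1" "W1 \<subseteq> Om" "x0 \<in> W1"
    and Y: "\<forall>i<?n. \<forall>x\<in>W1. Y i x \<in> model N" "\<forall>i<?n. \<forall>k\<in>UNIV. Ck_on k (model N) W1 (Y i)"
      "\<forall>x\<in>W1. onfam (G x) {..<?n} (\<lambda>i. Y i x)"
      "\<forall>x\<in>W1. \<forall>m\<le>?n. span ((\<lambda>i. Y i x) ` {..<m}) = span ((\<lambda>i. X i x) ` {..<m})"
    by (elim exE conjE) (rule that; assumption)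
  note YV = Y(1)[rule_format] and YC = Y(2)[rule_format, OF _ UNIV_I] and Yon = Y(3)[rule_format]
  have Ysp: "span ((\<lambda>i. Y i x) ` {..<?d}) = span ((\<lambda>i. H i x) ` {..<?d})" if "x \<in> W1" for x
  proof -
    have "(\<lambda>i. X i x) ` {..<?d} = (\<lambda>i. H i x) ` {..<?d}" by (intro image_cong) (auto simp: X_def)
    then show ?thesis using Y(4) that dn by auto
  qed
  have horiz: "G x (Y i x) w = 0" if "x \<in> W1" "i < ?d" "w \<in> model N" "D x w = 0" for x i w
  proof (rule lin_on_span_zero[OF VN, where l="\<lambda>z. G x z w"])
    have xO: "x \<in> Om" using that W1 by auto
    show "lin_on (model N) (\<lambda>z. G x z w)" by (rule inner_on_lin1[OF gO[OF xO] that(3)])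
    show "(\<lambda>i. H i x) ` {..<?d} \<subseteq> model N" using H(1)[OF xO] by auto
    show "G x s w = 0" if "s \<in> (\<lambda>i. H i x) ` {..<?d}" for s
      using that H(2)[OF xO \<open>w \<in> model N\<close>] \<open>D x w = 0\<close> by auto
    show "Y i x \<in> span ((\<lambda>i. H i x) ` {..<?d})"
      using Ysp[OF that(1)] that(2) by (auto intro: span_base)
  qed
  \<comment> \<open>Orthogonality to all \<open>H j x\<close> means that \<open>D x (Y i x)\<close>
    has zero product with every \<open>e j\<close>. The \<open>e j\<close> span the model of
    \<open>M\<close>, which contains this vector.\<close>
  have vert: "D x (Y i x) = 0" if "x \<in> W1" "?d \<le> i" "i < ?n" for x i
  proof -
    have xO: "x \<in> Om" using that W1 by auto
    have Yi: "Y i x \<in> model N" by (rule YV[OF that(3,1)])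
    have "G x (H j x) (Y i x) = 0" if j: "j < ?d" for j
    proof (rule lin_on_span_zero[OF VN, where l="\<lambda>z. G x z (Y i x)"])
      show "lin_on (model N) (\<lambda>z. G x z (Y i x))" by (rule inner_on_lin1[OF gO[OF xO] Yi])
      show "(\<lambda>i. Y i x) ` {..<?d} \<subseteq> model N" using YV \<open>x \<in> W1\<close> dn by auto
      show "G x s (Y i x) = 0" if "s \<in> (\<lambda>i. Y i x) ` {..<?d}" for s
        using that Yon[OF \<open>x \<in> W1\<close>] \<open>?d \<le> i\<close> \<open>i < ?n\<close> by (auto simp: onfam_def)
      show "H j x \<in> span ((\<lambda>i. Y i x) ` {..<?d})"
        using Ysp[OF \<open>x \<in> W1\<close>] j by (auto intro: span_base)
    qed
    then have z: "e j \<bullet> D x (Y i x) = 0" if "j < ?d" for j using H(2)[OF xO Yi] that by simp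
    have "lin_on (model M) (\<lambda>z. z \<bullet> D x (Y i x))" by (simp add: lin_on_def inner_add_left)
    then have "D x (Y i x) \<bullet> D x (Y i x) = 0"
      by (rule lin_on_span_zero[OF VM, of _ "e ` {..<?d}"]) (use e z D_in[OF xO Yi] in auto)
    then show ?thesis by simp
  qed
  define W where "W = {q \<in> fst cN. snd cN q \<in> W1}"
  have oW: "openin (mtop N) W" unfolding W_def by (rule chart_preimage_open[OF smN cN(1) W1(1)])
  have WcN: "W \<subseteq> fst cN" by (auto simp: W_def)
  have uW: "u \<in> W" using cN W1 by (simp add: W_def x0_def)
  have imW: "snd cN ` W \<subseteq> W1" by (auto simp: W_def)
  \<comment> \<open>Membership in \<open>Om\<close> only provides some point with the given
    coordinates; injectivity of the chart identifies it with \<open>q\<close>.\<close>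
  have Wpi: "\<pi> q \<in> fst cM" if "q \<in> W" for q
  proof -
    have "snd cN q \<in> Om" using that W1 by (auto simp: W_def)
    then obtain q' where "q' \<in> fst cN" "\<pi> q' \<in> fst cM" "snd cN q = snd cN q'" by (auto simp: Om_def)
    then show ?thesis using inj_onD[OF chart_inj[OF smN cN(1)]] WcN that by auto
  qed
  define Z where "Z i q = tvec N cN q (Y i (snd cN q))" for i q
  have Zvf: "smooth_vf N W (Z i)" if "i < ?n" for i
    unfolding Z_def
    by (rule smooth_vf_from_chart[OF smN cN(1) oW WcN Ck_on_subset[OF YC[OF that] imW]])
      (use YV[OF that] imW in auto)
  have Zon: "metric N q (Z i q) (Z j q) = (if i = j then 1 else 0)" if "q \<in> W" "i < ?n" "j < ?n" for q i j
    using Yon[of "snd cN q"] that gcomp_at[OF smN cN(1), of q] by (auto simp: Z_def W_def onfam_def)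
  have Zh: "Z i q \<in> horizontal N M \<pi> q" if q: "q \<in> W" and i: "i < ?d" for q i
    unfolding horizontal_def
  proof (intro CollectI conjI ballI)
    have qN: "q \<in> fst cN" using q WcN by auto
    have in': "i < ?n" using i dn by simp
    show "Z i q \<in> model N" using Zvf[OF in'] q by (simp add: smooth_vf_def)
    fix w assume w: "w \<in> vertical N M \<pi> q"
    have wm: "w \<in> model N" by (rule vertical_in[OF w])
    let ?w = "comps N cN q w"
    have wm': "?w \<in> model N" by (rule comps_in[OF smN cN(1) qN wm])
    have xO: "snd cN q \<in> Om" using q W1 by (auto simp: W_def)
    have "tvec M cM (\<pi> q) (D (snd cN q) ?w) = 0"
      using w dmap_eq[OF qN Wpi[OF q] wm] by (simp add: vertical_def)
    then have "D (snd cN q) ?w = comps M cM (\<pi> q) 0"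
      using comps_tvec[OF smM cM(1) Wpi[OF q] D_in[OF xO wm']] by simp
    then have "D (snd cN q) ?w = 0" using lin_on_zero[OF comps_lin[OF smM cM(1) Wpi[OF q]] VM] by simp
    then have "G (snd cN q) (Y i (snd cN q)) ?w = 0"
      using horiz[OF _ i wm'] q by (simp add: W_def)
    then show "metric N q (Z i q) w = 0"
      using gcomp_at[OF smN cN(1) qN] tvec_comps[OF smN cN(1) qN wm] by (simp add: Z_def)
  qed
  have Zv: "Z i q \<in> vertical N M \<pi> q" if q: "q \<in> W" and i: "?d \<le> i" "i < ?n" for q i
  proof -
    have qN: "q \<in> fst cN" using q WcN by auto
    have qW1: "snd cN q \<in> W1" using q by (simp add: W_def)
    have m: "Z i q \<in> model N" using Zvf[OF i(2)] q by (simp add: smooth_vf_def)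
    have "comps N cN q (Z i q) = Y i (snd cN q)"
      unfolding Z_def by (rule comps_tvec[OF smN cN(1) qN YV[OF i(2) qW1]])
    then have "dmap N M \<pi> q (Z i q) = tvec M cM (\<pi> q) 0"
      using dmap_eq[OF qN Wpi[OF q] m] vert[OF qW1 i] by simp
    then show ?thesis using m lin_on_zero[OF tvec_lin[OF smM cM(1) Wpi[OF q]] VM] by (simp add: vertical_def)
  qed
  have "adapted_frame N M \<pi> W Z (\<lambda>j. Z (?d + j))"
    unfolding adapted_frame_def using Zvf Zon Zh Zv dn by auto
  then show ?thesis using oW uW by blast
qed

lemma horizontal_laplacian_lift:
  assumes VI: "\<And>v. v \<in> vertical N M \<pi> u \<Longrightarrow> D2 v v = D x0 (\<Gamma> v v)"
    and f: "smooth_fun M (points M) f"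
  shows "horizontal_laplacian N M \<pi> (f \<circ> \<pi>) u = laplace_beltrami M f (\<pi> u)"
  unfolding horizontal_laplacian_def
proof (rule the_equality)
  show "\<forall>W E F. openin (mtop N) W \<and> u \<in> W \<and> adapted_frame N M \<pi> W E F \<longrightarrow>
        laplace_beltrami M f (\<pi> u) = hlap_in_frame N M \<pi> E F (f \<circ> \<pi>) u"
    using hlap_in_frame_eq[OF f VI] by metis
  fix r assume r: "\<forall>W E F. openin (mtop N) W \<and> u \<in> W \<and> adapted_frame N M \<pi> W E F \<longrightarrow>
        r = hlap_in_frame N M \<pi> E F (f \<circ> \<pi>) u"
  obtain W E F where "openin (mtop N) W" "u \<in> W" "adapted_frame N M \<pi> W E F"
    using adapted_frame_exists by blast
  then show "r = laplace_beltrami M f (\<pi> u)" using r hlap_in_frame_eq[OF f VI] by metis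
qed

end

section \<open>Level sets of submersions and ordinary differential equations\<close>

lemma has_derivative_line:
  assumes "(g has_derivative g') (at y)"
  shows "((\<lambda>t::real. g (y + t *\<^sub>R v)) has_vector_derivative g' v) (at 0)"
proof -
  have "((\<lambda>t::real. y + t *\<^sub>R v) has_vector_derivative v) (at 0)" by (auto intro!: derivative_eq_intros)
  moreover have "(g has_derivative g') (at (y + 0 *\<^sub>R v))" using assms by simp
  ultimately have "((g \<circ> (\<lambda>t::real. y + t *\<^sub>R v)) has_vector_derivative g' v) (at 0)"
    by (intro vector_derivative_diff_chain_within) (auto intro: has_derivative_at_withinI)
  then show ?thesis by (simp add: o_def)
qed

text \<open>A bootstrap: \<open>g' y v\<close> solves the linear equation
  \<open>dird f (g y) (g' y v) = v\<close>. If \<open>g\<close> has degree \<open>k\<close>, then so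
  do the coefficients and hence the solution, which raises the degree of \<open>g\<close> by
  one.\<close>

lemma inverse_Ck:
  fixes f g :: "'e::euclidean_space \<Rightarrow> 'e"
  assumes U: "open U" and W: "open W" and f: "\<And>k. Ck_on k UNIV U f"
    and gU: "\<And>y. y \<in> W \<Longrightarrow> g y \<in> U" and fg: "\<And>y. y \<in> W \<Longrightarrow> f (g y) = y"
    and dg: "\<And>y. y \<in> W \<Longrightarrow> (g has_derivative g' y) (at y)"
  shows "Ck_on k UNIV W g"
proof (induction k)
  have "continuous_on W g"
    by (rule has_derivative_continuous_on[of W g g']) (use dg has_derivative_at_withinI in blast)
  then show "Ck_on 0 UNIV W g" by simp
next
  fix k assume IH: "Ck_on k UNIV W g"
  have ro: "relopen UNIV W" and ro': "relopen UNIV U" using U W by auto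
  have dline: "((\<lambda>t. g (y + t *\<^sub>R v)) has_vector_derivative g' y v) (at 0)" if "y \<in> W" for y v
    by (rule has_derivative_line[OF dg[OF that]])
  have dgv: "dird g y v = g' y v" if "y \<in> W" for y v by (rule dird_eqI[OF dline[OF that]])
  have lin: "lin_on UNIV (dird f (g y))" if "y \<in> W" for y
    by (rule lin_on_dird[OF ro' f[of "Suc 0"] gU[OF that]])
  then have linear: "linear (dird f (g y))" if "y \<in> W" for y
    using that lin_on_add[OF lin[OF that]] lin_on_scale[OF lin[OF that]] by (intro linearI) auto
  have chain: "dird f (g y) (g' y v) = v" if y: "y \<in> W" for y v
  proof -
    have "((\<lambda>t. f (g (y + t *\<^sub>R v))) has_vector_derivative dird f (g (y + 0 *\<^sub>R v)) (g' y v)) (at 0)"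
      by (rule curve_chain[OF ro' f[of "Suc 0"] dline[OF y]]) (use gU y in auto)
    moreover have "((\<lambda>t. f (g (y + t *\<^sub>R v))) has_vector_derivative v) (at 0)"
    proof -
      have "\<forall>\<^sub>F t in nhds 0. t \<in> UNIV \<longrightarrow> f (g (y + t *\<^sub>R v)) = y + t *\<^sub>R v"
        using relopen_eventually_line[OF ro y UNIV_I] by (rule eventually_mono) (use fg in auto)
      moreover have "((\<lambda>t. y + t *\<^sub>R v) has_vector_derivative v) (at 0)" by (auto intro!: derivative_eq_intros)
      ultimately show ?thesis using fg[OF y] by (subst has_vector_derivative_cong_ev) auto
    qed
    ultimately show ?thesis using vector_derivative_unique_at by fastforce
  qed
  have inj: "inj (dird f (g y))" if y: "y \<in> W" for y
    by (rule linear_surj_imp_inj[OF linear[OF y]]) (use chain[OF y] in \<open>metis surjI\<close>)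
  \<comment> \<open>The normal equations: the Euclidean inner product pulled back by the injective
    map \<open>dird f (g y)\<close> is positive definite, which brings the system into the form
    treated by \<open>Ck_on_solve\<close>.\<close>
  define h where "h y a b = dird f (g y) a \<bullet> dird f (g y) b" for y a b
  have "Ck_on k UNIV W (\<lambda>y. g' y v)" for v
  proof (rule Ck_on_solve[OF ro, where g=h and l="\<lambda>y b. v \<bullet> dird f (g y) b"])
    show "inner_on UNIV (h y)" if y: "y \<in> W" for y
    proof -
      have "dird f (g y) v \<noteq> 0" if "v \<noteq> 0" for v
        using inj[OF y] that linear_0[OF linear[OF y]] by (metis injD)
      then show ?thesis
        unfolding inner_on_def lin_on_def h_def
        using lin_onD[OF lin[OF y]] by (auto simp: inner_add_left inner_add_right inner_commute)
    qed
    have c: "Ck_on k UNIV W (\<lambda>y. dird f (g y) a)" for a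
      by (rule Ck_on_compose[OF ro ro' _ IH Ck_on_dird[OF f]]) (use gU in auto)
    show "Ck_on k UNIV W (\<lambda>y. h y a b)" for a b
      unfolding h_def by (intro Ck_on_inner ro c)
    show "lin_on UNIV (\<lambda>b. v \<bullet> dird f (g y) b)" if "y \<in> W" for y
      using lin_onD[OF lin[OF that]] by (simp add: lin_on_def inner_add_right)
    show "Ck_on k UNIV W (\<lambda>y. v \<bullet> dird f (g y) b)" for b
      by (intro Ck_on_inner Ck_on_const ro c)
    show "h y (g' y v) w = v \<bullet> dird f (g y) w" if "y \<in> W" for y w
      using chain[OF that] by (simp add: h_def)
  qed auto
  then have "Ck_on k UNIV W (\<lambda>y. dird g y v)" for v
    by (rule Ck_on_cong[OF ro, rotated]) (simp add: dgv)
  then show "Ck_on (Suc k) UNIV W g"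
    using Ck_on_continuous[OF IH] dline by (auto intro: differentiableI_vector)
qed

lemma oproj_subspace_compose:
  assumes "subspace V" "subspace K" "K \<subseteq> V"
  shows "oproj K (oproj V x) = oproj K x"
  unfolding oproj_def[of K]
proof (intro sum.cong refl)
  fix b assume "b \<in> onb K"
  then have "b \<in> V" using onb_props(1)[OF assms(2)] assms(3) by auto
  then show "(oproj V x \<bullet> b) *\<^sub>R b = (x \<bullet> b) *\<^sub>R b"
    using oproj_orth[OF assms(1), of b x] by (simp add: inner_diff_left)
qed

text \<open>A level set of a submersion is mapped onto an open piece of the kernel of the
  differential. The chart \<open>\<kappa>\<close> is the restriction of a linear map and
  \<open>\<iota>\<close> is its smooth inverse. The kernel is replaced by an arbitrary subspace
  \<open>L\<close> of the same dimension because all charts of a fiber must share one model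
  space.\<close>

lemma straighten:
  fixes V L :: "'f::euclidean_space set" and V' :: "'e::euclidean_space set" and \<phi> :: "'f \<Rightarrow> 'e"
  assumes ro: "relopen V U" and V': "subspace V'" and \<phi>: "\<And>k. Ck_on k V U \<phi>" and \<phi>V: "\<And>x. x \<in> U \<Longrightarrow> \<phi> x \<in> V'"
    and x0: "x0 \<in> U" and onto: "dird \<phi> x0 ` V = V'"
    and L: "subspace L" and dL: "dim L = dim {v \<in> V. dird \<phi> x0 v = 0}"
  shows "\<exists>\<kappa> \<iota> U1 O'. bounded_linear \<kappa> \<and> openin (top_of_set V) U1 \<and> x0 \<in> U1 \<and> U1 \<subseteq> U \<and>
    openin (top_of_set L) O' \<and> (\<forall>k. Ck_on k L O' \<iota>) \<and>
    (\<forall>a\<in>O'. \<iota> a \<in> U1 \<and> \<phi> (\<iota> a) = \<phi> x0 \<and> \<kappa> (\<iota> a) = a) \<and>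
    (\<forall>x\<in>U1. \<phi> x = \<phi> x0 \<longrightarrow> \<kappa> x \<in> O' \<and> \<iota> (\<kappa> x) = x)"
proof -
  have V: "subspace V" using ro by simp
  let ?D = "dird \<phi> x0"
  have Dlin: "lin_on V ?D" by (rule lin_on_dird[OF ro \<phi>[of "Suc 0"] x0])
  define K where "K = {v \<in> V. ?D v = 0}"
  have K: "subspace K" unfolding K_def by (rule lin_on_kernel_subspace[OF V Dlin])
  have KV: "K \<subseteq> V" by (auto simp: K_def)
  let ?P = "oproj V" and ?Q = "oproj K"
  note Pin = oproj_in[OF V] and Qin = oproj_in[OF K]
  have QV: "?Q x \<in> V" for x using Qin KV by auto
  let ?L0 = "\<lambda>v. ?D (?P v)"
  have L0: "linear ?L0" by (rule linear_oproj_extension[OF V Dlin])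
  obtain g0 where g0: "range g0 \<subseteq> V" "linear g0" "\<And>w. w \<in> ?L0 ` V \<Longrightarrow> ?L0 (g0 w) = w"
    using linear_exists_right_inverse_on[OF L0 V] by blast
  have L0V: "?L0 ` V = V'"
  proof -
    have "?L0 ` V = ?D ` V" by (intro image_cong refl) (simp add: oproj_id[OF V])
    then show ?thesis using onto by simp
  qed
  have g0V: "g0 w \<in> V" for w using g0(1) by auto
  have Dg0: "?D (g0 w) = w" if "w \<in> V'" for w
    using g0(3)[of w] that by (simp add: L0V oproj_id[OF V g0V])
  \<comment> \<open>The right inverse of \<open>?D\<close> with values orthogonal to
    \<open>K\<close>; then \<open>s \<circ> ?D\<close> is \<open>v - ?Q v\<close> on
    \<open>V\<close>.\<close>
  define s where "s w = g0 w - ?Q (g0 w)" for w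
  have s_lin: "linear s"
    unfolding s_def using g0(2) linear_compose[OF g0(2) linear_oproj[of K]] by (intro linear_compose_sub) (auto simp: o_def)
  have sV: "s w \<in> V" for w unfolding s_def using g0V QV V by (simp add: subspace_diff)
  have Ds: "?D (s w) = w" if "w \<in> V'" for w
    unfolding s_def using lin_on_diff[OF Dlin g0V QV] Dg0[OF that] Qin by (simp add: K_def)
  have sD: "s (?D v) = v - ?Q v" if v: "v \<in> V" for v
  proof -
    have Dv: "?D v \<in> V'" using onto v by auto
    have kV: "g0 (?D v) - v \<in> V" using g0V v V by (simp add: subspace_diff)
    have "?D (g0 (?D v) - v) = 0" using lin_on_diff[OF Dlin g0V v] Dg0[OF Dv] by simp
    then have "g0 (?D v) - v \<in> K" using kV by (simp add: K_def)
    then have "?Q (g0 (?D v) - v) = g0 (?D v) - v" by (rule oproj_id[OF K])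
    then have "?Q (g0 (?D v)) - ?Q v = g0 (?D v) - v" by (simp add: linear_diff[OF linear_oproj])
    then show ?thesis by (simp add: s_def algebra_simps)
  qed
  have dLK: "dim L = dim K" using dL by (simp add: K_def)
  obtain f2 g2 where fg: "linear f2" "linear g2" "f2 ` L = K" "g2 ` K = L"
    "\<And>x. x \<in> L \<Longrightarrow> norm (f2 x) = norm x" "\<And>x. x \<in> K \<Longrightarrow> norm (g2 x) = norm x"
    "\<And>x. x \<in> L \<Longrightarrow> g2 (f2 x) = x" "\<And>x. x \<in> K \<Longrightarrow> f2 (g2 x) = x"
    by (rule isometries_subspaces[OF L K dLK]) blast
  define \<kappa> where "\<kappa> x = g2 (?Q x)" for x
  have \<kappa>: "bounded_linear \<kappa>"
    unfolding \<kappa>_def using linear_compose[OF linear_oproj[of K] fg(2)] by (simp add: o_def linear_conv_bounded_linear)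
  define Ut where "Ut = ?P -` U"
  have oUt: "open Ut"
  proof -
    obtain T where T: "open T" "U = V \<inter> T" using ro by (auto simp: openin_open)
    have "Ut = ?P -` T" using T Pin by (auto simp: Ut_def)
    then show ?thesis
      using continuous_open_vimage[OF T(1)] linear_continuous_at[OF bounded_linear_oproj[of V]] by auto
  qed
  \<comment> \<open>On \<open>V\<close> the value of \<phi> and the projection to \<open>K\<close>
    serve as new coordinates. The summand \<open>y - ?P y\<close> fills the directions orthogonal to
    \<open>V\<close>, so that the inverse function theorem can be applied in the full Euclidean
    space.\<close>
  define \<psi> where "\<psi> y = s (\<phi> (?P y)) + ?Q y + (y - ?P y)" for y
  have roUt: "relopen UNIV Ut" using oUt by simp
  have bls: "bounded_linear s" using s_lin by (simp add: linear_conv_bounded_linear)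
  have \<phi>P: "Ck_on k UNIV Ut (\<lambda>y. \<phi> (?P y))" for k
    by (rule Ck_on_compose[OF roUt ro _ Ck_on_linear[OF roUt bounded_linear_oproj] \<phi>]) (auto simp: Ut_def)
  have \<psi>Ck: "Ck_on k UNIV Ut \<psi>" for k
    unfolding \<psi>_def
    by (intro Ck_on_add Ck_on_diff Ck_on_bounded_linear[OF roUt bls] \<phi>P Ck_on_linear[OF roUt bounded_linear_oproj] Ck_on_ident roUt)
  let ?f' = "\<lambda>y h. s (\<Sum>b\<in>onb V. (h \<bullet> b) *\<^sub>R dird \<phi> (?P y) b) + ?Q h + (h - ?P h)"
  have bl: "bounded_linear (?f' y)" for y
    by (intro bounded_linear_add bounded_linear_sub bounded_linear_oproj bounded_linear_ident
        bounded_linear_compose[OF bls] bounded_linear_sum bounded_linear_scaleR_const bounded_linear_inner_left)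
  have der: "(\<psi> has_derivative ?f' y) (at y)" if y: "y \<in> Ut" for y
  proof -
    have Py: "?P y \<in> U" using y by (simp add: Ut_def)
    have "((\<lambda>y. \<phi> (?P (?P y))) has_derivative (\<lambda>h. \<Sum>b\<in>onb V. (?P h \<bullet> b) *\<^sub>R dird \<phi> (?P y) b)) (at y)"
      using has_derivative_compose[OF bounded_linear_imp_has_derivative[OF bounded_linear_oproj[of V]] Ck1_frechet[OF ro \<phi>[of "Suc 0"] Py]] .
    moreover have "?P h \<bullet> b = h \<bullet> b" if "b \<in> onb V" for h b by (rule inner_oproj_onb[OF V that])
    ultimately have "((\<lambda>y. \<phi> (?P y)) has_derivative (\<lambda>h. \<Sum>b\<in>onb V. (h \<bullet> b) *\<^sub>R dird \<phi> (?P y) b)) (at y)"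
      by (simp add: oproj_id[OF V Pin])
    then show ?thesis
      unfolding \<psi>_def
      by (intro has_derivative_add has_derivative_diff has_derivative_ident
          bounded_linear_imp_has_derivative[OF bounded_linear_oproj] bounded_linear.has_derivative[OF bls])
  qed
  define F' where "F' y = Blinfun (?f' y)" for y
  have F': "blinfun_apply (F' y) = ?f' y" for y unfolding F'_def by (rule bounded_linear_Blinfun_apply[OF bl])
  \<comment> \<open>Continuity of the derivative in operator norm, checked on basis vectors.\<close>
  have cF: "continuous_on Ut F'"
  proof (rule continuous_on_blinfun_componentwise)
    fix i :: 'f assume "i \<in> Basis"
    have "continuous_on Ut (\<lambda>y. dird \<phi> (?P y) b)" if "b \<in> onb V" for b
    proof (rule continuous_on_compose2[of U "\<lambda>x. dird \<phi> x b" Ut ?P])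
      show "continuous_on U (\<lambda>x. dird \<phi> x b)"
        using Ck_on_continuous[OF Ck_on_dird[OF \<phi>[of "Suc 0"]]] onb_props(1)[OF V] that by blast
      show "continuous_on Ut ?P" by (rule linear_continuous_on[OF bounded_linear_oproj])
    qed (auto simp: Ut_def)
    then show "continuous_on Ut (\<lambda>y. blinfun_apply (F' y) i)"
      unfolding F' by (intro continuous_intros bounded_linear.continuous_on[OF bls]) auto
  qed
  have x0V: "x0 \<in> V" using x0 relopen_subset[OF ro] by auto
  have x0Ut: "x0 \<in> Ut" using x0 oproj_id[OF V x0V] by (simp add: Ut_def)
  have "?f' x0 h = h" for h
  proof -
    have "(\<Sum>b\<in>onb V. (h \<bullet> b) *\<^sub>R dird \<phi> (?P x0) b) = ?D (?P h)"
      using lin_on_expand[OF V Dlin Pin, of h] by (simp add: oproj_id[OF V x0V] inner_oproj_onb[OF V])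
    then show ?thesis using sD[OF Pin, of h] oproj_subspace_compose[OF V K KV] by simp
  qed
  \<comment> \<open>By the choice of \<open>s\<close> the derivative of \<open>\<psi>\<close> at
    \<open>x0\<close> is the identity, and so it is its own inverse.\<close>
  then have id: "id_blinfun o\<^sub>L F' x0 = id_blinfun" by (intro blinfun_eqI) (simp add: F')
  have der': "(\<psi> has_derivative blinfun_apply (F' y)) (at y)" if "y \<in> Ut" for y
    unfolding F' by (rule der[OF that])
  have "\<exists>U' Vv g g'. open U' \<and> U' \<subseteq> Ut \<and> x0 \<in> U' \<and> open Vv \<and> \<psi> x0 \<in> Vv \<and> homeomorphism U' Vv \<psi> g \<and>
    (\<forall>y\<in>Vv. (g has_derivative (g' y)) (at y))"
    apply (rule inverse_function_theorem[OF oUt der' cF x0Ut id])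
     apply assumption
    subgoal for U' W g g'
      by (rule exI[of _ U'], rule exI[of _ W], rule exI[of _ g], rule exI[of _ g']) simp
    done
  then obtain U' Vv g g' where IFT: "open U'" "U' \<subseteq> Ut" "x0 \<in> U'" "open Vv" "\<psi> x0 \<in> Vv" "homeomorphism U' Vv \<psi> g"
    "\<forall>y\<in>Vv. (g has_derivative (g' y)) (at y)"
    by (elim exE conjE) (rule that; assumption)
  have gU: "g y \<in> U'" and \<psi>g: "\<psi> (g y) = y" if "y \<in> Vv" for y
    using IFT(6) that by (auto simp: homeomorphism_def)
  have g\<psi>: "\<psi> x \<in> Vv" "g (\<psi> x) = x" if "x \<in> U'" for x
    using IFT(6) that by (auto simp: homeomorphism_def)
  have gCk: "Ck_on k UNIV Vv g" for k
    by (rule inverse_Ck[OF IFT(1,4) Ck_on_subset[OF \<psi>Ck IFT(2)] gU \<psi>g IFT(7)[rule_format]])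
  let ?w0 = "\<phi> x0"
  define U1 where "U1 = V \<inter> U'"
  define O' where "O' = {a \<in> L. s ?w0 + f2 a \<in> Vv}"
  define \<iota> where "\<iota> a = g (s ?w0 + f2 a)" for a
  have blf: "bounded_linear f2" using fg(1) by (simp add: linear_conv_bounded_linear)
  have O'o: "openin (top_of_set L) O'"
  proof -
    have "open ((\<lambda>a. s ?w0 + f2 a) -` Vv)"
      by (rule continuous_open_vimage[OF IFT(4)]) (intro continuous_intros linear_continuous_at blf)
    moreover have "O' = L \<inter> (\<lambda>a. s ?w0 + f2 a) -` Vv" by (auto simp: O'_def)
    ultimately show ?thesis by (auto simp: openin_open)
  qed
  have roO: "relopen L O'" using L O'o by simp
  have \<iota>Ck: "Ck_on k L O' \<iota>" for k
    unfolding \<iota>_def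
  proof (rule Ck_on_compose[OF roO _ _ _ gCk])
    show "relopen UNIV Vv" using IFT(4) by simp
    show "Ck_on k L O' (\<lambda>a. s ?w0 + f2 a)"
      by (intro Ck_on_add[OF roO] Ck_on_const Ck_on_linear[OF roO] blf)
  qed (auto simp: O'_def)
  have f2K: "f2 a \<in> K" if "a \<in> L" for a using fg(3) that by auto
  have U1U: "U1 \<subseteq> U" using IFT(2) oproj_id[OF V] by (auto simp: U1_def Ut_def)
  have one: "\<iota> a \<in> U1 \<and> \<phi> (\<iota> a) = ?w0 \<and> \<kappa> (\<iota> a) = a" if a: "a \<in> O'" for a
  proof -
    have aL: "a \<in> L" and aV: "s ?w0 + f2 a \<in> Vv" using a by (auto simp: O'_def)
    define x where "x = \<iota> a"
    have xU': "x \<in> U'" and \<psi>x: "\<psi> x = s ?w0 + f2 a" using gU[OF aV] \<psi>g[OF aV] by (auto simp: x_def \<iota>_def)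
    have f2V: "f2 a \<in> V" using f2K[OF aL] KV by auto
    \<comment> \<open>The equation for \<open>\<psi> x\<close> expresses \<open>x - ?P x\<close> by
      vectors of \<open>V\<close>. Being also orthogonal to \<open>V\<close>, it vanishes, so the
      inverse map does not leave \<open>V\<close>.\<close>
    have "x - ?P x = s ?w0 + f2 a - s (\<phi> (?P x)) - ?Q x" using \<psi>x by (simp add: \<psi>_def algebra_simps)
    also have "\<dots> \<in> V" using sV f2V QV V by (intro subspace_diff subspace_add) auto
    finally have "(x - ?P x) \<bullet> (x - ?P x) = 0" by (rule oproj_orth[OF V])
    then have Px: "?P x = x" by simp
    then have xV: "x \<in> V" using Pin[of x] by simp
    then have xU1: "x \<in> U1" using xU' by (simp add: U1_def)
    then have xU: "x \<in> U" using U1U by auto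
    have e: "s (\<phi> x) + ?Q x = s ?w0 + f2 a" using \<psi>x Px by (simp add: \<psi>_def)
    \<comment> \<open>Applying \<open>?D\<close> removes the components in \<open>K\<close> and
      leaves the values of \<phi>.\<close>
    have "?D (s (\<phi> x) + ?Q x) = \<phi> x"
      using lin_on_add[OF Dlin sV QV] Ds[OF \<phi>V[OF xU]] Qin[of x] by (simp add: K_def)
    moreover have "?D (s ?w0 + f2 a) = ?w0"
      using lin_on_add[OF Dlin sV f2V] Ds[OF \<phi>V[OF x0]] f2K[OF aL] by (simp add: K_def)
    ultimately have \<phi>x: "\<phi> x = ?w0" using e by simp
    then have "?Q x = f2 a" using e by simp
    then have "\<kappa> x = a" using fg(7)[OF aL] by (simp add: \<kappa>_def)
    then show ?thesis using xU1 \<phi>x by (simp add: x_def)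
  qed
  have two: "\<kappa> x \<in> O' \<and> \<iota> (\<kappa> x) = x" if x: "x \<in> U1" "\<phi> x = ?w0" for x
  proof -
    have xV: "x \<in> V" and xU': "x \<in> U'" using x by (auto simp: U1_def)
    have "\<kappa> x \<in> L" using fg(4) Qin by (auto simp: \<kappa>_def)
    moreover have "\<psi> x = s ?w0 + f2 (\<kappa> x)"
      using x(2) oproj_id[OF V xV] fg(8)[OF Qin] by (simp add: \<psi>_def \<kappa>_def)
    ultimately show ?thesis using g\<psi>[OF xU'] by (simp add: O'_def \<iota>_def)
  qed
  have "openin (top_of_set V) U1" using IFT(1) by (auto simp: U1_def openin_open)
  moreover have "x0 \<in> U1" using x0V IFT(3) by (simp add: U1_def)
  ultimately show ?thesis using \<kappa> U1U O'o \<iota>Ck one two by blast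
qed

text \<open>Picard iteration as a fixed point in the complete space of bounded continuous functions
  on the whole line. Time is clamped to \<open>[-\<epsilon>, \<epsilon>]\<close> by
  \<open>cl\<close> to make the operator act on that space. Integrals start at
  \<open>-\<epsilon>\<close>, and \<open>I z 0\<close> is subtracted to put the initial time at
  0.\<close>

lemma ode_exists_global:
  fixes \<Phi> :: "'z::euclidean_space \<Rightarrow> 'z"
  assumes K: "K \<ge> 0" and lip: "\<And>x y. norm (\<Phi> x - \<Phi> y) \<le> K * norm (x - y)"
    and e: "\<epsilon> > 0" "3 * \<epsilon> * K \<le> 1 / 2"
  shows "\<exists>z. z 0 = z0 \<and> (\<forall>t\<in>{-\<epsilon><..<\<epsilon>}. (z has_vector_derivative \<Phi> (z t)) (at t))"
proof -
  have cPhi: "continuous_on S \<Phi>" for S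
    by (rule lipschitz_on_continuous_on[of K], rule lipschitz_onI) (use lip K in \<open>auto simp: dist_norm\<close>)
  define cl where "cl t = max (-\<epsilon>) (min \<epsilon> t)" for t :: real
  have cl: "cl t \<in> {-\<epsilon>..\<epsilon>}" for t using e by (auto simp: cl_def)
  have cl_id: "cl t = t" if "t \<in> {-\<epsilon>..\<epsilon>}" for t using that by (auto simp: cl_def)
  have ccl: "continuous_on UNIV cl" unfolding cl_def by (intro continuous_intros)
  define I where "I z t = integral {-\<epsilon>..t} (\<lambda>s. \<Phi> (apply_bcontfun z s))" for z :: "real \<Rightarrow>\<^sub>C 'z" and t
  have cz: "continuous_on S (\<lambda>s. \<Phi> (apply_bcontfun z s))" for z S
    by (rule continuous_on_compose2[OF cPhi[of UNIV]]) auto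
  define T where "T z t = z0 + I z (cl t) - I z 0" for z t
  have cI: "continuous_on {-\<epsilon>..\<epsilon>} (I z)" for z
    unfolding I_def by (rule indefinite_integral_continuous_1[OF integrable_continuous_real[OF cz]])
  have cT: "continuous_on UNIV (T z)" for z
    unfolding T_def by (intro continuous_intros continuous_on_compose2[OF cI ccl]) (use cl in auto)
  have bT: "bounded (range (T z))" for z
  proof -
    have "range (T z) \<subseteq> (\<lambda>w. z0 + w - I z 0) ` (I z ` {-\<epsilon>..\<epsilon>})" using cl by (auto simp: T_def)
    moreover have "compact ((\<lambda>w. z0 + w - I z 0) ` (I z ` {-\<epsilon>..\<epsilon>}))"
      by (intro compact_continuous_image cI continuous_intros) auto
    ultimately show ?thesis using compact_imp_bounded bounded_subset by blast
  qed
  have Tb: "apply_bcontfun (Bcontfun (T z)) = T z" for z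
    using cT bT by (intro Bcontfun_inverse) (simp add: bcontfun_def)
  have Idiff: "integral {-\<epsilon>..t} (\<lambda>s. \<Phi> (apply_bcontfun z s) - \<Phi> (apply_bcontfun y s)) = I z t - I y t" for z y t
    unfolding I_def by (rule integral_diff[OF integrable_continuous_real[OF cz] integrable_continuous_real[OF cz]])
  have diff: "norm (I z t - I y t) \<le> 2 * \<epsilon> * (K * dist z y)" if t: "t \<in> {-\<epsilon>..\<epsilon>}" for z y t
  proof -
    have "norm (integral {-\<epsilon>..t} (\<lambda>s. \<Phi> (apply_bcontfun z s) - \<Phi> (apply_bcontfun y s))) \<le> (K * dist z y) * (t - (-\<epsilon>))"
    proof (rule integral_bound)
      show "- \<epsilon> \<le> t" using t by simp
      show "continuous_on {- \<epsilon>..t} (\<lambda>s. \<Phi> (apply_bcontfun z s) - \<Phi> (apply_bcontfun y s))"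
        by (intro continuous_on_diff cz)
      fix s
      have "norm (\<Phi> (apply_bcontfun z s) - \<Phi> (apply_bcontfun y s)) \<le> K * dist (apply_bcontfun z s) (apply_bcontfun y s)"
        using lip by (simp add: dist_norm)
      also have "\<dots> \<le> K * dist z y" using dist_bounded[of z s y] K by (simp add: mult_left_mono)
      finally show "norm (\<Phi> (apply_bcontfun z s) - \<Phi> (apply_bcontfun y s)) \<le> K * dist z y" .
    qed
    also have "\<dots> \<le> (K * dist z y) * (2 * \<epsilon>)" using t K by (intro mult_left_mono) auto
    finally show ?thesis
      using Idiff[of t z y] by (simp add: mult.commute mult.left_commute)
  qed
  have diff0: "norm (I z 0 - I y 0) \<le> \<epsilon> * (K * dist z y)" for z y
  proof -
    have "norm (integral {-\<epsilon>..0} (\<lambda>s. \<Phi> (apply_bcontfun z s) - \<Phi> (apply_bcontfun y s))) \<le> (K * dist z y) * (0 - (-\<epsilon>))"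
    proof (rule integral_bound)
      show "- \<epsilon> \<le> 0" using e by simp
      show "continuous_on {- \<epsilon>..0} (\<lambda>s. \<Phi> (apply_bcontfun z s) - \<Phi> (apply_bcontfun y s))"
        by (intro continuous_on_diff cz)
      fix s
      have "norm (\<Phi> (apply_bcontfun z s) - \<Phi> (apply_bcontfun y s)) \<le> K * dist (apply_bcontfun z s) (apply_bcontfun y s)"
        using lip by (simp add: dist_norm)
      also have "\<dots> \<le> K * dist z y" using dist_bounded[of z s y] K by (simp add: mult_left_mono)
      finally show "norm (\<Phi> (apply_bcontfun z s) - \<Phi> (apply_bcontfun y s)) \<le> K * dist z y" .
    qed
    then show ?thesis
      using Idiff[of 0 z y] by (simp add: mult.commute mult.left_commute)
  qed
  have "dist (Bcontfun (T z)) (Bcontfun (T y)) \<le> (1/2) * dist z y" for z y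
  proof (rule dist_bound)
    fix t
    \<comment> \<open>The integral up to \<open>cl t\<close> extends over a length of at most
      \<open>2 * \<epsilon>\<close> and the subtracted one over \<open>\<epsilon>\<close>, whence
      the factor 3 in the assumption on \<epsilon>.\<close>
    have "norm (T z t - T y t) \<le> norm (I z (cl t) - I y (cl t)) + norm (I z 0 - I y 0)"
      unfolding T_def using norm_triangle_ineq4[of "I z (cl t) - I y (cl t)" "I z 0 - I y 0"] by (simp add: algebra_simps)
    also have "\<dots> \<le> 2 * \<epsilon> * (K * dist z y) + \<epsilon> * (K * dist z y)"
      by (rule add_mono[OF diff[OF cl] diff0])
    also have "\<dots> = (3 * \<epsilon> * K) * dist z y" by (simp add: algebra_simps)
    also have "\<dots> \<le> (1/2) * dist z y" by (rule mult_right_mono[OF e(2)]) simp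
    finally show "dist (apply_bcontfun (Bcontfun (T z)) t) (apply_bcontfun (Bcontfun (T y)) t) \<le> (1/2) * dist z y"
      unfolding Tb by (simp add: dist_norm)
  qed
  then obtain z where z: "Bcontfun (T z) = z"
    using banach_fix_type[of "1/2" "\<lambda>z. Bcontfun (T z)"] by auto
  have zT: "apply_bcontfun z = T z" using Tb[of z] z by simp
  have zt: "apply_bcontfun z t = z0 + I z t - I z 0" if "t \<in> {-\<epsilon>..\<epsilon>}" for t
    using fun_cong[OF zT, of t] cl_id[OF that] by (simp add: T_def)
  show ?thesis
  proof (intro exI[of _ "apply_bcontfun z"] conjI ballI)
    show "apply_bcontfun z 0 = z0" using zt[of 0] e by simp
    fix t assume t: "t \<in> {-\<epsilon><..<\<epsilon>}"
    have "(I z has_vector_derivative \<Phi> (apply_bcontfun z t)) (at t within {-\<epsilon>..\<epsilon>})"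
      unfolding I_def by (rule integral_has_vector_derivative[OF cz]) (use t in auto)
    moreover have "at t within {-\<epsilon>..\<epsilon>} = at t"
      by (rule at_within_interior) (use t in auto)
    ultimately have "((\<lambda>t. z0 + I z t - I z 0) has_vector_derivative \<Phi> (apply_bcontfun z t)) (at t)"
      by (auto intro!: derivative_eq_intros)
    then show "(apply_bcontfun z has_vector_derivative \<Phi> (apply_bcontfun z t)) (at t)"
      by (rule has_vector_derivative_transform_within_open[of _ _ _ "{-\<epsilon><..<\<epsilon>}"]) (use t zt in auto)
  qed
qed

text \<open>Precomposition with the nearest point map of a closed ball \<open>C\<close> in
  \<open>S\<close> makes the field globally Lipschitz. For short times the solution has no time to
  leave \<open>C\<close>, where the modified field is the original one.\<close>

lemma ode_exists:
  fixes S :: "'z::euclidean_space set" and \<Phi> :: "'z \<Rightarrow> 'z"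
  assumes ro: "relopen S U" and \<Phi>: "Ck_on (Suc 0) S U \<Phi>" and \<Phi>S: "\<And>x. x \<in> U \<Longrightarrow> \<Phi> x \<in> S" and z0: "z0 \<in> U"
  shows "\<exists>\<epsilon>>0. \<exists>z. z 0 = z0 \<and> (\<forall>t\<in>{-\<epsilon><..<\<epsilon>}. z t \<in> U \<and> (z has_vector_derivative \<Phi> (z t)) (at t))"
proof -
  have S: "subspace S" using ro by simp
  let ?N = "\<lambda>x. \<Sum>b\<in>onb S. norm (dird \<Phi> x b)"
  have z0S: "z0 \<in> S" using z0 relopen_subset[OF ro] by auto
  obtain r0 where r0: "r0 > 0" "\<And>y. y \<in> S \<Longrightarrow> dist y z0 < r0 \<Longrightarrow> y \<in> U"
    using relopen_ball[OF ro z0] by blast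
  have c1: "continuous_on U ?N"
    using \<Phi> onb_props(1)[OF S] by (intro continuous_on_sum continuous_on_norm) auto
  have c0: "continuous_on U \<Phi>" by (rule Ck_on_continuous[OF \<Phi>])
  obtain d1 where d1: "d1 > 0" "\<And>y. y \<in> U \<Longrightarrow> dist y z0 < d1 \<Longrightarrow> dist (?N y) (?N z0) < 1"
    using c1[unfolded continuous_on_iff, rule_format, OF z0, of 1] by auto
  obtain d2 where d2: "d2 > 0" "\<And>y. y \<in> U \<Longrightarrow> dist y z0 < d2 \<Longrightarrow> dist (\<Phi> y) (\<Phi> z0) < 1"
    using c0[unfolded continuous_on_iff, rule_format, OF z0, of 1] by auto
  define r where "r = Min {r0, d1, d2} / 2"
  have r: "r > 0" "r < r0" "r < d1" "r < d2" using r0(1) d1(1) d2(1) by (auto simp: r_def min_def)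
  \<comment> \<open>On the ball the sum of the norms of the partial derivatives and the norm of the
    field exceed their values at \<open>z0\<close> by less than 1. Thus \<open>K\<close> is a
    Lipschitz constant and \<open>B\<close> a bound for the speed.\<close>
  define K where "K = ?N z0 + 1"
  define B where "B = norm (\<Phi> z0) + 1"
  have K0: "K \<ge> 0" and B0: "B > 0" using sum_nonneg[of "onb S" "\<lambda>b. norm (dird \<Phi> z0 b)"] by (auto simp: K_def B_def add_nonneg_pos)
  define C where "C = S \<inter> cball z0 r"
  have CU: "C \<subseteq> U" using r0(2) r by (auto simp: C_def dist_commute)
  have near: "dist y z0 < d1" "dist y z0 < d2" if "y \<in> C" for y using that r by (auto simp: C_def dist_commute)
  have Cx: "convex C" "closed C" "C \<noteq> {}" "z0 \<in> C"
    using S z0S r(1) by (auto simp: C_def subspace_imp_convex closed_subspace intro!: convex_Int closed_Int)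
  have lipC: "norm (\<Phi> x - \<Phi> y) \<le> K * norm (x - y)" if "x \<in> C" "y \<in> C" for x y
  proof (rule differentiable_bound[OF Cx(1) _ _ that(1,2)])
    fix x assume x: "x \<in> C"
    have xU: "x \<in> U" using x CU by auto
    have "((\<lambda>y. \<Phi> (oproj S y)) has_derivative (\<lambda>h. \<Sum>b\<in>onb S. (h \<bullet> b) *\<^sub>R dird \<Phi> x b)) (at x within C)"
      by (rule has_derivative_at_withinI[OF Ck1_frechet[OF ro \<Phi> xU]])
    then show "(\<Phi> has_derivative (\<lambda>h. \<Sum>b\<in>onb S. (h \<bullet> b) *\<^sub>R dird \<Phi> x b)) (at x within C)"
      by (rule has_derivative_transform_within[OF _ zero_less_one x]) (simp add: C_def oproj_id[OF S])
    show "onorm (\<lambda>h. \<Sum>b\<in>onb S. (h \<bullet> b) *\<^sub>R dird \<Phi> x b) \<le> K"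
    proof (rule onorm_le)
      fix h
      have "norm (\<Sum>b\<in>onb S. (h \<bullet> b) *\<^sub>R dird \<Phi> x b) \<le> (\<Sum>b\<in>onb S. norm h * norm (dird \<Phi> x b))"
      proof (rule sum_norm_le)
        fix b assume "b \<in> onb S"
        then have "\<bar>h \<bullet> b\<bar> \<le> norm h" using Cauchy_Schwarz_ineq2[of h b] onb_props(3)[OF S] by simp
        then show "norm ((h \<bullet> b) *\<^sub>R dird \<Phi> x b) \<le> norm h * norm (dird \<Phi> x b)" by (simp add: mult_right_mono)
      qed
      also have "\<dots> = norm h * ?N x" by (simp add: sum_distrib_left)
      also have "\<dots> \<le> norm h * K"
        using d1(2)[OF xU near(1)[OF x]] by (intro mult_left_mono) (auto simp: K_def dist_real_def)
      finally show "norm (\<Sum>b\<in>onb S. (h \<bullet> b) *\<^sub>R dird \<Phi> x b) \<le> K * norm h" by (simp add: mult.commute)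
    qed
  qed
  have bC: "norm (\<Phi> x) \<le> B" if "x \<in> C" for x
  proof -
    have "dist (\<Phi> x) (\<Phi> z0) < 1" using d2(2) near[OF that] CU that by auto
    then show ?thesis using norm_triangle_ineq2[of "\<Phi> x" "\<Phi> z0"] by (simp add: B_def dist_norm)
  qed
  define \<Psi> where "\<Psi> x = \<Phi> (closest_point C x)" for x
  have cp: "closest_point C x \<in> C" for x by (rule closest_point_in_set[OF Cx(2,3)])
  have lip: "norm (\<Psi> x - \<Psi> y) \<le> K * norm (x - y)" for x y
  proof -
    have "norm (\<Psi> x - \<Psi> y) \<le> K * norm (closest_point C x - closest_point C y)"
      unfolding \<Psi>_def by (rule lipC[OF cp cp])
    also have "\<dots> \<le> K * norm (x - y)"
      using closest_point_lipschitz[OF Cx(1-3), of x y] K0 by (intro mult_left_mono) (auto simp: dist_norm)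
    finally show ?thesis .
  qed
  \<comment> \<open>The first term gives the contraction bound
    \<open>3 * \<epsilon> * K \<le> 1 / 2\<close>, the second gives
    \<open>B * \<epsilon> \<le> r\<close>, which confines the solution to the ball.\<close>
  define \<epsilon> where "\<epsilon> = min (1 / (6 * (K + 1))) (r / (B + 1))"
  have e0: "\<epsilon> > 0" using K0 B0 r by (simp add: \<epsilon>_def)
  have "\<epsilon> * K \<le> 1 / (6 * (K + 1)) * K" using K0 by (intro mult_right_mono) (auto simp: \<epsilon>_def)
  also have "\<dots> \<le> 1 / 6" using K0 by (simp add: field_simps)
  finally have eK: "3 * \<epsilon> * K \<le> 1 / 2" by simp
  have "\<epsilon> * B \<le> r / (B + 1) * B" using B0 by (intro mult_right_mono) (auto simp: \<epsilon>_def)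
  also have "\<dots> \<le> r" using B0 r by (simp add: field_simps)
  finally have eB: "B * \<epsilon> \<le> r" by (simp add: mult.commute)
  obtain z where z: "z 0 = z0" "\<And>t. t \<in> {-\<epsilon><..<\<epsilon>} \<Longrightarrow> (z has_vector_derivative \<Psi> (z t)) (at t)"
    using ode_exists_global[OF K0 lip e0 eK, of z0] by blast
  let ?I = "{-\<epsilon><..<\<epsilon>}"
  have I0: "0 \<in> ?I" using e0 by simp
  \<comment> \<open>The component of the solution orthogonal to \<open>S\<close> has zero derivative
    because the field takes values in \<open>S\<close>.\<close>
  have zS: "z t \<in> S" if t: "t \<in> ?I" for t
  proof -
    have "((\<lambda>t. z t - oproj S (z t)) has_vector_derivative 0) (at s within ?I)" if s: "s \<in> ?I" for s
    proof -
      have "\<Psi> (z s) \<in> S" using \<Phi>S cp CU by (auto simp: \<Psi>_def)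
      then have "\<Psi> (z s) - oproj S (\<Psi> (z s)) = 0" by (simp add: oproj_id[OF S])
      moreover have "((\<lambda>t. z t - oproj S (z t)) has_vector_derivative \<Psi> (z s) - oproj S (\<Psi> (z s))) (at s)"
        by (intro has_vector_derivative_diff z(2)[OF s] bounded_linear.has_vector_derivative[OF bounded_linear_oproj])
      ultimately show ?thesis by (simp add: has_vector_derivative_at_within)
    qed
    then obtain c where c: "\<And>t. t \<in> ?I \<Longrightarrow> z t - oproj S (z t) = c"
      using has_vector_derivative_zero_constant[of ?I "\<lambda>t. z t - oproj S (z t)"] convex_real_interval(8)[of "-\<epsilon>" \<epsilon>] by auto
    have "z 0 - oproj S (z 0) = 0" using z(1) oproj_id[OF S z0S] by simp
    then have "c = 0" using c[OF I0] by simp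
    then have "z t = oproj S (z t)" using c[OF t] by simp
    then show ?thesis using oproj_in[OF S] by metis
  qed
  have zC: "z t \<in> C" if t: "t \<in> ?I" for t
  proof -
    have "norm (z t - z 0) \<le> B * norm (t - 0)"
    proof (rule differentiable_bound[of ?I z "\<lambda>s h. h *\<^sub>R \<Psi> (z s)" B t 0])
      show "(z has_derivative (\<lambda>h. h *\<^sub>R \<Psi> (z s))) (at s within ?I)" if "s \<in> ?I" for s
        using z(2)[OF that] has_derivative_at_withinI unfolding has_vector_derivative_def by blast
      show "onorm (\<lambda>h. h *\<^sub>R \<Psi> (z s)) \<le> B" for s
      proof (rule onorm_le)
        fix h :: real
        have "norm (\<Psi> (z s)) * \<bar>h\<bar> \<le> B * \<bar>h\<bar>" unfolding \<Psi>_def by (rule mult_right_mono[OF bC[OF cp] abs_ge_zero])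
        then show "norm (h *\<^sub>R \<Psi> (z s)) \<le> B * norm h" by (simp add: mult.commute)
      qed
    qed (use t I0 in auto)
    also have "\<dots> \<le> B * \<epsilon>" using t B0 by (intro mult_left_mono) auto
    finally have "dist z0 (z t) \<le> r" using z(1) eB by (simp add: dist_norm norm_minus_commute)
    then show ?thesis using zS[OF t] by (simp add: C_def)
  qed
  have "z t \<in> U \<and> (z has_vector_derivative \<Phi> (z t)) (at t)" if t: "t \<in> ?I" for t
    using zC[OF t] CU z(2)[OF t] closest_point_self[OF zC[OF t]] by (auto simp: \<Psi>_def)
  then show ?thesis using e0 z(1) by blast
qed

text \<open>The equation expresses the derivative of \<open>z\<close> through \<open>z\<close>
  itself, so each degree of smoothness yields the next.\<close>

lemma ode_smooth:
  fixes z :: "real \<Rightarrow> 'z::euclidean_space"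
  assumes I: "open I" and ro: "relopen S U" and \<Phi>: "\<And>k. Ck_on k S U \<Phi>"
    and zU: "\<And>t. t \<in> I \<Longrightarrow> z t \<in> U" and z: "\<And>t. t \<in> I \<Longrightarrow> (z has_vector_derivative \<Phi> (z t)) (at t)"
  shows "Ck_on k UNIV I z"
proof (induction k)
  case 0
  have "continuous_on I z"
    by (rule continuous_on_vector_derivative) (use z has_vector_derivative_at_within in blast)
  then show ?case by simp
next
  case (Suc k)
  have roI: "relopen UNIV I" using I by simp
  have line: "((\<lambda>s. z (t + s *\<^sub>R v)) has_vector_derivative v *\<^sub>R \<Phi> (z t)) (at 0)" if t: "t \<in> I" for t v
  proof -
    have "((\<lambda>s. t + s *\<^sub>R v) has_vector_derivative v) (at 0)" by (auto intro!: derivative_eq_intros)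
    moreover have "(z has_vector_derivative \<Phi> (z t)) (at (t + 0 *\<^sub>R v))" using z[OF t] by simp
    ultimately show ?thesis using vector_diff_chain_at[of "\<lambda>s. t + s *\<^sub>R v" v 0 z] by (simp add: o_def)
  qed
  have "Ck_on k UNIV I (\<lambda>t. dird z t v)" for v
  proof (rule Ck_on_cong[OF roI])
    show "Ck_on k UNIV I (\<lambda>t. v *\<^sub>R \<Phi> (z t))"
      by (intro Ck_on_scaleR roI Ck_on_const Ck_on_compose[OF roI ro _ Suc \<Phi>]) (use zU in auto)
    show "v *\<^sub>R \<Phi> (z t) = dird z t v" if "t \<in> I" for t
      by (rule dird_eqI[symmetric, OF line[OF that]])
  qed
  then show ?case using Ck_on_continuous[OF Suc] line by (auto intro: differentiableI_vector)
qed

section \<open>Fibers as Riemannian submanifolds\<close>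

text \<open>Charts of a fiber are required to factor through a linear map of an ambient chart, which makes
  the transition maps between them smooth.\<close>

definition fibre_chart ::
  "('b, 'f::euclidean_space) riem \<Rightarrow> 'b set \<Rightarrow> 'f set \<Rightarrow> ('b, 'f) chart \<Rightarrow> ('f \<Rightarrow> 'f) \<Rightarrow> ('b, 'f) chart \<Rightarrow> bool" where
  "fibre_chart N S L c \<kappa> k \<longleftrightarrow> c \<in> atlas N \<and> fst k \<subseteq> S \<and> openin (subtopology (mtop N) S) (fst k) \<and>
     inj_on (snd k) (fst k) \<and> openin (top_of_set L) (snd k ` fst k) \<and>
     bounded_linear \<kappa> \<and> fst k \<subseteq> fst c \<and> (\<forall>q\<in>fst k. snd k q = \<kappa> (snd c q)) \<and>
     (\<forall>n. Ck_on n L (snd k ` fst k) (snd c \<circ> cinv k))"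

lemma fibre_chartD:
  assumes "fibre_chart N S L c \<kappa> k"
  shows "c \<in> atlas N" "fst k \<subseteq> S" "openin (subtopology (mtop N) S) (fst k)"
     "inj_on (snd k) (fst k)" "openin (top_of_set L) (snd k ` fst k)"
     "bounded_linear \<kappa>" "fst k \<subseteq> fst c" "\<And>q. q \<in> fst k \<Longrightarrow> snd k q = \<kappa> (snd c q)"
     "\<And>n. Ck_on n L (snd k ` fst k) (snd c \<circ> cinv k)"
     "\<And>q. q \<in> fst k \<Longrightarrow> cinv k (snd k q) = q"
  using assms inv_into_f_f[of "snd k" "fst k"] unfolding fibre_chart_def cinv_def by blast+

lemma inner_on_pullback:
  assumes g: "inner_on V g" and V: "subspace V" and l: "lin_on L l" and lV: "\<And>v. v \<in> L \<Longrightarrow> l v \<in> V"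
    and inj: "\<And>v. v \<in> L \<Longrightarrow> l v = 0 \<Longrightarrow> v = 0"
  shows "inner_on L (\<lambda>v w. g (l v) (l w))"
  unfolding inner_on_def
proof (intro conjI ballI impI)
  fix w assume w: "w \<in> L"
  show "lin_on L (\<lambda>v. g (l v) (l w))"
    using lin_onD[OF l] lin_onD[OF inner_on_lin1[OF g lV[OF w]] lV lV] by (simp add: lin_on_def)
next
  fix v w assume "v \<in> L" "w \<in> L"
  then show "g (l v) (l w) = g (l w) (l v)" using inner_on_sym[OF g lV lV] by blast
next
  fix v assume "v \<in> L" "v \<noteq> 0"
  then show "0 < g (l v) (l v)" using inner_on_pos[OF g lV] inj by blast
qed

text \<open>The induced metric is defined through the differential of the inclusion, which depends
  only on the atlas. The preliminary record with zero metric makes that differential available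
  before the metric is known.\<close>

definition fibre_manifold ::
  "('b, 'f::euclidean_space) riem \<Rightarrow> 'b set \<Rightarrow> 'f set \<Rightarrow> ('b, 'f) chart set \<Rightarrow> ('b, 'f) riem" where
  "fibre_manifold N S L A =
     (let F0 = \<lparr>mtop = subtopology (mtop N) S, model = L, atlas = A, metric = (\<lambda>q v w. 0)\<rparr>
      in F0 \<lparr>metric := (\<lambda>q v w. metric N q (dmap F0 N (\<lambda>q. q) q v) (dmap F0 N (\<lambda>q. q) q w))\<rparr>)"

context
  fixes N :: "('b, 'f::euclidean_space) riem" and S :: "'b set" and L :: "'f set"
  assumes RN: "riemannian_manifold N" and S: "S \<subseteq> points N" and L: "subspace L"
begin

private lemma smN: "smooth_manifold N" by (rule riemannian_manifoldD(1)[OF RN])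

lemma fibre_chart_relopen: "fibre_chart N S L c \<kappa> k \<Longrightarrow> relopen L (snd k ` fst k)"
  using L fibre_chartD(5) by blast

text \<open>\<open>cinv k\<close> factors through the ambient chart as
  \<open>cinv c \<circ> (snd c \<circ> cinv k)\<close>, whose inner map is smooth by the definition
  of a fiber chart.\<close>

lemma fibre_chart_cinv_continuous:
  assumes k: "fibre_chart N S L c \<kappa> k"
  shows "continuous_map (top_of_set (snd k ` fst k)) (mtop N) (cinv k)"
proof -
  note d = fibre_chartD[OF k]
  let ?X = "top_of_set (snd k ` fst k)"
  have "continuous_map ?X (top_of_set (snd c ` fst c)) (snd c \<circ> cinv k)"
    using Ck_on_continuous[OF d(9)] d(7,10) by (auto simp: continuous_map_in_subtopology)
  from continuous_map_compose[OF this cinv_continuous[OF smN d(1)]]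
  have "continuous_map ?X (mtop N) (cinv c \<circ> (snd c \<circ> cinv k))" .
  then show ?thesis
    by (rule continuous_map_eq) (use d(7,10) cinv_left[OF smN d(1)] in auto)
qed

lemma fibre_chart_image_relopen:
  assumes k: "fibre_chart N S L c \<kappa> k" and A: "openin (mtop N) A"
  shows "relopen L (snd k ` (fst k \<inter> A))"
proof -
  note d = fibre_chartD[OF k]
  have "openin (top_of_set (snd k ` fst k)) {x \<in> topspace (top_of_set (snd k ` fst k)). cinv k x \<in> A}"
    by (rule openin_continuous_map_preimage[OF fibre_chart_cinv_continuous[OF k] A])
  moreover have "{x \<in> topspace (top_of_set (snd k ` fst k)). cinv k x \<in> A} = snd k ` (fst k \<inter> A)"
    by (auto simp: d(10))
  ultimately show ?thesis using L d(5) openin_trans by metis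
qed

lemma fibre_chart_homeomorphic:
  assumes k: "fibre_chart N S L c \<kappa> k"
  shows "homeomorphic_map (subtopology (subtopology (mtop N) S) (fst k)) (top_of_set (snd k ` fst k)) (snd k)"
proof -
  note d = fibre_chartD[OF k]
  have st: "subtopology (subtopology (mtop N) S) (fst k) = subtopology (mtop N) (fst k)"
    using d(2) by (simp add: subtopology_subtopology inf.absorb2)
  have ts: "topspace (subtopology (mtop N) (fst k)) = fst k"
    using S d(2) by (auto simp: topspace_subtopology)
  have "continuous_map (subtopology (mtop N) (fst c)) euclidean (snd c)"
    using homeomorphic_imp_continuous_map[OF smooth_manifoldD(6)[OF smN d(1)]] by (simp add: continuous_map_in_subtopology)
  then have "continuous_map (subtopology (mtop N) (fst k)) euclidean (snd c)"
    using continuous_map_from_subtopology_mono d(7) by blast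
  moreover have "continuous_map euclidean euclidean \<kappa>"
    using linear_continuous_on[OF d(6)] by simp
  ultimately have "continuous_map (subtopology (mtop N) (fst k)) euclidean (\<kappa> \<circ> snd c)"
    by (rule continuous_map_compose)
  then have "continuous_map (subtopology (mtop N) (fst k)) euclidean (snd k)"
    by (rule continuous_map_eq) (simp add: ts d(8))
  then have 1: "continuous_map (subtopology (mtop N) (fst k)) (top_of_set (snd k ` fst k)) (snd k)"
    using ts by (auto simp: continuous_map_in_subtopology)
  have 2: "continuous_map (top_of_set (snd k ` fst k)) (subtopology (mtop N) (fst k)) (cinv k)"
    using fibre_chart_cinv_continuous[OF k] d(10) by (auto simp: continuous_map_in_subtopology)
  have "homeomorphic_maps (subtopology (mtop N) (fst k)) (top_of_set (snd k ` fst k)) (snd k) (cinv k)"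
    unfolding homeomorphic_maps_def using 1 2 d(10) ts by auto
  then show ?thesis unfolding st by (auto simp: homeomorphic_map_maps)
qed

text \<open>Used to cut charts of a fiber away from a compact set near \<open>u\<close>.\<close>

lemma fibre_chart_restrict:
  assumes k: "fibre_chart N S L c \<kappa> k" and A: "openin (mtop N) A"
  shows "fibre_chart N S L c \<kappa> (fst k \<inter> A, snd k)"
proof -
  note d = fibre_chartD[OF k]
  let ?k = "(fst k \<inter> A, snd k)"
  have ro: "relopen L (snd k ` (fst k \<inter> A))" by (rule fibre_chart_image_relopen[OF k A])
  have inj: "inj_on (snd k) (fst k \<inter> A)" using d(4) by (rule inj_on_subset) auto
  have "openin (subtopology (mtop N) S) (S \<inter> A)" using A by (auto simp: openin_subtopology)
  then have "openin (subtopology (mtop N) S) (fst k \<inter> (S \<inter> A))" using d(3) by (rule openin_Int[rotated])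
  moreover have "fst k \<inter> (S \<inter> A) = fst k \<inter> A" using d(2) by auto
  ultimately have o: "openin (subtopology (mtop N) S) (fst k \<inter> A)" by simp
  have "Ck_on n L (snd k ` (fst k \<inter> A)) (snd c \<circ> cinv ?k)" for n
  proof (rule Ck_on_cong[OF ro])
    show "Ck_on n L (snd k ` (fst k \<inter> A)) (snd c \<circ> cinv k)" by (rule Ck_on_subset[OF d(9)]) auto
    fix x assume "x \<in> snd k ` (fst k \<inter> A)"
    then obtain q where q: "q \<in> fst k \<inter> A" "x = snd k q" by auto
    have "cinv ?k x = q" using inv_into_f_f[OF inj q(1)] q(2) by (simp add: cinv_def)
    then show "(snd c \<circ> cinv k) x = (snd c \<circ> cinv ?k) x"
      using d(10) q by simp
  qed
  then show ?thesis unfolding fibre_chart_def using d ro inj o by auto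
qed

lemma fibre_chart_ambient_Ck:
  assumes k: "fibre_chart N S L c \<kappa> k" and c2: "c2 \<in> atlas N"
  shows "Ck_on n L (snd k ` (fst k \<inter> fst c2)) (snd c2 \<circ> cinv k)"
proof -
  note d = fibre_chartD[OF k]
  have ro: "relopen L (snd k ` (fst k \<inter> fst c2))"
    by (rule fibre_chart_image_relopen[OF k smooth_manifoldD(4)[OF smN c2]])
  have ro': "relopen (model N) (snd c ` (fst c \<inter> fst c2))"
    by (rule chart_overlap_relopen[OF smN d(1) smooth_manifoldD(4)[OF smN c2]])
  have "Ck_on n L (snd k ` (fst k \<inter> fst c2)) (\<lambda>x. (snd c2 \<circ> cinv c) ((snd c \<circ> cinv k) x))"
    by (rule Ck_on_compose[OF ro ro' _ Ck_on_subset[OF d(9)] transition_Ck[OF smN d(1) c2]])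
      (use d(7,10) in auto)
  then show ?thesis
    by (rule Ck_on_cong[OF ro, rotated]) (use d(7,10) cinv_left[OF smN d(1)] in auto)
qed

lemma fibre_chart_transition_Ck:
  assumes k: "fibre_chart N S L c \<kappa> k" and k2: "fibre_chart N S L c2 \<kappa>2 k2"
  shows "Ck_on n L (snd k ` (fst k \<inter> fst k2)) (snd k2 \<circ> cinv k)"
proof -
  note d = fibre_chartD[OF k] and d2 = fibre_chartD[OF k2]
  obtain A where A: "openin (mtop N) A" "fst k2 = A \<inter> S" using d2(3) by (auto simp: openin_subtopology)
  have "fst k \<inter> fst k2 = fst k \<inter> A" using A d(2) by auto
  then have ro: "relopen L (snd k ` (fst k \<inter> fst k2))" using fibre_chart_image_relopen[OF k A(1)] by simp
  have "Ck_on n L (snd k ` (fst k \<inter> fst k2)) (\<lambda>x. \<kappa>2 ((snd c2 \<circ> cinv k) x))"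
    by (rule Ck_on_bounded_linear[OF ro d2(6)], rule Ck_on_subset[OF fibre_chart_ambient_Ck[OF k d2(1)]])
      (use d2(7) in auto)
  then show ?thesis
    by (rule Ck_on_cong[OF ro, rotated]) (auto simp: d(10) d2(8))
qed

text \<open>Since \<open>\<kappa> \<circ> snd c \<circ> cinv k\<close> is the identity, the linear
  map \<open>\<kappa>\<close> is a left inverse of the derivative of the parametrization; this is
  what makes the inclusion an immersion.\<close>

lemma fibre_chart_dird:
  assumes k: "fibre_chart N S L c \<kappa> k" and x: "x \<in> snd k ` fst k" and v: "v \<in> L"
  shows "\<kappa> (dird (snd c \<circ> cinv k) x v) = v" "dird (snd c \<circ> cinv k) x v \<in> model N"
proof -
  note d = fibre_chartD[OF k] and ro = fibre_chart_relopen[OF k]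
  note df = Ck_on_differentiable[OF d(9)[of "Suc 0"] v x]
  have "\<kappa> (dird (snd c \<circ> cinv k) x v) = dird (\<lambda>y. \<kappa> ((snd c \<circ> cinv k) y)) x v"
    by (rule dird_bounded_linear[OF d(6) df, symmetric])
  also have "\<dots> = dird (\<lambda>y. y) x v"
    by (rule dird_cong[OF ro x v]) (auto simp: d(10) d(8)[symmetric])
  also have "\<dots> = v" by (rule dird_eqI) (auto intro!: derivative_eq_intros)
  finally show "\<kappa> (dird (snd c \<circ> cinv k) x v) = v" .
  show "dird (snd c \<circ> cinv k) x v \<in> model N"
    by (rule dird_in_subspace[OF ro df x v smooth_manifoldD(1)[OF smN]])
      (use d(7,10) chart_in_model[OF smN d(1)] in auto)
qed

context
  fixes A :: "('b, 'f) chart set"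
  assumes A: "\<And>k. k \<in> A \<Longrightarrow> \<exists>c \<kappa>. fibre_chart N S L c \<kappa> k" and cover: "\<Union> (fst ` A) = S"
begin

private abbreviation (input) "F \<equiv> fibre_manifold N S L A"

lemma fibre_manifold_simps:
  "mtop F = subtopology (mtop N) S" "model F = L" "atlas F = A"
  by (simp_all add: fibre_manifold_def Let_def)

lemma fibre_metric: "metric F q v w = metric N q (dmap F N (\<lambda>q. q) q v) (dmap F N (\<lambda>q. q) q w)"
  by (simp add: fibre_manifold_def Let_def dmap_def chart_at_def)

lemma fibre_points: "points F = S"
  using S by (auto simp: fibre_manifold_simps topspace_subtopology)

lemma fibre_smooth_manifold: "smooth_manifold F"
  unfolding smooth_manifold_def fibre_manifold_simps
proof (intro conjI ballI)
  show "Hausdorff_space (subtopology (mtop N) S)"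
    using smN Hausdorff_space_subtopology by (auto simp: smooth_manifold_def)
  show "second_countable (subtopology (mtop N) S)"
    using smN second_countable_subtopology by (auto simp: smooth_manifold_def)
  show "subspace L" by (rule L)
  show "(\<Union>c\<in>A. fst c) = topspace (subtopology (mtop N) S)"
    using cover S by (auto simp: topspace_subtopology)
next
  fix k assume "k \<in> A"
  then obtain c \<kappa> where k: "fibre_chart N S L c \<kappa> k" using A by blast
  note d = fibre_chartD[OF k]
  show "openin (subtopology (mtop N) S) (fst k)" "openin (top_of_set L) (snd k ` fst k)" by fact+
  show "homeomorphic_map (subtopology (subtopology (mtop N) S) (fst k)) (top_of_set (snd k ` fst k)) (snd k)"
    by (rule fibre_chart_homeomorphic[OF k])
next
  fix k k2 assume "k \<in> A" "k2 \<in> A"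
  then obtain c \<kappa> c2 \<kappa>2 where "fibre_chart N S L c \<kappa> k" "fibre_chart N S L c2 \<kappa>2 k2" using A by blast
  then show "Cinf_on L (snd k ` (fst k \<inter> fst k2)) (snd k2 \<circ> cinv k)"
    unfolding Cinf_on_def using fibre_chart_transition_Ck by blast
qed

lemma fibre_inclusion_smooth: "smooth_map F N (\<lambda>q. q)"
  unfolding smooth_map_def fibre_manifold_simps
proof (intro conjI ballI)
  show "continuous_map (subtopology (mtop N) S) (mtop N) (\<lambda>q. q)"
    by (rule continuous_map_from_subtopology) simp
  fix k c2 assume "k \<in> A" and c2: "c2 \<in> atlas N"
  then obtain c \<kappa> where k: "fibre_chart N S L c \<kappa> k" using A by blast
  have "snd c2 \<circ> (\<lambda>q. q) \<circ> cinv k = snd c2 \<circ> cinv k" by auto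
  moreover have "(\<lambda>q. q) -` fst c2 = fst c2" by auto
  ultimately show "Cinf_on L (snd k ` (fst k \<inter> (\<lambda>q. q) -` fst c2)) (snd c2 \<circ> (\<lambda>q. q) \<circ> cinv k)"
    using fibre_chart_ambient_Ck[OF k c2] unfolding Cinf_on_def by simp
qed

lemma fibre_dmap:
  assumes k: "k \<in> A" and q: "q \<in> fst k" and c: "c \<in> atlas N" "q \<in> fst c" and v: "v \<in> L"
  shows "dmap F N (\<lambda>q. q) q v = tvec N c q (dird (snd c \<circ> cinv k) (snd k q) (comps F k q v))"
proof -
  have "snd c \<circ> (\<lambda>q. q) \<circ> cinv k = snd c \<circ> cinv k" by auto
  then show ?thesis
    using dmap_rep[OF fibre_smooth_manifold smN fibre_inclusion_smooth, of k c q v] assms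
    by (simp add: fibre_manifold_simps)
qed

lemma fibre_dmap_props:
  assumes q: "q \<in> S"
  shows "lin_on L (dmap F N (\<lambda>q. q) q)" "v \<in> L \<Longrightarrow> dmap F N (\<lambda>q. q) q v \<in> model N"
    "v \<in> L \<Longrightarrow> dmap F N (\<lambda>q. q) q v = 0 \<Longrightarrow> v = 0"
proof -
  obtain k where kA: "k \<in> A" "q \<in> fst k" using q cover by auto
  obtain c \<kappa> where k: "fibre_chart N S L c \<kappa> k" using A kA by blast
  note d = fibre_chartD[OF k] and ro = fibre_chart_relopen[OF k]
  have qc: "q \<in> fst c" using d(7) kA by auto
  have x: "snd k q \<in> snd k ` fst k" using kA by auto
  note smF = fibre_smooth_manifold
  have kF: "k \<in> atlas F" using kA by (simp add: fibre_manifold_simps)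
  note ci = comps_in[OF smF kF kA(2), unfolded fibre_manifold_simps(2)]
    and cl = comps_lin[OF smF kF kA(2), unfolded fibre_manifold_simps(2)]
  note dl = lin_on_dird[OF ro d(9)[of "Suc 0"] x]
  note e = fibre_dmap[OF kA d(1) qc] and fd = fibre_chart_dird[OF k x]
  show "v \<in> L \<Longrightarrow> dmap F N (\<lambda>q. q) q v \<in> model N"
    using e fd(2)[OF ci] tvec_in[OF smN d(1) qc] by simp
  show "lin_on L (dmap F N (\<lambda>q. q) q)"
    unfolding lin_on_def
  proof (intro ballI allI)
    fix a b r s assume ab: "a \<in> L" "b \<in> L"
    then have abL: "r *\<^sub>R a + s *\<^sub>R b \<in> L" using L by (auto intro!: subspace_add subspace_scale)
    show "dmap F N (\<lambda>q. q) q (r *\<^sub>R a + s *\<^sub>R b) = r *\<^sub>R dmap F N (\<lambda>q. q) q a + s *\<^sub>R dmap F N (\<lambda>q. q) q b"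
      unfolding e[OF ab(1)] e[OF ab(2)] e[OF abL] lin_onD[OF cl ab] lin_onD[OF dl ci[OF ab(1)] ci[OF ab(2)]]
      by (rule lin_onD[OF tvec_lin[OF smN d(1) qc] fd(2)[OF ci[OF ab(1)]] fd(2)[OF ci[OF ab(2)]]])
  qed
  assume v: "v \<in> L" and z: "dmap F N (\<lambda>q. q) q v = 0"
  note VN = smooth_manifoldD(1)[OF smN]
  let ?w = "dird (snd c \<circ> cinv k) (snd k q) (comps F k q v)"
  have "?w = comps N c q (tvec N c q ?w)" by (rule comps_tvec[OF smN d(1) qc fd(2)[OF ci[OF v]], symmetric])
  also have "\<dots> = 0" using z e[OF v] lin_on_zero[OF comps_lin[OF smN d(1) qc] VN] by simp
  finally have "comps F k q v = 0"
    using fd(1)[OF ci[OF v]] linear_0[OF bounded_linear.linear[OF d(6)]] by simp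
  moreover have "tvec F k q (comps F k q v) = v"
    by (rule tvec_comps[OF smF kF kA(2)]) (simp add: v fibre_manifold_simps)
  ultimately have "v = tvec F k q 0" by simp
  then show "v = 0"
    using lin_on_zero[OF tvec_lin[OF smF kF kA(2)]] L by (simp add: fibre_manifold_simps)
qed

lemma fibre_gcomp:
  assumes kA: "k \<in> A" and k: "fibre_chart N S L c \<kappa> k" and x: "x \<in> snd k ` fst k" and ab: "a \<in> L" "b \<in> L"
  shows "gcomp F k x a b = gcomp N c ((snd c \<circ> cinv k) x) (dird (snd c \<circ> cinv k) x a) (dird (snd c \<circ> cinv k) x b)"
proof -
  obtain q where q: "q \<in> fst k" "x = snd k q" using x by auto
  note d = fibre_chartD[OF k]
  have qc: "q \<in> fst c" using d(7) q by auto
  have kF: "k \<in> atlas F" using kA by (simp add: fibre_manifold_simps)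
  note smF = fibre_smooth_manifold
  have "dmap F N (\<lambda>q. q) q (tvec F k q a) = tvec N c q (dird (snd c \<circ> cinv k) (snd k q) a)" if "a \<in> L" for a
    using fibre_dmap[OF kA q(1) d(1) qc] tvec_in[OF smF kF q(1)] comps_tvec[OF smF kF q(1)] that
    by (simp add: fibre_manifold_simps)
  then show ?thesis
    using ab gcomp_at[OF smF kF q(1)] gcomp_at[OF smN d(1) qc] by (simp add: q(2) fibre_metric d(10)[OF q(1)])
qed

lemma fibre_riemannian: "riemannian_manifold F"
  unfolding riemannian_manifold_def fibre_points
proof (intro conjI ballI allI impI)
  show "smooth_manifold F" by (rule fibre_smooth_manifold)
  have io: "inner_on L (metric F q)" if "q \<in> S" for q
  proof -
    have "q \<in> points N" using that S by auto
    have e: "metric F q = (\<lambda>v w. metric N q (dmap F N (\<lambda>q. q) q v) (dmap F N (\<lambda>q. q) q w))"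
      by (intro ext fibre_metric)
    show ?thesis unfolding e
      by (rule inner_on_pullback[OF riemannian_manifoldD(2)[OF RN \<open>q \<in> points N\<close>] smooth_manifoldD(1)[OF smN] fibre_dmap_props[OF that]])
  qed
  fix q assume q: "q \<in> S"
  note i = io[OF q]
  show "metric F q (r *\<^sub>R u + s *\<^sub>R v) w = r * metric F q u w + s * metric F q v w"
    if "u \<in> model F" "v \<in> model F" "w \<in> model F" for u v w r s
    using that lin_onD[OF inner_on_lin1[OF i]] by (simp add: fibre_manifold_simps)
  show "metric F q v w = metric F q w v" if "v \<in> model F" "w \<in> model F" for v w
    using that inner_on_sym[OF i] by (simp add: fibre_manifold_simps)
  show "0 < metric F q v v" if "v \<in> model F" "v \<noteq> 0" for v
    using that inner_on_pos[OF i] by (simp add: fibre_manifold_simps)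
next
  fix k a b assume kF: "k \<in> atlas F" and ab: "a \<in> model F" "b \<in> model F"
  then have kA: "k \<in> A" and ab': "a \<in> L" "b \<in> L" by (simp_all add: fibre_manifold_simps)
  obtain c \<kappa> where k: "fibre_chart N S L c \<kappa> k" using A kA by blast
  note d = fibre_chartD[OF k] and ro = fibre_chart_relopen[OF k]
  let ?i = "snd c \<circ> cinv k"
  have im: "?i ` (snd k ` fst k) \<subseteq> snd c ` fst c" using d(7,10) by auto
  have "Ck_on n L (snd k ` fst k) (\<lambda>x. gcomp N c (?i x) (dird ?i x a) (dird ?i x b))" for n
  proof (rule Ck_on_bilin_field[OF ro smooth_manifoldD(1)[OF smN]])
    show "lin_on (model N) (\<lambda>v. gcomp N c (?i x) v w)" if "x \<in> snd k ` fst k" "w \<in> model N" for x w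
      using inner_on_lin1[OF gcomp_inner[OF RN d(1)] that(2)] im that(1) by blast
    show "lin_on (model N) (gcomp N c (?i x) v)" if "x \<in> snd k ` fst k" "v \<in> model N" for x v
      using inner_on_lin2[OF gcomp_inner[OF RN d(1)] smooth_manifoldD(1)[OF smN] that(2)] im that(1) by blast
    show "Ck_on n L (snd k ` fst k) (\<lambda>x. gcomp N c (?i x) v w)" if "v \<in> model N" "w \<in> model N" for v w
      by (rule Ck_on_compose[OF ro chart_relopen[OF smN d(1)] im d(9) gcomp_Ck[OF RN d(1) that]])
  qed (use Ck_on_dird[OF d(9)] ab' fibre_chart_dird(2)[OF k] in auto)
  then have "Ck_on n L (snd k ` fst k) (\<lambda>x. gcomp F k x a b)" for n
    by (rule Ck_on_cong[OF ro, rotated]) (rule fibre_gcomp[OF kA k _ ab', symmetric])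
  then show "Cinf_on (model F) (snd k ` fst k) (\<lambda>x. gcomp F k x a b)"
    by (simp add: Cinf_on_def fibre_manifold_simps)
qed

lemma fibre_riem_submanifold: "riem_submanifold N S F"
  unfolding riem_submanifold_def
proof (intro conjI ballI)
  show "riemannian_manifold F" by (rule fibre_riemannian)
  show "S \<subseteq> points N" by (rule S)
  show "mtop F = subtopology (mtop N) S" by (rule fibre_manifold_simps)
  show "smooth_map F N (\<lambda>q. q)" by (rule fibre_inclusion_smooth)
  fix q assume q: "q \<in> S"
  show "metric F q v w = metric N q (dmap F N (\<lambda>q. q) q v) (dmap F N (\<lambda>q. q) q w)" for v w
    by (rule fibre_metric)
  show "inj_on (dmap F N (\<lambda>q. q) q) (model F)"
    unfolding fibre_manifold_simps
  proof (rule inj_onI)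
    fix v w assume vw: "v \<in> L" "w \<in> L" "dmap F N (\<lambda>q. q) q v = dmap F N (\<lambda>q. q) q w"
    have "v - w \<in> L" using vw L by (simp add: subspace_diff)
    moreover have "dmap F N (\<lambda>q. q) q (v - w) = 0"
      using lin_on_diff[OF fibre_dmap_props(1)[OF q] vw(1,2)] vw(3) by simp
    ultimately have "v - w = 0" by (rule fibre_dmap_props(3)[OF q])
    then show "v = w" by simp
  qed
qed

end

end

context submersion_at
begin

lemma D_onto: "D x0 ` model N = model M"
proof
  show "D x0 ` model N \<subseteq> model M" using D_in[OF x0(1)] by auto
  show "model M \<subseteq> D x0 ` model N"
  proof
    fix w assume "w \<in> model M"
    then obtain h where "h \<in> horizontal N M \<pi> u" "w = dmap N M \<pi> u h"
      using bij_betw_imp_surj_on[OF dmap_bij[OF u]] by blast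
    then show "w \<in> D x0 ` model N" using dmap_u horizontal_in by auto
  qed
qed

text \<open>In coordinates the fiber is a level set of \<open>phi\<close>, a submersion at
  \<open>x0\<close> by \<open>D_onto\<close>, so straightening provides the chart.\<close>

lemma fibre_chart_exists:
  assumes L: "subspace L" and dL: "dim L = dim (vertical N M \<pi> u)"
  shows "\<exists>\<kappa> k. u \<in> fst k \<and> fibre_chart N {q \<in> points N. \<pi> q = \<pi> u} L cN \<kappa> k"
proof -
  let ?S = "{q \<in> points N. \<pi> q = \<pi> u}"
  have phiV: "phi x \<in> model M" if "x \<in> Om" for x
    using phi_in[OF that] relopen_subset[OF roM] by auto
  have dK: "dim L = dim {v \<in> model N. D x0 v = 0}" using dL by (simp add: vertical_u)
  have "\<exists>\<kappa> \<iota> U1 O'. bounded_linear \<kappa> \<and> openin (top_of_set (model N)) U1 \<and> x0 \<in> U1 \<and> U1 \<subseteq> Om \<and>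
    openin (top_of_set L) O' \<and> (\<forall>k. Ck_on k L O' \<iota>) \<and>
    (\<forall>a\<in>O'. \<iota> a \<in> U1 \<and> phi (\<iota> a) = phi x0 \<and> \<kappa> (\<iota> a) = a) \<and>
    (\<forall>x\<in>U1. phi x = phi x0 \<longrightarrow> \<kappa> x \<in> O' \<and> \<iota> (\<kappa> x) = x)"
    by (rule straighten[OF Om_relopen VM phi_Ck phiV x0(1) D_onto L dK])
  then obtain \<kappa> \<iota> U1 O' where \<kappa>: "bounded_linear \<kappa>" and U1: "openin (top_of_set (model N)) U1" "x0 \<in> U1" "U1 \<subseteq> Om"
    and O': "openin (top_of_set L) O'" and \<iota>: "\<forall>n. Ck_on n L O' \<iota>"
    and 1: "\<forall>a\<in>O'. \<iota> a \<in> U1 \<and> phi (\<iota> a) = phi x0 \<and> \<kappa> (\<iota> a) = a"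
    and 2: "\<forall>x\<in>U1. phi x = phi x0 \<longrightarrow> \<kappa> x \<in> O' \<and> \<iota> (\<kappa> x) = x"
    by (elim exE conjE) (rule that; assumption)
  define T where "T = {q \<in> fst cN. snd cN q \<in> U1}"
  define k where "k = (?S \<inter> T, \<kappa> \<circ> snd cN)"
  have oT: "openin (mtop N) T" unfolding T_def by (rule chart_preimage_open[OF smN cN(1) U1(1)])
  have phiS: "phi (snd cN q) = phi x0" if "q \<in> fst k" for q
  proof -
    have q: "q \<in> fst cN" "\<pi> q = \<pi> u" using that by (auto simp: k_def T_def)
    show ?thesis using phi_snd[OF q(1)] q(2) by (simp add: phi_x0 y0_def)
  qed
  have fwd: "\<kappa> (snd cN q) \<in> O'" "\<iota> (\<kappa> (snd cN q)) = snd cN q" if "q \<in> fst k" for q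
    using 2 phiS[OF that] that by (auto simp: k_def T_def)
  \<comment> \<open>Here the level set is brought back to the fiber: equal values of
    \<open>phi\<close> mean equal images under \<pi>, because \<open>snd cM\<close> is injective on
    its domain.\<close>
  have bwd: "\<exists>q\<in>fst k. snd cN q = \<iota> a" if "a \<in> O'" for a
  proof -
    have "\<iota> a \<in> Om" using 1 U1 that by auto
    then obtain q where q: "q \<in> fst cN" "\<pi> q \<in> fst cM" "snd cN q = \<iota> a" by (auto simp: Om_def)
    have "snd cM (\<pi> q) = snd cM (\<pi> u)" using phi_snd[OF q(1)] q(3) 1 that by (simp add: phi_x0 y0_def)
    then have "\<pi> q = \<pi> u" using inj_onD[OF chart_inj[OF smM cM(1)] _ q(2) cM(2)] by simp
    then have "q \<in> fst k" using q 1 that chart_subset[OF smN cN(1)] by (auto simp: k_def T_def)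
    then show ?thesis using q(3) by blast
  qed
  have im: "snd k ` fst k = O'"
  proof
    show "snd k ` fst k \<subseteq> O'" using fwd by (auto simp: k_def)
    show "O' \<subseteq> snd k ` fst k"
    proof
      fix a assume a: "a \<in> O'"
      obtain q where "q \<in> fst k" "snd cN q = \<iota> a" using bwd[OF a] by blast
      then show "a \<in> snd k ` fst k" using 1 a by (auto simp: k_def image_iff intro!: bexI[of _ q])
    qed
  qed
  have kcN: "fst k \<subseteq> fst cN" by (auto simp: k_def T_def)
  have inj: "inj_on (snd k) (fst k)"
  proof (rule inj_onI)
    fix q r assume qr: "q \<in> fst k" "r \<in> fst k" "snd k q = snd k r"
    then have "\<kappa> (snd cN q) = \<kappa> (snd cN r)" by (simp add: k_def)
    then have "\<iota> (\<kappa> (snd cN q)) = \<iota> (\<kappa> (snd cN r))" by (rule arg_cong)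
    then have "snd cN q = snd cN r" unfolding fwd(2)[OF qr(1)] fwd(2)[OF qr(2)] .
    then show "q = r" using inj_onD[OF chart_inj[OF smN cN(1)]] qr kcN by blast
  qed
  have \<iota>k: "\<iota> a = (snd cN \<circ> cinv k) a" if a: "a \<in> O'" for a
  proof -
    obtain q where q: "q \<in> fst k" "a = snd k q" using a im by auto
    have "cinv k a = q" using q inj by (simp add: cinv_def)
    then show ?thesis using fwd(2)[OF q(1)] q by (simp add: k_def)
  qed
  have "relopen L O'" using L O' by simp
  then have Ck: "Ck_on n L O' (snd cN \<circ> cinv k)" for n
    by (rule Ck_on_cong) (rule \<iota>k, assumption, rule \<iota>[rule_format])
  have ok: "openin (subtopology (mtop N) ?S) (fst k)"
    using oT by (auto simp: openin_subtopology k_def)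
  have "fibre_chart N ?S L cN \<kappa> k"
    unfolding fibre_chart_def im
  proof (intro conjI ballI allI)
    show "fst k \<subseteq> ?S" by (auto simp: k_def)
    show "snd k q = \<kappa> (snd cN q)" for q by (simp add: k_def)
  qed (use inj O' kcN in \<open>simp_all add: ok cN(1) \<kappa> Ck\<close>)
  moreover have "u \<in> fst k" using u cN U1 by (simp add: k_def T_def x0_def)
  ultimately show ?thesis by blast
qed

end

section \<open>Geodesics in the fibers\<close>

lemma Ck_on_Pair:
  fixes f :: "'e::euclidean_space \<Rightarrow> 'x::real_normed_vector" and g :: "'e \<Rightarrow> 'y::real_normed_vector"
  assumes ro: "relopen V U" and f: "Ck_on k V U f" and g: "Ck_on k V U g"
  shows "Ck_on k V U (\<lambda>x. (f x, g x))"
proof -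
  have 1: "bounded_linear (\<lambda>a::'x. (a, 0::'y))" "bounded_linear (\<lambda>b::'y. (0::'x, b))"
    by (intro bounded_linear_Pair bounded_linear_ident bounded_linear_zero)+
  have "Ck_on k V U (\<lambda>x. (f x, 0) + (0, g x))"
    by (rule Ck_on_add[OF ro Ck_on_bounded_linear[OF ro 1(1) f] Ck_on_bounded_linear[OF ro 1(2) g]])
  then show ?thesis by simp
qed

lemma Ck_on_empty: "Ck_on k V {} f"
  by (induction k arbitrary: f) auto

lemma curve_derivative:
  fixes X :: "real \<Rightarrow> 'w::real_normed_vector"
  assumes "Ck_on (Suc k) UNIV I X" "t \<in> I"
  shows "(X has_vector_derivative dird X t 1) (at t)"
  using line_derivative[OF assms(1) UNIV_I, of 0 t 1] assms(2) by simp

text \<open>By \<open>only\<close> no other chart meets the curve, so smoothness and the geodesic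
  equation hold there vacuously, and the transformation law of Christoffel symbols does not
  enter.\<close>

lemma geodesicI_chart:
  fixes F :: "('b, 'f::euclidean_space) riem"
  assumes smF: "smooth_manifold F" and k: "k \<in> atlas F" and I: "open I" "is_interval I"
    and x: "\<And>t. t \<in> I \<Longrightarrow> x t \<in> snd k ` fst k" "\<And>n. Ck_on n UNIV I x"
    and only: "\<And>c t. c \<in> atlas F \<Longrightarrow> c \<noteq> k \<Longrightarrow> t \<in> I \<Longrightarrow> cinv k (x t) \<notin> fst c"
    and v: "\<And>t. t \<in> I \<Longrightarrow> (x has_vector_derivative v t) (at t)"
    and a: "\<And>t. t \<in> I \<Longrightarrow> (v has_vector_derivative - christoffel F k (x t) (v t) (v t)) (at t)"
  shows "geodesic F I (\<lambda>t. cinv k (x t))"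
proof -
  have roI: "relopen UNIV I" using I by simp
  have sx: "snd k (cinv k (x t)) = x t" "cinv k (x t) \<in> fst k" if "t \<in> I" for t
    using cinv_right[OF x(1)[OF that]] cinv_in[OF x(1)[OF that]] by auto
  let ?\<gamma> = "\<lambda>t. cinv k (x t)"
  have "continuous_map (top_of_set I) (top_of_set (snd k ` fst k)) x"
    using Ck_on_continuous[OF x(2)] x(1) by (auto simp: continuous_map_in_subtopology)
  from continuous_map_compose[OF this cinv_continuous[OF smF k]]
  have cont: "continuous_map (top_of_set I) (mtop F) ?\<gamma>" by (simp add: o_def)
  have Cinf: "Cinf_on UNIV (I \<inter> ?\<gamma> -` fst c) (snd c \<circ> ?\<gamma>)" if c: "c \<in> atlas F" for c
  proof (cases "c = k")
    case True
    have "I \<inter> ?\<gamma> -` fst k = I" using sx by auto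
    moreover have "Cinf_on UNIV I (snd k \<circ> ?\<gamma>)"
      by (rule Cinf_on_cong[OF roI, of x]) (use sx x(2) in \<open>auto simp: Cinf_on_def\<close>)
    ultimately show ?thesis using True by simp
  next
    case False
    have "I \<inter> ?\<gamma> -` fst c = {}" using only[OF c False] by auto
    then show ?thesis by (simp add: Cinf_on_def Ck_on_empty)
  qed
  have eq: "vector_derivative (\<lambda>s. vector_derivative (snd k \<circ> ?\<gamma>) (at s)) (at t) +
      christoffel F k ((snd k \<circ> ?\<gamma>) t) (vector_derivative (snd k \<circ> ?\<gamma>) (at t)) (vector_derivative (snd k \<circ> ?\<gamma>) (at t)) = 0"
    if t: "t \<in> I" for t
  proof -
    have 1: "vector_derivative (snd k \<circ> ?\<gamma>) (at s) = v s" if s: "s \<in> I" for s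
    proof (rule vector_derivative_at)
      show "((snd k \<circ> ?\<gamma>) has_vector_derivative v s) (at s)"
        by (rule has_vector_derivative_transform_within_open[OF v[OF s] I(1) s]) (simp add: sx)
    qed
    have "((\<lambda>s. vector_derivative (snd k \<circ> ?\<gamma>) (at s)) has_vector_derivative - christoffel F k (x t) (v t) (v t)) (at t)"
      by (rule has_vector_derivative_transform_within_open[OF a[OF t] I(1) t]) (simp add: 1)
    then have "vector_derivative (\<lambda>s. vector_derivative (snd k \<circ> ?\<gamma>) (at s)) (at t) = - christoffel F k (x t) (v t) (v t)"
      by (rule vector_derivative_at)
    then show ?thesis using 1[OF t] sx[OF t] by simp
  qed
  show ?thesis
    unfolding geodesic_def smooth_curve_def Let_def
  proof (intro conjI ballI impI)
    fix c t assume "c \<in> atlas F" "t \<in> I" "?\<gamma> t \<in> fst c"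
    then have "c = k" using only by blast
    then show "vector_derivative (\<lambda>s. vector_derivative (snd c \<circ> ?\<gamma>) (at s)) (at t) +
      christoffel F c ((snd c \<circ> ?\<gamma>) t) (vector_derivative (snd c \<circ> ?\<gamma>) (at t)) (vector_derivative (snd c \<circ> ?\<gamma>) (at t)) = 0"
      using eq[OF \<open>t \<in> I\<close>] by simp
  qed (use I cont Cinf in auto)
qed

text \<open>The geodesic equation as a first-order system for position and velocity on
  \<open>B \<times> model F\<close>. Confining positions to \<open>B\<close> gives control over the
  region in which the geodesic runs.\<close>

lemma geodesic_ode:
  fixes F :: "('b, 'f::euclidean_space) riem"
  assumes RF: "riemannian_manifold F" and k: "k \<in> atlas F"
    and B: "openin (top_of_set (model F)) B" "B \<subseteq> snd k ` fst k" and a0: "a0 \<in> B" and v0: "v0 \<in> model F"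
  shows "\<exists>\<epsilon>>0. \<exists>x v. x 0 = a0 \<and> v 0 = v0 \<and> (\<forall>n. Ck_on n UNIV {-\<epsilon><..<\<epsilon>} x) \<and>
    (\<forall>t\<in>{-\<epsilon><..<\<epsilon>}. x t \<in> B \<and> (x has_vector_derivative v t) (at t) \<and>
       (v has_vector_derivative - christoffel F k (x t) (v t) (v t)) (at t))"
proof -
  let ?L = "model F" and ?S = "model F \<times> model F" and ?U = "B \<times> model F"
  note smF = riemannian_manifoldD(1)[OF RF]
  have L: "subspace ?L" by (rule smooth_manifoldD(1)[OF smF])
  have S: "subspace ?S" using L by (intro subspace_Times)
  obtain T where T: "open T" "B = ?L \<inter> T" using B(1) by (auto simp: openin_open)
  have "?U = ?S \<inter> (T \<times> UNIV)" using T by auto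
  then have ro: "relopen ?S ?U" using S T by (auto simp: openin_open intro!: exI[of _ "T \<times> UNIV"] open_Times)
  have roB: "relopen ?L B" using L B by simp
  define \<Phi> where "\<Phi> z = (snd z, - christoffel F k (fst z) (snd z) (snd z))" for z :: "'f \<times> 'f"
  have Bk: "x \<in> snd k ` fst k" if "x \<in> B" for x using that B by auto
  have "Ck_on n ?S ?U (\<lambda>z. christoffel F k (fst z) (snd z) (snd z))" for n
  proof (rule Ck_on_bilin_field[OF ro L, where b="\<lambda>z. christoffel F k (fst z)"])
    show "lin_on ?L (\<lambda>v. christoffel F k (fst z) v w)" if "z \<in> ?U" "w \<in> ?L" for z w
      by (rule christoffel_lin1[OF RF k Bk that(2)]) (use that in auto)
    show "lin_on ?L (christoffel F k (fst z) v)" if "z \<in> ?U" "v \<in> ?L" for z v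
      by (rule christoffel_lin2[OF RF k Bk that(2)]) (use that in auto)
    show "Ck_on n ?S ?U (\<lambda>z. christoffel F k (fst z) v w)" if "v \<in> ?L" "w \<in> ?L" for v w
      by (rule Ck_on_compose[OF ro roB _ Ck_on_linear[OF ro bounded_linear_fst]
            Ck_on_subset[OF christoffel_Ck[OF RF k that] B(2)]]) auto
  qed (auto intro!: Ck_on_linear[OF ro bounded_linear_snd])
  then have \<Phi>Ck: "Ck_on n ?S ?U \<Phi>" for n
    unfolding \<Phi>_def by (intro Ck_on_Pair[OF ro] Ck_on_minus[OF ro] Ck_on_linear[OF ro bounded_linear_snd])
  have \<Phi>S: "\<Phi> z \<in> ?S" if "z \<in> ?U" for z
    using that christoffel_props(1)[OF RF k Bk, of "fst z" "snd z" "snd z"] subspace_neg[OF L]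
    by (auto simp: \<Phi>_def)
  have z0: "(a0, v0) \<in> ?U" using a0 v0 by simp
  from ode_exists[OF ro \<Phi>Ck \<Phi>S z0]
  obtain \<epsilon> z where e: "\<epsilon> > 0" and z: "z 0 = (a0, v0)"
    and zU: "\<And>t. t \<in> {-\<epsilon><..<\<epsilon>} \<Longrightarrow> z t \<in> ?U" and dz: "\<And>t. t \<in> {-\<epsilon><..<\<epsilon>} \<Longrightarrow> (z has_vector_derivative \<Phi> (z t)) (at t)"
    by blast
  have zCk: "Ck_on n UNIV {-\<epsilon><..<\<epsilon>} z" for n
    by (rule ode_smooth[OF _ ro \<Phi>Ck zU dz]) auto
  have roI: "relopen UNIV {-\<epsilon><..<\<epsilon>}" by simp
  show ?thesis
  proof (rule exI[of _ \<epsilon>], rule conjI[OF e], rule exI[of _ "\<lambda>t. fst (z t)"], rule exI[of _ "\<lambda>t. snd (z t)"],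
      intro conjI allI ballI)
    show "Ck_on n UNIV {-\<epsilon><..<\<epsilon>} (\<lambda>t. fst (z t))" for n
      by (rule Ck_on_bounded_linear[OF roI bounded_linear_fst zCk])
    fix t assume t: "t \<in> {-\<epsilon><..<\<epsilon>}"
    show "fst (z t) \<in> B" using zU[OF t] by auto
    show "((\<lambda>t. fst (z t)) has_vector_derivative snd (z t)) (at t)"
      "((\<lambda>t. snd (z t)) has_vector_derivative - christoffel F k (fst (z t)) (snd (z t)) (snd (z t))) (at t)"
      using bounded_linear.has_vector_derivative[OF bounded_linear_fst dz[OF t]]
        bounded_linear.has_vector_derivative[OF bounded_linear_snd dz[OF t]] by (simp_all add: \<Phi>_def)
  qed (use z in auto)
qed

context submersion_at
begin

text \<open>The vertical space at \<open>u\<close> serves as model at every point of the fiber: the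
  locale facts instantiated at \<open>q\<close> show that the vertical spaces have equal
  dimension.\<close>

lemma fibre_cover:
  assumes "q \<in> points N" "\<pi> q = \<pi> u"
  shows "\<exists>c \<kappa> k. q \<in> fst k \<and> fibre_chart N {q \<in> points N. \<pi> q = \<pi> u} (vertical N M \<pi> u) c \<kappa> k"
proof -
  interpret Q: submersion_at M N \<pi> q
    by unfold_locales (use RM RN sub assms in auto)
  have "dim (vertical N M \<pi> u) = dim (vertical N M \<pi> q)"
    using dim_vertical Q.dim_vertical by simp
  from Q.fibre_chart_exists[OF vertical_subspace this] show ?thesis
    unfolding assms(2) by blast
qed

text \<open>\<open>phi\<close> is constant along the parametrized fiber, so the derivative of the
  parametrization takes values in the kernel of \<open>D x0\<close>. It is injective because
  \<open>\<kappa>\<close> inverts it, hence onto the kernel by equality of dimensions.\<close>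

lemma fibre_tangent:
  assumes k: "fibre_chart N {q \<in> points N. \<pi> q = \<pi> u} (vertical N M \<pi> u) cN \<kappa> k" and uk: "u \<in> fst k"
    and w: "w \<in> vertical N M \<pi> u"
  shows "\<exists>v\<in>vertical N M \<pi> u. dird (snd cN \<circ> cinv k) (snd k u) v = w"
proof -
  let ?L = "vertical N M \<pi> u" and ?i = "snd cN \<circ> cinv k" and ?S = "{q \<in> points N. \<pi> q = \<pi> u}"
  note d = fibre_chartD[OF k]
  have L: "subspace ?L" by (rule vertical_subspace)
  have ro: "relopen ?L (snd k ` fst k)" using L d(5) by blast
  have x: "snd k u \<in> snd k ` fst k" using uk by auto
  have i0: "?i (snd k u) = x0" using d(10)[OF uk] by (simp add: x0_def)
  note dl = lin_on_dird[OF ro d(9)[of "Suc 0"] x]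
  have im: "?i ` (snd k ` fst k) \<subseteq> Om"
    using d(2,7,10) cM(2) by (fastforce simp: Om_def)
  have K: "dird ?i (snd k u) a \<in> ?L" if a: "a \<in> ?L" for a
  proof -
    note df = Ck_on_differentiable[OF d(9)[of "Suc 0"] a x]
    have m: "dird ?i (snd k u) a \<in> model N"
      by (rule dird_in_subspace[OF ro df x a VN]) (use im Om_relopen relopen_subset in blast)
    have "D x0 (dird ?i (snd k u) a) = dird (\<lambda>y. phi (?i y)) (snd k u) a"
      using dird_chain(2)[OF ro Om_relopen d(9)[of "Suc 0"] phi_Ck[of "Suc 0"] im x a] i0 by simp
    also have "\<dots> = dird (\<lambda>y. y0) (snd k u) a"
    proof (rule dird_cong[OF ro x a])
      fix y assume "y \<in> snd k ` fst k"
      then obtain q where q: "q \<in> fst k" "y = snd k q" by auto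
      then have "q \<in> fst cN" "\<pi> q = \<pi> u" using d(2,7) by auto
      then show "phi (?i y) = y0" using phi_snd[of q] q d(10) by (simp add: y0_def)
    qed
    also have "\<dots> = 0" by (rule dird_eqI) simp
    finally show ?thesis using m by (simp add: vertical_u)
  qed
  have inj: "a = 0" if a: "a \<in> ?L" "dird ?i (snd k u) a = 0" for a
  proof -
    have "\<kappa> (dird ?i (snd k u) a) = a"
      by (rule fibre_chart_dird(1)[OF RN _ vertical_subspace k x a(1)]) auto
    then show ?thesis using a(2) linear_0[OF bounded_linear.linear[OF d(6)]] by simp
  qed
  let ?l = "\<lambda>a. dird ?i (snd k u) (oproj ?L a)"
  have lin: "linear ?l" by (rule linear_oproj_extension[OF L dl])
  have "inj_on ?l ?L"
  proof (rule inj_onI)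
    fix a b assume ab: "a \<in> ?L" "b \<in> ?L" "?l a = ?l b"
    have "a - b \<in> ?L" using ab L by (simp add: subspace_diff)
    moreover have "?l (a - b) = 0" using ab linear_diff[OF lin] by simp
    ultimately have "a - b = 0" using inj[of "a - b"] oproj_id[OF L, of "a - b"] by simp
    then show "a = b" by simp
  qed
  then have dl': "dim (?l ` ?L) = dim ?L"
    by (intro dim_image_eq[OF lin]) (simp add: span_eq_iff[THEN iffD2, OF L])
  have sub: "?l ` ?L \<subseteq> ?L" using K oproj_in[OF L] by auto
  have "?l ` ?L = ?L"
    by (rule subspace_dim_equal[OF linear_subspace_image[OF lin L] L sub]) (simp only: dl' order_refl)
  then obtain a where "a \<in> ?L" "?l a = w" using w by (metis (no_types, lifting) imageE)
  then show ?thesis using oproj_id[OF L] by auto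
qed

text \<open>The constant function \<open>phi (?X t)\<close> is differentiated twice. The first
  derivative gives \<open>D (?X t) (?X' t) = 0\<close>; the second gives \<open>D2 w w\<close> plus
  \<open>D x0\<close> of the acceleration, which the geodesic equation in \<open>N\<close>
  identifies as \<open>- \<Gamma> w w\<close>.\<close>

lemma second_form_along_curve:
  assumes geo: "geodesic N I \<gamma>" and I0: "0 \<in> I" and g0: "\<gamma> 0 = u"
    and fib: "\<And>t. t \<in> I \<Longrightarrow> \<gamma> t \<in> fst cN" "\<And>t. t \<in> I \<Longrightarrow> \<pi> (\<gamma> t) = \<pi> u"
    and w: "((snd cN \<circ> \<gamma>) has_vector_derivative w) (at 0)"
  shows "D2 w w = D x0 (\<Gamma> w w)"
proof -
  let ?X = "snd cN \<circ> \<gamma>"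
  let ?X' = "\<lambda>s. vector_derivative ?X (at s)"
  have I: "open I" using geo by (simp add: geodesic_def)
  have roI: "relopen UNIV I" using I by simp
  have "I \<inter> \<gamma> -` fst cN = I" using fib by auto
  then have XCk: "Ck_on k UNIV I ?X" for k
    using geo cN(1) unfolding geodesic_def smooth_curve_def Cinf_on_def by metis
  have dX: "(?X has_vector_derivative dird ?X s 1) (at s)" if "s \<in> I" for s
    by (rule curve_derivative[OF XCk that])
  have X': "?X' s = dird ?X s 1" if "s \<in> I" for s by (rule vector_derivative_at[OF dX[OF that]])
  have w': "?X' 0 = w" by (rule vector_derivative_at[OF w])
  have "Ck_on (Suc 0) UNIV I ?X'"
    by (rule Ck_on_cong[OF roI _ Ck_on_dird[OF XCk UNIV_I]]) (simp add: X')
  from curve_derivative[OF this I0]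
  have "?X' differentiable (at 0)" by (rule differentiableI_vector)
  then have dX': "(?X' has_vector_derivative vector_derivative ?X' (at 0)) (at 0)" by (simp add: vector_derivative_works)
  have geq: "vector_derivative ?X' (at 0) + \<Gamma> w w = 0"
    using geo I0 fib(1)[OF I0] cN(1) w' g0 unfolding geodesic_def Let_def by (auto simp: x0_def)
  have XOm: "?X t \<in> Om" if "t \<in> I" for t
    using fib[OF that] cM(2) by (auto simp: Om_def)
  have XV: "?X t \<in> model N" if "t \<in> I" for t using XOm[OF that] relopen_subset[OF Om_relopen] by auto
  have X0: "?X 0 = x0" by (simp add: g0 x0_def)
  have X'V: "?X' t \<in> model N" if t: "t \<in> I" for t
    unfolding X'[OF t]
    by (rule dird_in_subspace[OF roI Ck_on_differentiable[OF XCk UNIV_I t] t UNIV_I VN XV])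
  have evI: "\<forall>\<^sub>F s in nhds t. s \<in> I" if "t \<in> I" for t by (rule eventually_nhds_in_open[OF I that])
  have phiX: "phi (?X t) = y0" if "t \<in> I" for t
    using phi_snd[OF fib(1)[OF that]] fib(2)[OF that] by (simp add: y0_def)
  have zero: "D (?X t) (?X' t) = 0" if t: "t \<in> I" for t
  proof -
    have "((\<lambda>s. phi (?X s)) has_vector_derivative D (?X t) (?X' t)) (at t)"
    proof (rule curve_chain[where g="?X", OF Om_relopen phi_Ck _ XOm[OF t] X'V[OF t]])
      show "(?X has_vector_derivative ?X' t) (at t)" using dX[OF t] X'[OF t] by simp
      show "\<forall>\<^sub>F s in nhds t. s \<in> UNIV \<longrightarrow> ?X s \<in> model N" using evI[OF t] by (rule eventually_mono) (use XV in blast)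
    qed
    moreover have "((\<lambda>s. phi (?X s)) has_vector_derivative 0) (at t)"
      by (rule has_vector_derivative_transform_within_open[OF has_vector_derivative_const[of y0] I t]) (rule phiX[symmetric])
    ultimately show ?thesis by (rule vector_derivative_unique_at)
  qed
  have wV: "w \<in> model N" using X'V[OF I0] w' by simp
  have GV: "\<Gamma> w w \<in> model N" by (rule christoffel_props(1)[OF RN cN(1) x0(2) wV wV])
  have acc: "vector_derivative ?X' (at 0) = - \<Gamma> w w" using geq by (simp add: add_eq_0_iff2)
  have "((\<lambda>s. D (?X s) (?X' s)) has_vector_derivative dird (\<lambda>z. D z (?X' 0)) (?X 0) w + D (?X 0) (- \<Gamma> w w)) (at 0)"
  proof (rule lin_curve[OF Om_relopen VN D_lin Ck_on_dird[OF phi_Ck]])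
    show "(?X has_vector_derivative w) (at 0)" by (rule w)
    show "(?X' has_vector_derivative - \<Gamma> w w) (at 0)" using dX' acc by simp
    show "\<forall>\<^sub>F s in nhds 0. ?X s \<in> Om" using evI[OF I0] by (rule eventually_mono) (rule XOm)
    show "\<forall>\<^sub>F s in nhds 0. ?X' s \<in> model N" using evI[OF I0] by (rule eventually_mono) (rule X'V)
    show "- \<Gamma> w w \<in> model N" using GV VN by (simp add: subspace_neg)
  qed (use XOm[OF I0] wV X'V[OF I0] in auto)
  moreover have "((\<lambda>s. D (?X s) (?X' s)) has_vector_derivative 0) (at 0)"
    by (rule has_vector_derivative_transform_within_open[OF has_vector_derivative_const[of 0] I I0]) (rule zero[symmetric])
  ultimately have "dird (\<lambda>z. D z (?X' 0)) (?X 0) w + D (?X 0) (- \<Gamma> w w) = 0" by (rule vector_derivative_unique_at)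
  then have "D2 w w + D x0 (- \<Gamma> w w) = 0" unfolding w' X0 .
  moreover have "D x0 (- \<Gamma> w w) = - D x0 (\<Gamma> w w)"
    using lin_on_scale[OF D_lin[OF x0(1)] GV, of "-1"] by simp
  ultimately show ?thesis by (simp add: add_eq_0_iff2)
qed

text \<open>The atlas of the fiber is chosen with a single chart near \<open>u\<close>, so that the geodesic equation,
  which is required in all charts, needs to be solved in one chart only.\<close>

lemma vertical_second_form:
  assumes tg: "totally_geodesic_fibers N M \<pi>" and w: "w \<in> vertical N M \<pi> u"
  shows "D2 w w = D x0 (\<Gamma> w w)"
proof -
  let ?S = "{q \<in> points N. \<pi> q = \<pi> u}" and ?L = "vertical N M \<pi> u"
  have S: "?S \<subseteq> points N" by auto
  have L: "subspace ?L" by (rule vertical_subspace)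
  obtain \<kappa> k where uk: "u \<in> fst k" and k: "fibre_chart N ?S ?L cN \<kappa> k"
    using fibre_chart_exists[OF L refl] by blast
  note d = fibre_chartD[OF k]
  let ?a0 = "snd k u"
  have ro: "relopen ?L (snd k ` fst k)" using L d(5) by blast
  have a0L: "?a0 \<in> ?L" using relopen_subset[OF ro] uk by auto
  obtain r0 where r0: "r0 > 0" "\<And>y. y \<in> ?L \<Longrightarrow> dist y ?a0 < r0 \<Longrightarrow> y \<in> snd k ` fst k"
    using relopen_ball[OF ro imageI[OF uk]] by blast
  define r where "r = r0 / 2"
  have r: "r > 0" "r < r0" using r0(1) by (auto simp: r_def)
  \<comment> \<open>The closed ball is compact and stays in the chart image because its radius is
    half of \<open>r0\<close>; the open ball \<open>B\<close> inside it is where the geodesic is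
    solved.\<close>
  define Cb where "Cb = ?L \<inter> cball ?a0 r"
  define B where "B = ?L \<inter> ball ?a0 r"
  have CbO: "Cb \<subseteq> snd k ` fst k" using r0(2) r(2) by (auto simp: Cb_def dist_commute)
  have BCb: "B \<subseteq> Cb" by (auto simp: B_def Cb_def)
  define C where "C = cinv k ` Cb"
  have "compact Cb" unfolding Cb_def by (intro closed_Int_compact closed_subspace L compact_cball)
  then have "compactin (top_of_set (snd k ` fst k)) Cb" using CbO by (simp add: compactin_subtopology)
  then have "compactin (mtop N) C"
    unfolding C_def using fibre_chart_cinv_continuous[OF RN S L k] by (rule image_compactin)
  then have "closedin (mtop N) C"
    using smooth_manifoldD(3)[OF smN] by (rule compactin_imp_closedin[rotated])
  then have oC: "openin (mtop N) (points N - C)" by (simp add: closedin_def)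
  \<comment> \<open>All charts other than \<open>k\<close> avoid \<open>C\<close>. They still cover
    the rest of the fiber, since \<open>C\<close> is contained in the domain of \<open>k\<close>
    and, being compact in a Hausdorff space, is closed, so restricting a chart to its complement is
    allowed.\<close>
  define A where "A = insert k {k'. (\<exists>c \<kappa>. fibre_chart N ?S ?L c \<kappa> k') \<and> fst k' \<inter> C = {}}"
  have Ach: "\<exists>c \<kappa>. fibre_chart N ?S ?L c \<kappa> k'" if "k' \<in> A" for k' using that k unfolding A_def by blast
  have CK: "C \<subseteq> fst k" using CbO d(10) by (auto simp: C_def)
  have cover: "\<Union> (fst ` A) = ?S"
  proof
    show "\<Union> (fst ` A) \<subseteq> ?S" using Ach fibre_chartD(2) by fastforce
    show "?S \<subseteq> \<Union> (fst ` A)"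
    proof
      fix q assume q: "q \<in> ?S"
      show "q \<in> \<Union> (fst ` A)"
      proof (cases "q \<in> fst k")
        case True then show ?thesis by (auto simp: A_def)
      next
        case False
        obtain c \<kappa>' k' where k': "q \<in> fst k'" "fibre_chart N ?S ?L c \<kappa>' k'" using fibre_cover[of q] q by auto
        let ?k = "(fst k' \<inter> (points N - C), snd k')"
        have "fibre_chart N ?S ?L c \<kappa>' ?k" by (rule fibre_chart_restrict[OF RN S L k'(2) oC])
        moreover have "fst ?k \<inter> C = {}" by auto
        ultimately have "?k \<in> A" unfolding A_def by blast
        moreover have "q \<in> fst ?k" using k' q False CK by auto
        ultimately show ?thesis by blast
      qed
    qed
  qed
  let ?F = "fibre_manifold N ?S ?L A"
  have RF: "riemannian_manifold ?F" by (rule fibre_riemannian[OF RN S L Ach cover])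
  have subF: "riem_submanifold N ?S ?F" by (rule fibre_riem_submanifold[OF RN S L Ach cover])
  have kF: "k \<in> atlas ?F" by (simp add: fibre_manifold_def Let_def A_def)
  have mF: "model ?F = ?L" by (simp add: fibre_manifold_def Let_def)
  have aF: "atlas ?F = A" by (simp add: fibre_manifold_def Let_def)
  \<comment> \<open>The initial velocity in the fiber chart that corresponds to \<open>w\<close> in
    the ambient chart.\<close>
  obtain v0 where v0: "v0 \<in> ?L" "dird (snd cN \<circ> cinv k) ?a0 v0 = w"
    using fibre_tangent[OF k uk w] by blast
  have "openin (top_of_set (model ?F)) B" unfolding mF B_def by (auto simp: openin_open)
  moreover have "B \<subseteq> snd k ` fst k" using BCb CbO by auto
  moreover have "?a0 \<in> B" using a0L r by (simp add: B_def)
  ultimately obtain \<epsilon> x v where e: "\<epsilon> > 0" and xv: "x 0 = ?a0" "v 0 = v0" and xCk: "\<And>n. Ck_on n UNIV {-\<epsilon><..<\<epsilon>} x"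
    and xB: "\<And>t. t \<in> {-\<epsilon><..<\<epsilon>} \<Longrightarrow> x t \<in> B"
    and dx: "\<And>t. t \<in> {-\<epsilon><..<\<epsilon>} \<Longrightarrow> (x has_vector_derivative v t) (at t)"
    and dv: "\<And>t. t \<in> {-\<epsilon><..<\<epsilon>} \<Longrightarrow> (v has_vector_derivative - christoffel ?F k (x t) (v t) (v t)) (at t)"
    using geodesic_ode[OF RF kF, of B ?a0 v0] v0(1) unfolding mF by blast
  let ?I = "{-\<epsilon><..<\<epsilon>}" and ?\<gamma> = "\<lambda>t. cinv k (x t)"
  have I0: "0 \<in> ?I" using e by simp
  have xO: "x t \<in> snd k ` fst k" if "t \<in> ?I" for t using xB[OF that] BCb CbO by auto
  have gk: "?\<gamma> t \<in> fst k" if "t \<in> ?I" for t by (rule cinv_in[OF xO[OF that]])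
  have "geodesic ?F ?I ?\<gamma>"
  proof (rule geodesicI_chart[OF riemannian_manifoldD(1)[OF RF] kF _ _ xO xCk _ dx dv])
    \<comment> \<open>Positions in \<open>B\<close> lie in the closed ball, so the curve runs inside
      \<open>C\<close>, which every chart other than \<open>k\<close> avoids.\<close>
    show "cinv k (x t) \<notin> fst c" if "c \<in> atlas ?F" "c \<noteq> k" "t \<in> ?I" for c t
    proof -
      have "cinv k (x t) \<in> C" using xB[OF that(3)] BCb by (auto simp: C_def)
      moreover have "c \<in> A" using that(1) unfolding aF .
      ultimately show ?thesis using that(2) unfolding A_def by blast
    qed
  qed (auto simp: is_interval_oo)
  moreover have "\<pi> u \<in> points M" by (rule pi_points[OF u])
  ultimately have geo: "geodesic N ?I ?\<gamma>"
    using tg subF unfolding totally_geodesic_fibers_def by blast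
  show ?thesis
  proof (rule second_form_along_curve[OF geo I0])
    show "?\<gamma> 0 = u" using xv d(10)[OF uk] by simp
    show "?\<gamma> t \<in> fst cN" "\<pi> (?\<gamma> t) = \<pi> u" if "t \<in> ?I" for t
      using gk[OF that] d(2,7) by auto
    have "((\<lambda>t. (snd cN \<circ> cinv k) (x t)) has_vector_derivative dird (snd cN \<circ> cinv k) (x 0) v0) (at 0)"
    proof (rule curve_chain[OF ro d(9)])
      show "(x has_vector_derivative v0) (at 0)" using dx[OF I0] xv by simp
      show "x 0 \<in> snd k ` fst k" by (rule xO[OF I0])
      have "\<forall>\<^sub>F s in nhds 0. s \<in> ?I" using I0 by (intro eventually_nhds_in_open) auto
      then show "\<forall>\<^sub>F s in nhds 0. s \<in> UNIV \<longrightarrow> x s \<in> ?L"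
        by (rule eventually_mono) (use xB in \<open>auto simp: B_def\<close>)
    qed (rule v0(1))
    then show "((snd cN \<circ> ?\<gamma>) has_vector_derivative w) (at 0)" using v0(2) xv by (simp add: o_def)
  qed
qed

end

theorem corollary4p5:
  fixes M :: "('a, 'e::euclidean_space) riem"
    and N :: "('b, 'f::euclidean_space) riem"
    and \<pi> :: "'b \<Rightarrow> 'a"
    and f :: "'a \<Rightarrow> real"
  assumes "riemannian_manifold M" and "riemannian_manifold N"
    and "riemannian_submersion N M \<pi>"
    and "totally_geodesic_fibers N M \<pi>"
    and "bracket_generating N (horizontal N M \<pi>)"
    and "smooth_fun M (points M) f"
    and "u \<in> points N"
  shows "horizontal_laplacian N M \<pi> (f \<circ> \<pi>) u = laplace_beltrami M f (\<pi> u)"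
proof -
  interpret submersion_at M N \<pi> u
    by unfold_locales (use assms in auto)
  show ?thesis
    by (rule horizontal_laplacian_lift[OF vertical_second_form[OF assms(4)] assms(6)])
qed

end
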